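(* Let $q\in(0,1)$. $\mathrm{Pol}(\mathbb{C})_q[[t]]$, with the multiplication $m$ and the involution $*$ described in the context, is a $U_q\mathfrak{su}_{1,1}$-module algebra.
   Context: The ground field is $\mathbb{C}$, $q\in(0,1)$, $\mathbb{Z}_+=\{0,1,2,\dots\}$, and $(a;q^2)_k=(1-a)(1-q^2a)\cdots(1-q^{2(k-1)}a)$ (empty product equal to $1$). $\mathrm{Pol}(\mathbb{C})_q$ is the unital algebra with two generators $z,z^*$ and the single relation $z^*z=q^2zz^*+1-q^2$; the elements $\{z^jz^{*k}\}_{j,k\in\mathbb{Z}_+}$ form a basis of it. It is an involutive algebra: $f\mapsto f^*$ is the antilinear antiautomorphism with $z\mapsto z^*$, $z^*\mapsto z$. **Differential calculus.** $\Omega^1(\mathbb{C})_q$ is the first order differential calculus over $\mathrm{Pol}(\mathbb{C})_q$: a bimodule with a linear map $d:\mathrm{Pol}(\mathbb{C})_q\to\Omega^1(\mathbb{C})_q$ satisfying the Leibniz rule $d(f_1f_2)=df_1\cdot f_2+f_1\cdot df_2$, spanned by the elements $f_1\cdot df_2\cdot f_3$, and described by the commutation relations $$z\,dz=q^{-2}dz\,z,\quad z^*dz^*=q^2dz^*\,z^*,\quad z^*dz=q^2dz\,z^*,\quad z\,dz^*=q^{-2}dz^*\,z.$$ The partial derivatives are the linear operators in $\mathrm{Pol}(\mathbb{C})_q$ given by $$df=\frac{\partial^{(r)}f}{\partial z}dz+\frac{\partial^{(r)}f}{\partial z^*}dz^*=dz\frac{\partial^{(l)}f}{\partial z}+dz^*\frac{\partial^{(l)}f}{\partial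 z^*}.$$ **Multiplication and involution in $\mathrm{Pol}(\mathbb{C})_q[[t]]$.** $m_0:\mathrm{Pol}(\mathbb{C})_q^{\otimes2}\to\mathrm{Pol}(\mathbb{C})_q$ is $m_0(f_1\otimes f_2)=f_1f_2$, and $\widetilde\square:\mathrm{Pol}(\mathbb{C})_q^{\otimes2}\to\mathrm{Pol}(\mathbb{C})_q^{\otimes2}$ is the linear operator $$\widetilde\square(f_1\otimes f_2)=\Big(\frac{\partial^{(r)}f_1}{\partial z^*}\otimes1\Big)\cdot q^{-2}\big(1-(1+q^{-2})z^*\otimes z+q^{-2}z^{*2}\otimes z^2\big)\cdot\Big(1\otimes\frac{\partial^{(l)}f_2}{\partial z}\Big),$$ with products taken in the ordinary (componentwise) tensor product algebra. For $k\in\mathbb{Z}_+$ put $$p_k(x)=\sum_{j=0}^k\frac{(q^{-2k};q^2)_j}{(q^2;q^2)_j^2}\,q^{2j}\prod_{i=0}^{j-1}\Big(1-q^{2i}\big((1-q^2)^2x+1+q^2\big)+q^{4i+2}\Big).$$ For $f_1,f_2\in\mathrm{Pol}(\mathbb{C})_q$, $$f_1*f_2=f_1\cdot f_2+\sum_{k=1}^\infty C_k(f_1,f_2)t^k\in\mathrm{Pol}(\mathbb{C})_q[[t]],\qquad C_k(f_1,f_2)=m_0\Big(\big(p_k(\widetilde\square)-p_{k-1}(\widetilde\square)\big)(f_1\otimes f_2)\Big).$$ The multiplication $m$ in $\mathrm{Pol}(\mathbb{C})_q[[t]]$ is the bilinear map $$m\Big(\sum_{j=0}^\infty a_jt^j,\sum_{k=0}^\infty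 b_kt^k\Big)=\sum_{i=0}^\infty\Big(\sum_{j+k=i}a_j*b_k\Big)t^i,\qquad a_j,b_k\in\mathrm{Pol}(\mathbb{C})_q,$$ and the involution is $\big(\sum_jf_jt^j\big)^*=\sum_jf_j^*t^j$. **The Hopf $*$-algebra.** $U_q\mathfrak{sl}_2$ is the Hopf algebra over $\mathbb{C}$ with generators $K,K^{-1},E,F$ and relations $$KK^{-1}=K^{-1}K=1,\quad K^{\pm1}E=q^{\pm2}EK^{\pm1},\quad K^{\pm1}F=q^{\mp2}FK^{\pm1},\quad EF-FE=\frac{K-K^{-1}}{q-q^{-1}},$$ comultiplication $\Delta(K^{\pm1})=K^{\pm1}\otimes K^{\pm1}$, $\Delta(E)=E\otimes1+K\otimes E$, $\Delta(F)=F\otimes K^{-1}+1\otimes F$, counit $\varepsilon(E)=\varepsilon(F)=\varepsilon(K^{\pm1}-1)=0$, antipode $S(K^{\pm1})=K^{\mp1}$, $S(E)=-K^{-1}E$, $S(F)=-FK$. $U_q\mathfrak{su}_{1,1}$ is the Hopf $*$-algebra obtained by equipping $U_q\mathfrak{sl}_2$ with the (antilinear, antimultiplicative) involution $E^*=-KF$, $F^*=-EK^{-1}$, $(K^{\pm1})^*=K^{\pm1}$. **Module algebras.** An algebra $A$ which is also a $U_q\mathfrak{sl}_2$-module is a $U_q\mathfrak{sl}_2$-module algebra if its multiplication $A\otimes A\to A$ is a morphism of $U_q\mathfrak{sl}_2$-modules (the tensor product being a module via $\Delta$) and, when $A$ has a unit, $\xi\cdot1=\varepsilon(\xi)1$ for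 all $\xi\in U_q\mathfrak{sl}_2$. An involutive algebra $A$ is a $U_q\mathfrak{su}_{1,1}$-module algebra if it is a $U_q\mathfrak{sl}_2$-module algebra and $(\xi f)^*=(S(\xi))^*f^*$ for all $\xi\in U_q\mathfrak{su}_{1,1}$, $f\in A$. **The action.** With its original multiplication and involution, $\mathrm{Pol}(\mathbb{C})_q$ is a $U_q\mathfrak{su}_{1,1}$-module algebra (known fact) whose structure is determined by $$K^{\pm1}z=q^{\pm2}z,\qquad Fz=q^{1/2},\qquad Ez=-q^{1/2}z^2$$ (the action on $z^*$ being determined by $(\xi f)^*=(S(\xi))^*f^*$: $K^{\pm1}z^*=q^{\mp2}z^*$, $Ez^*=q^{-3/2}$, $Fz^*=-q^{5/2}z^{*2}$). The space $\mathrm{Pol}(\mathbb{C})_q[[t]]$ carries the coefficientwise action $\xi\big(\sum_jf_jt^j\big)=\sum_j(\xi f_j)t^j$. *)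

theory Defs
  imports
    Complex_Main
    "HOL-Library.Poly_Mapping"
    "HOL-Library.Product_Plus"
    "HOL-Computational_Algebra.Polynomial"
    "HOL-Computational_Algebra.Formal_Power_Series"
begin

section \<open>Complex vector spaces and algebras\<close>

class scaleC =
  fixes scaleC :: "complex \<Rightarrow> 'a \<Rightarrow> 'a" (infixr \<open>*\<^sub>C\<close> 75)

class complex_vector = scaleC + ab_group_add +
  assumes scaleC_add_right: "a *\<^sub>C (x + y) = a *\<^sub>C x + a *\<^sub>C y"
    and scaleC_add_left: "(a + b) *\<^sub>C x = a *\<^sub>C x + b *\<^sub>C x"
    and scaleC_scaleC: "a *\<^sub>C b *\<^sub>C x = (a * b) *\<^sub>C x"
    and scaleC_one: "1 *\<^sub>C x = x"

class complex_algebra_1 = complex_vector + ring_1 +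
  assumes mult_scaleC_left: "(a *\<^sub>C x) * y = a *\<^sub>C (x * y)"
    and mult_scaleC_right: "x * (a *\<^sub>C y) = a *\<^sub>C (x * y)"

global_interpretation complex_vector:
  vector_space "scaleC :: complex \<Rightarrow> 'a \<Rightarrow> 'a::complex_vector"
  by unfold_locales
    (rule scaleC_add_right scaleC_add_left scaleC_scaleC scaleC_one)+

abbreviation clinear :: "('a::complex_vector \<Rightarrow> 'b::complex_vector) \<Rightarrow> bool"
  where "clinear \<equiv> Vector_Spaces.linear scaleC scaleC"

definition cbilinear ::
    "('a::complex_vector \<Rightarrow> 'b::complex_vector \<Rightarrow> 'c::complex_vector) \<Rightarrow> bool"
  where "cbilinear f \<longleftrightarrow> (\<forall>x. clinear (f x)) \<and> (\<forall>y. clinear (\<lambda>x. f x y))"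

definition antilinear :: "('a::complex_vector \<Rightarrow> 'b::complex_vector) \<Rightarrow> bool"
  where "antilinear f \<longleftrightarrow>
    (\<forall>x y. f (x + y) = f x + f y) \<and> (\<forall>c x. f (c *\<^sub>C x) = cnj c *\<^sub>C f x)"

lemma clinearI:
  assumes "\<And>x y. f (x + y) = f x + f y" "\<And>c x. f (c *\<^sub>C x) = c *\<^sub>C f x"
  shows "clinear f"
  using assms by unfold_locales auto


instantiation complex :: complex_algebra_1
begin
definition scaleC_complex :: "complex \<Rightarrow> complex \<Rightarrow> complex"
  where "scaleC_complex = (*)"
instance by standard (auto simp: scaleC_complex_def algebra_simps)
end

instantiation prod :: (complex_vector, complex_vector) complex_vector
begin
definition scaleC_prod :: "complex \<Rightarrow> 'a \<times> 'b \<Rightarrow> 'a \<times> 'b"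
  where "scaleC_prod c x = (c *\<^sub>C fst x, c *\<^sub>C snd x)"
instance
  by standard
    (auto simp: scaleC_prod_def plus_prod_def scaleC_add_right scaleC_add_left scaleC_scaleC scaleC_one)
end

instantiation fps :: (complex_vector) complex_vector
begin
definition scaleC_fps :: "complex \<Rightarrow> 'a fps \<Rightarrow> 'a fps"
  where "scaleC_fps c f = Abs_fps (\<lambda>n. c *\<^sub>C fps_nth f n)"
instance
  by standard
    (auto simp: scaleC_fps_def fps_eq_iff scaleC_add_right scaleC_add_left scaleC_scaleC scaleC_one)
end

instantiation poly_mapping :: (type, complex_vector) complex_vector
begin
lift_definition scaleC_poly_mapping :: "complex \<Rightarrow> ('a \<Rightarrow>\<^sub>0 'b) \<Rightarrow> 'a \<Rightarrow>\<^sub>0 'b"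
  is "\<lambda>c f k. c *\<^sub>C f k"
proof -
  fix c and f :: "'a \<Rightarrow> 'b"
  assume "finite {x. f x \<noteq> 0}"
  then show "finite {x. c *\<^sub>C f x \<noteq> 0}"
    by (rule rev_finite_subset) auto
qed
instance
  by standard
    (transfer, auto simp: fun_eq_iff scaleC_add_right scaleC_add_left scaleC_scaleC scaleC_one)+
end


section \<open>Tensor products\<close>

definition lin_ext :: "('k \<Rightarrow> 'v::complex_vector) \<Rightarrow> ('k \<Rightarrow>\<^sub>0 complex) \<Rightarrow> 'v"
  where "lin_ext f x = (\<Sum>k\<in>Poly_Mapping.keys x. Poly_Mapping.lookup x k *\<^sub>C f k)"

lemma lin_ext_superset:
  assumes "finite A" "Poly_Mapping.keys x \<subseteq> A"
  shows "lin_ext f x = (\<Sum>k\<in>A. Poly_Mapping.lookup x k *\<^sub>C f k)"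
  unfolding lin_ext_def using assms
  by (intro sum.mono_neutral_left) (auto simp: in_keys_iff)

lemma clinear_lin_ext: "clinear (lin_ext f)"
proof (rule clinearI)
  fix x y :: "'a \<Rightarrow>\<^sub>0 complex" and c
  let ?A = "Poly_Mapping.keys x \<union> Poly_Mapping.keys y"
  have "lin_ext f (x + y) = (\<Sum>k\<in>?A. Poly_Mapping.lookup (x + y) k *\<^sub>C f k)"
    by (rule lin_ext_superset) (auto simp: Poly_Mapping.keys_add)
  also have "\<dots> = lin_ext f x + lin_ext f y"
    by (simp add: lin_ext_superset[of ?A] lookup_add scaleC_add_left sum.distrib)
  finally show "lin_ext f (x + y) = lin_ext f x + lin_ext f y" .
  have "lin_ext f (c *\<^sub>C x) = (\<Sum>k\<in>Poly_Mapping.keys x. Poly_Mapping.lookup (c *\<^sub>C x) k *\<^sub>C f k)"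
    by (rule lin_ext_superset) (auto simp: in_keys_iff scaleC_poly_mapping.rep_eq)
  also have "\<dots> = c *\<^sub>C lin_ext f x"
    by (simp add: lin_ext_def scaleC_poly_mapping.rep_eq scaleC_complex_def
        complex_vector.scale_sum_right)
  finally show "lin_ext f (c *\<^sub>C x) = c *\<^sub>C lin_ext f x" .
qed

lemma lin_ext_single [simp]: "lin_ext f (Poly_Mapping.single k c) = c *\<^sub>C f k"
  by (cases "c = 0") (auto simp: lin_ext_def)

lemma poly_mapping_sum_single:
  fixes x :: "'k \<Rightarrow>\<^sub>0 complex"
  shows "x = (\<Sum>k\<in>Poly_Mapping.keys x. Poly_Mapping.lookup x k *\<^sub>C Poly_Mapping.single k 1)"
  by (rule poly_mapping_eqI)
    (auto simp: lookup_sum lookup_single scaleC_poly_mapping.rep_eq scaleC_complex_def when_def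
      in_keys_iff if_distrib[of "(*) c" for c] cong: if_cong)

lemma
  assumes "clinear f"
  shows clinear_add: "f (x + y) = f x + f y"
    and clinear_scaleC: "f (c *\<^sub>C x) = c *\<^sub>C f x"
    and clinear_diff: "f (x - y) = f x - f y"
    and clinear_zero: "f 0 = 0"
proof -
  interpret Vector_Spaces.linear scaleC scaleC f by fact
  show "f (x + y) = f x + f y" "f (c *\<^sub>C x) = c *\<^sub>C f x" "f (x - y) = f x - f y" "f 0 = 0"
    by (rule add scale diff zero)+
qed

lemma cbilinearD:
  assumes "cbilinear f"
  shows "f (x + x') y = f x y + f x' y" "f x (y + y') = f x y + f x y'"
    "f (c *\<^sub>C x) y = c *\<^sub>C f x y" "f x (c *\<^sub>C y) = c *\<^sub>C f x y"
  using assms clinear_add clinear_scaleC unfolding cbilinear_def by metis+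

lemma cbilinearI:
  assumes "\<And>x x' y. f (x + x') y = f x y + f x' y" "\<And>x y y'. f x (y + y') = f x y + f x y'"
    "\<And>c x y. f (c *\<^sub>C x) y = c *\<^sub>C f x y" "\<And>c x y. f x (c *\<^sub>C y) = c *\<^sub>C f x y"
  shows "cbilinear f"
  unfolding cbilinear_def using assms by (auto intro: clinearI)

definition tensor_rels :: "('a::complex_vector \<times> 'b::complex_vector \<Rightarrow>\<^sub>0 complex) set"
  where "tensor_rels =
    {Poly_Mapping.single (x + x', y) 1 - Poly_Mapping.single (x, y) 1
       - Poly_Mapping.single (x', y) 1 | x x' y. True}
    \<union> {Poly_Mapping.single (x, y + y') 1 - Poly_Mapping.single (x, y) 1
       - Poly_Mapping.single (x, y') 1 | x y y'. True}
    \<union> {Poly_Mapping.single (c *\<^sub>C x, y) 1 - c *\<^sub>C Poly_Mapping.single (x, y) 1 | c x y. True}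
    \<union> {Poly_Mapping.single (x, c *\<^sub>C y) 1 - c *\<^sub>C Poly_Mapping.single (x, y) 1 | c x y. True}"

definition tensor_eq ::
    "('a::complex_vector \<times> 'b::complex_vector \<Rightarrow>\<^sub>0 complex) \<Rightarrow> ('a \<times> 'b \<Rightarrow>\<^sub>0 complex) \<Rightarrow> bool"
  where "tensor_eq x y \<longleftrightarrow> x - y \<in> complex_vector.span tensor_rels"

lemma equivp_tensor_eq:
  "equivp (tensor_eq :: ('a::complex_vector \<times> 'b::complex_vector \<Rightarrow>\<^sub>0 complex) \<Rightarrow> _)"
proof (rule equivpI)
  show "reflp (tensor_eq :: ('a \<times> 'b \<Rightarrow>\<^sub>0 complex) \<Rightarrow> _)"
    by (auto intro!: reflpI simp: tensor_eq_def complex_vector.span_zero)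
  show "symp (tensor_eq :: ('a \<times> 'b \<Rightarrow>\<^sub>0 complex) \<Rightarrow> _)"
  proof (rule sympI)
    fix x y :: "'a \<times> 'b \<Rightarrow>\<^sub>0 complex"
    assume "tensor_eq x y"
    then have "- (x - y) \<in> complex_vector.span tensor_rels"
      unfolding tensor_eq_def by (rule complex_vector.span_neg)
    then show "tensor_eq y x" by (simp add: tensor_eq_def)
  qed
  show "transp (tensor_eq :: ('a \<times> 'b \<Rightarrow>\<^sub>0 complex) \<Rightarrow> _)"
  proof (rule transpI)
    fix x y z :: "'a \<times> 'b \<Rightarrow>\<^sub>0 complex"
    assume "tensor_eq x y" "tensor_eq y z"
    then have "(x - y) + (y - z) \<in> complex_vector.span tensor_rels"
      unfolding tensor_eq_def by (rule complex_vector.span_add)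
    then show "tensor_eq x z" by (simp add: tensor_eq_def)
  qed
qed

quotient_type (overloaded) ('a, 'b) tensor = "'a::complex_vector \<times> 'b::complex_vector \<Rightarrow>\<^sub>0 complex" / tensor_eq
  morphisms rep_tensor abs_tensor
  by (rule equivp_tensor_eq)

instantiation tensor :: (complex_vector, complex_vector) complex_vector
begin
lift_definition zero_tensor :: "('a, 'b) tensor" is 0 .
lift_definition plus_tensor :: "('a, 'b) tensor \<Rightarrow> ('a, 'b) tensor \<Rightarrow> ('a, 'b) tensor" is "(+)"
  unfolding tensor_eq_def
  by (simp add: add_diff_add complex_vector.span_add)
lift_definition uminus_tensor :: "('a, 'b) tensor \<Rightarrow> ('a, 'b) tensor" is uminus
  unfolding tensor_eq_def
  by (simp only: minus_diff_minus complex_vector.span_neg)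
lift_definition minus_tensor :: "('a, 'b) tensor \<Rightarrow> ('a, 'b) tensor \<Rightarrow> ('a, 'b) tensor" is "(-)"
proof -
  fix x x' y y' :: "'a \<times> 'b \<Rightarrow>\<^sub>0 complex"
  assume "tensor_eq x x'" "tensor_eq y y'"
  then have "(x - x') - (y - y') \<in> complex_vector.span tensor_rels"
    unfolding tensor_eq_def by (rule complex_vector.span_diff)
  then show "tensor_eq (x - y) (x' - y')"
    unfolding tensor_eq_def by (simp add: algebra_simps)
qed
lift_definition scaleC_tensor :: "complex \<Rightarrow> ('a, 'b) tensor \<Rightarrow> ('a, 'b) tensor" is scaleC
  unfolding tensor_eq_def
  by (simp only: complex_vector.scale_right_diff_distrib[symmetric] complex_vector.span_scale)
instance
  by standard
    (transfer, simp add: tensor_eq_def complex_vector.span_zero add_ac scaleC_add_right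
      scaleC_add_left scaleC_scaleC scaleC_one)+
end

lift_definition tens :: "'a::complex_vector \<Rightarrow> 'b::complex_vector \<Rightarrow> ('a, 'b) tensor"
    (infix \<open>\<otimes>\<close> 72)
  is "\<lambda>x y. Poly_Mapping.single (x, y) 1" .

text \<open>The linear map on the tensor product induced by a bilinear map; for bilinear maps the choice
  of the representative does not matter (see \<open>tensor_lift_tens\<close>, \<open>clinear_tensor_lift\<close> below).\<close>

definition tensor_lift ::
    "('a::complex_vector \<Rightarrow> 'b::complex_vector \<Rightarrow> 'c::complex_vector) \<Rightarrow> ('a, 'b) tensor \<Rightarrow> 'c"
  where "tensor_lift f t = lin_ext (case_prod f) (rep_tensor t)"

definition tensor_map ::
    "('a::complex_vector \<Rightarrow> 'c::complex_vector) \<Rightarrow> ('b::complex_vector \<Rightarrow> 'd::complex_vector)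
      \<Rightarrow> ('a, 'b) tensor \<Rightarrow> ('c, 'd) tensor"
  where "tensor_map f g = tensor_lift (\<lambda>x y. f x \<otimes> g y)"

lemma cbilinear_tens: "cbilinear (\<otimes>)"
proof (rule cbilinearI; transfer)
  fix x x' :: 'a and y y' :: 'b and c
  show "tensor_eq (Poly_Mapping.single (x + x', y) 1)
      (Poly_Mapping.single (x, y) 1 + Poly_Mapping.single (x', y) 1)"
    unfolding tensor_eq_def diff_diff_eq[symmetric]
    by (rule complex_vector.span_base) (unfold tensor_rels_def, blast)
  show "tensor_eq (Poly_Mapping.single (x, y + y') 1)
      (Poly_Mapping.single (x, y) 1 + Poly_Mapping.single (x, y') 1)"
    unfolding tensor_eq_def diff_diff_eq[symmetric]
    by (rule complex_vector.span_base) (unfold tensor_rels_def, blast)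
  show "tensor_eq (Poly_Mapping.single (c *\<^sub>C x, y) 1) (c *\<^sub>C Poly_Mapping.single (x, y) 1)"
    unfolding tensor_eq_def
    by (rule complex_vector.span_base) (unfold tensor_rels_def, blast)
  show "tensor_eq (Poly_Mapping.single (x, c *\<^sub>C y) 1) (c *\<^sub>C Poly_Mapping.single (x, y) 1)"
    unfolding tensor_eq_def
    by (rule complex_vector.span_base) (unfold tensor_rels_def, blast)
qed

lemma lin_ext_tensor_eq:
  assumes f: "cbilinear f" and xy: "tensor_eq x y"
  shows "lin_ext (case_prod f) x = lin_ext (case_prod f) y"
proof -
  note lin = clinear_lin_ext[of "case_prod f"]
  have "lin_ext (case_prod f) u = 0" if "u \<in> complex_vector.span tensor_rels" for u
    using that
  proof (induction rule: complex_vector.span_induct_alt)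
    case base
    show ?case using lin by (rule clinear_zero)
  next
    case (step c u v)
    have "lin_ext (case_prod f) u = 0"
      using step(1) unfolding tensor_rels_def
      by (auto simp: clinear_diff[OF lin] clinear_scaleC[OF lin] cbilinearD[OF f] scaleC_one)
    with step(2) show ?case by (simp add: clinear_add[OF lin] clinear_scaleC[OF lin])
  qed
  from this[of "x - y"] xy show ?thesis by (simp add: tensor_eq_def clinear_diff[OF lin])
qed

lemma tensor_lift_abs:
  "cbilinear f \<Longrightarrow> tensor_lift f (abs_tensor x) = lin_ext (case_prod f) x"
  unfolding tensor_lift_def
  by (rule lin_ext_tensor_eq) (simp_all add: Quotient3_rep_abs[OF Quotient3_tensor]
      equivp_reflp[OF equivp_tensor_eq])

lemma tensor_lift_tens: "cbilinear f \<Longrightarrow> tensor_lift f (x \<otimes> y) = f x y"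
  by (simp add: tens.abs_eq tensor_lift_abs scaleC_one)

lemma clinear_tensor_lift:
  assumes "cbilinear f"
  shows "clinear (tensor_lift f)"
proof (rule clinearI)
  fix s t :: "('a, 'b) tensor" and c
  obtain x y where st: "s = abs_tensor x" "t = abs_tensor y"
    by (metis Quotient3_abs_rep Quotient3_tensor)
  show "tensor_lift f (s + t) = tensor_lift f s + tensor_lift f t"
    by (simp add: st plus_tensor.abs_eq tensor_lift_abs assms clinear_add[OF clinear_lin_ext])
  show "tensor_lift f (c *\<^sub>C s) = c *\<^sub>C tensor_lift f s"
    by (simp add: st scaleC_tensor.abs_eq tensor_lift_abs assms clinear_scaleC[OF clinear_lin_ext])
qed

lemma tensor_induct [case_names zero add tens]:
  assumes "P 0" "\<And>s t. P s \<Longrightarrow> P t \<Longrightarrow> P (s + t)" "\<And>x y. P (x \<otimes> y)"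
  shows "P t"
proof -
  have cl: "c *\<^sub>C (x \<otimes> y) = (c *\<^sub>C x) \<otimes> y" for c x y
    by (simp add: cbilinearD[OF cbilinear_tens])
  obtain u where t: "t = abs_tensor u"
    by (metis Quotient3_abs_rep Quotient3_tensor)
  have "P (abs_tensor (\<Sum>k\<in>A. Poly_Mapping.lookup u k *\<^sub>C Poly_Mapping.single k 1))"
    if "finite A" for A
    using that
  proof (induction A rule: finite_induct)
    case empty
    then show ?case using assms(1) by (simp add: zero_tensor.abs_eq)
  next
    case (insert k A)
    obtain x y where k: "k = (x, y)" by (cases k)
    have "P (Poly_Mapping.lookup u k *\<^sub>C (x \<otimes> y))" by (simp add: cl assms(3))
    then show ?case
      using insert assms(2)
      by (simp add: plus_tensor.abs_eq[symmetric] scaleC_tensor.abs_eq[symmetric] tens.abs_eq k)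
  qed
  from this[of "Poly_Mapping.keys u"] show ?thesis
    unfolding t by (subst poly_mapping_sum_single[of u]) simp
qed

lemma cbilinear_mult: "cbilinear ((*) :: 'a::complex_algebra_1 \<Rightarrow> _)"
  by (rule cbilinearI) (simp_all add: algebra_simps mult_scaleC_left mult_scaleC_right)

lemma cbilinear_comp:
  assumes "cbilinear f" "clinear g" "clinear h"
  shows "cbilinear (\<lambda>x y. f (g x) (h y))"
  by (rule cbilinearI)
    (simp_all add: cbilinearD[OF assms(1)] clinear_add[OF assms(2)] clinear_add[OF assms(3)]
      clinear_scaleC[OF assms(2)] clinear_scaleC[OF assms(3)])

lemma tens_eq_0_imp:
  assumes "x \<otimes> y = (0 :: ('a::complex_vector, 'b::complex_vector) tensor)"
  shows "x = 0 \<or> y = 0"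
proof (rule ccontr)
  assume "\<not> ?thesis"
  then have ind: "\<not> complex_vector.dependent {x}" "\<not> complex_vector.dependent {y}"
    by simp_all
  have p1: "vector_space_pair (scaleC :: complex \<Rightarrow> 'a \<Rightarrow> 'a) (scaleC :: complex \<Rightarrow> complex \<Rightarrow> complex)"
    and p2: "vector_space_pair (scaleC :: complex \<Rightarrow> 'b \<Rightarrow> 'b) (scaleC :: complex \<Rightarrow> complex \<Rightarrow> complex)"
    by unfold_locales
  obtain g where g: "clinear g" "g x = (1::complex)"
    using vector_space_pair.linear_independent_extend[OF p1 ind(1), of "\<lambda>_. 1"] by auto
  obtain h where h: "clinear h" "h y = (1::complex)"
    using vector_space_pair.linear_independent_extend[OF p2 ind(2), of "\<lambda>_. 1"] by auto
  have bil: "cbilinear (\<lambda>x y. g x * h y)"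
    by (rule cbilinear_comp[OF cbilinear_mult g(1) h(1)])
  have "tensor_lift (\<lambda>x y. g x * h y) (x \<otimes> y) = 1"
    by (simp add: tensor_lift_tens[OF bil] g h)
  with assms show False by (simp add: clinear_zero[OF clinear_tensor_lift[OF bil]])
qed

instantiation tensor :: (complex_algebra_1, complex_algebra_1) complex_algebra_1
begin

definition one_tensor :: "('a, 'b) tensor"
  where "one_tensor = 1 \<otimes> 1"

definition times_tensor :: "('a, 'b) tensor \<Rightarrow> ('a, 'b) tensor \<Rightarrow> ('a, 'b) tensor"
  where "s * t = tensor_lift (\<lambda>a b. tensor_lift (\<lambda>a' b'. (a * a') \<otimes> (b * b')) t) s"

lemma tensor_mult_aux:
  fixes t :: "('a, 'b) tensor"
  shows "cbilinear (\<lambda>a' b'. (a * a' :: 'a) \<otimes> (b * b' :: 'b))"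
    and "cbilinear (\<lambda>a b. tensor_lift (\<lambda>a' b'. (a * a') \<otimes> (b * b')) t)"
proof -
  show 1: "cbilinear (\<lambda>a' b'. (a * a' :: 'a) \<otimes> (b * b' :: 'b))" for a b
    by (rule cbilinear_comp[OF cbilinear_tens])
      (use cbilinear_mult in \<open>auto simp: cbilinear_def\<close>)
  note lin = clinear_tensor_lift[OF 1]
  note lin = clinear_zero[OF lin] clinear_add[OF lin]
  note tn = tensor_lift_tens[OF 1]
  note bil = cbilinearD[OF cbilinear_tens] distrib_right mult_scaleC_left
  let ?L = "\<lambda>a b. tensor_lift (\<lambda>a' b'. (a * a') \<otimes> (b * b'))"
  have L: "?L (a + a2) b t = ?L a b t + ?L a2 b t"
    "?L a (b + b2) t = ?L a b t + ?L a b2 t"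
    "?L (c *\<^sub>C a) b t = c *\<^sub>C ?L a b t"
    "?L a (c *\<^sub>C b) t = c *\<^sub>C ?L a b t" for a a2 b b2 c
  proof (induction t rule: tensor_induct)
    case (tens x y)
    { case 1 show ?case unfolding tn by (simp only: bil)
    next case 2 show ?case unfolding tn by (simp only: bil)
    next case 3 show ?case unfolding tn by (simp only: bil)
    next case 4 show ?case unfolding tn by (simp only: bil) }
  qed (simp_all only: lin add_ac scaleC_add_right add_0_left complex_vector.scale_zero_right)
  show "cbilinear (\<lambda>a b. ?L a b t)"
    by (rule cbilinearI) (fact L)+
qed

lemma tensor_mult_tens: "(a \<otimes> b) * (a' \<otimes> b') = (a * a') \<otimes> (b * b')"
  unfolding times_tensor_def
  by (subst tensor_lift_tens[OF tensor_mult_aux(2)], rule tensor_lift_tens[OF tensor_mult_aux(1)])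

lemma cbilinear_tensor_mult: "cbilinear ((*) :: ('a, 'b) tensor \<Rightarrow> _)"
proof (rule cbilinearI)
  fix s s' t t' :: "('a, 'b) tensor" and c
  note lin = clinear_tensor_lift[OF tensor_mult_aux(1)]
  note lin2 = clinear_tensor_lift[OF tensor_mult_aux(2)]
  show l: "(s + s') * t = s * t + s' * t" for s s' t :: "('a, 'b) tensor"
    by (simp add: times_tensor_def clinear_add[OF lin2])
  show "(c *\<^sub>C s) * t = c *\<^sub>C (s * t)"
    by (simp add: times_tensor_def clinear_scaleC[OF lin2])
  have z: "0 * u = 0" for u :: "('a, 'b) tensor"
    by (simp add: times_tensor_def clinear_zero[OF lin2])
  have tn: "(a \<otimes> b) * u = tensor_lift (\<lambda>a' b'. (a * a') \<otimes> (b * b')) u"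
    for a b and u :: "('a, 'b) tensor"
    by (simp add: times_tensor_def tensor_lift_tens[OF tensor_mult_aux(2)])
  show "s * (t + t') = s * t + s * t'"
    by (induction s rule: tensor_induct) (simp_all add: z l tn clinear_add[OF lin] add_ac)
  show "s * (c *\<^sub>C t) = c *\<^sub>C (s * t)"
    by (induction s rule: tensor_induct) (simp_all add: z l tn clinear_scaleC[OF lin] scaleC_add_right)
qed

instance
proof
  fix s t u :: "('a, 'b) tensor" and c
  note b = cbilinearD[OF cbilinear_tensor_mult]
  show "(s + t) * u = s * u + t * u" "s * (t + u) = s * t + s * u"
    "(c *\<^sub>C s) * t = c *\<^sub>C (s * t)" "s * (c *\<^sub>C t) = c *\<^sub>C (s * t)"
    by (simp_all add: b)
  have z: "0 * s = 0" "s * 0 = 0" for s :: "('a, 'b) tensor"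
    using b(3)[of 0 0 s] b(4)[of s 0 0] by simp_all
  show "s * t * u = s * (t * u)"
  proof (induction s rule: tensor_induct)
    case (tens a1 b1)
    show ?case
    proof (induction t rule: tensor_induct)
      case (tens a2 b2)
      show ?case
        by (induction u rule: tensor_induct) (simp_all add: z b tensor_mult_tens mult.assoc)
    qed (simp_all add: z b)
  qed (simp_all add: z b)
  show "1 * s = s" "s * 1 = s"
    by (induction s rule: tensor_induct; simp add: z b one_tensor_def tensor_mult_tens)+
  show "(0 :: ('a, 'b) tensor) \<noteq> 1"
    using tens_eq_0_imp[of "1 :: 'a" "1 :: 'b"] by (auto simp: one_tensor_def)
qed

end


section \<open>Algebras given by generators and relations\<close>

text \<open>The free monoid, written additively so that \<open>Poly_Mapping\<close> turns finitely supported
  functions on it into the free algebra.\<close>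

datatype 'g word = Word (letters: "'g list")

instantiation word :: (type) monoid_add
begin
definition zero_word :: "'g word" where "zero_word = Word []"
definition plus_word :: "'g word \<Rightarrow> 'g word \<Rightarrow> 'g word"
  where "plus_word v w = Word (letters v @ letters w)"
instance by standard (auto simp: zero_word_def plus_word_def)
end

type_synonym 'g free_alg = "'g word \<Rightarrow>\<^sub>0 complex"

definition gen :: "'g \<Rightarrow> 'g free_alg"
  where "gen g = Poly_Mapping.single (Word [g]) 1"

definition free_eval :: "('g \<Rightarrow> 'a::complex_algebra_1) \<Rightarrow> 'g free_alg \<Rightarrow> 'a"
  where "free_eval \<phi> = lin_ext (\<lambda>w. prod_list (map \<phi> (letters w)))"

text \<open>The algebra has generators \<open>\<phi> g\<close> and defining relations \<open>r = 0\<close> for \<open>r \<in> R\<close>: evaluation of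
  noncommutative polynomials is onto, and its kernel is the two-sided ideal generated by \<open>R\<close>. This is
  a predicate on algebra types because a type cannot depend on the parameter \<open>q\<close> of the relations.\<close>

definition presented_by :: "('g \<Rightarrow> 'a::complex_algebra_1) \<Rightarrow> 'g free_alg set \<Rightarrow> bool"
  where "presented_by \<phi> R \<longleftrightarrow>
    surj (free_eval \<phi>) \<and>
    {x. free_eval \<phi> x = 0} = complex_vector.span {a * r * b | a r b. r \<in> R}"

definition alg_hom :: "('a::complex_algebra_1 \<Rightarrow> 'b::complex_algebra_1) \<Rightarrow> bool"
  where "alg_hom f \<longleftrightarrow> clinear f \<and> f 1 = 1 \<and> (\<forall>x y. f (x * y) = f x * f y)"

definition alg_antihom :: "('a::complex_algebra_1 \<Rightarrow> 'b::complex_algebra_1) \<Rightarrow> bool"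
  where "alg_antihom f \<longleftrightarrow> clinear f \<and> f 1 = 1 \<and> (\<forall>x y. f (x * y) = f y * f x)"

definition antilinear_antihom :: "('a::complex_algebra_1 \<Rightarrow> 'b::complex_algebra_1) \<Rightarrow> bool"
  where "antilinear_antihom f \<longleftrightarrow> antilinear f \<and> f 1 = 1 \<and> (\<forall>x y. f (x * y) = f y * f x)"


section \<open>The involutive algebra of polynomials on the quantum plane\<close>

datatype pol_gen = GenZ | GenZs

text \<open>Here and below \<open>z\<close>, \<open>zs\<close> stand for the generators $z$, $z^*$.\<close>

definition Pol_alg :: "real \<Rightarrow> 'p::complex_algebra_1 \<Rightarrow> 'p \<Rightarrow> bool"
  where "Pol_alg q z zs \<longleftrightarrow>
    presented_by (case_pol_gen z zs)
      {gen GenZs * gen GenZ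
        - (complex_of_real (q^2) *\<^sub>C (gen GenZ * gen GenZs) + complex_of_real (1 - q^2) *\<^sub>C 1)}"

definition Pol_star :: "'p::complex_algebra_1 \<Rightarrow> 'p \<Rightarrow> ('p \<Rightarrow> 'p) \<Rightarrow> bool"
  where "Pol_star z zs st \<longleftrightarrow> antilinear_antihom st \<and> bij st \<and> st z = zs \<and> st zs = z"


section \<open>Differential calculus\<close>

definition bimodule ::
    "('a::complex_algebra_1 \<Rightarrow> 'w::complex_vector \<Rightarrow> 'w) \<Rightarrow> ('w \<Rightarrow> 'a \<Rightarrow> 'w) \<Rightarrow> bool"
  where "bimodule l r \<longleftrightarrow>
    cbilinear l \<and> cbilinear r \<and>
    (\<forall>w. l 1 w = w) \<and> (\<forall>a b w. l (a * b) w = l a (l b w)) \<and>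
    (\<forall>w. r w 1 = w) \<and> (\<forall>a b w. r w (a * b) = r (r w a) b) \<and>
    (\<forall>a b w. r (l a w) b = l a (r w b))"

definition first_order_calculus ::
    "('a::complex_algebra_1 \<Rightarrow> 'w::complex_vector \<Rightarrow> 'w) \<Rightarrow> ('w \<Rightarrow> 'a \<Rightarrow> 'w) \<Rightarrow> ('a \<Rightarrow> 'w) \<Rightarrow> bool"
  where "first_order_calculus l r d \<longleftrightarrow>
    bimodule l r \<and> clinear d \<and>
    (\<forall>f g. d (f * g) = r (d f) g + l f (d g)) \<and>
    complex_vector.span {r (l f1 (d f2)) f3 | f1 f2 f3. True} = UNIV"

text \<open>The free bimodule on two generators is \<open>A \<otimes> A\<close> (first generator) plus \<open>A \<otimes> A\<close> (second
  generator), where \<open>a \<otimes> b\<close> stands for \<open>a\<close> times the generator times \<open>b\<close>. It is mapped to the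
  bimodule by sending the two generators to \<open>v\<close> and \<open>w\<close>.\<close>

definition free_bimod_eval ::
    "('a::complex_algebra_1 \<Rightarrow> 'w::complex_vector \<Rightarrow> 'w) \<Rightarrow> ('w \<Rightarrow> 'a \<Rightarrow> 'w) \<Rightarrow> 'w \<Rightarrow> 'w
      \<Rightarrow> ('a, 'a) tensor \<times> ('a, 'a) tensor \<Rightarrow> 'w"
  where "free_bimod_eval l r v w x =
    tensor_lift (\<lambda>a b. r (l a v) b) (fst x) + tensor_lift (\<lambda>a b. r (l a w) b) (snd x)"

definition sub_bimod ::
    "(('a::complex_algebra_1, 'a) tensor \<times> ('a, 'a) tensor) set
      \<Rightarrow> (('a, 'a) tensor \<times> ('a, 'a) tensor) set"
  where "sub_bimod R = complex_vector.span
    {((a \<otimes> 1) * x * (1 \<otimes> b), (a \<otimes> 1) * y * (1 \<otimes> b)) | a b x y. (x, y) \<in> R}"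

text \<open>With $dz$, $dz^*$ as the two generators, the elements below are
  $z\,dz - q^{-2} dz\,z$, $z^* dz^* - q^2 dz^* z^*$, $z^* dz - q^2 dz\,z^*$,
  $z\,dz^* - q^{-2} dz^* z$.\<close>

definition calculus_rels ::
    "real \<Rightarrow> 'p::complex_algebra_1 \<Rightarrow> 'p \<Rightarrow> (('p, 'p) tensor \<times> ('p, 'p) tensor) set"
  where "calculus_rels q z zs =
    {(z \<otimes> 1 - complex_of_real (1 / q^2) *\<^sub>C (1 \<otimes> z), 0),
     (0, zs \<otimes> 1 - complex_of_real (q^2) *\<^sub>C (1 \<otimes> zs)),
     (zs \<otimes> 1 - complex_of_real (q^2) *\<^sub>C (1 \<otimes> zs), 0),
     (0, z \<otimes> 1 - complex_of_real (1 / q^2) *\<^sub>C (1 \<otimes> z))}"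

text \<open>\<open>\<Omega>\<^sup>1\<close>, with left action \<open>l\<close> and right action \<open>r\<close>: the commutation relations are the defining
  relations of the bimodule.\<close>

definition Pol_calculus ::
    "real \<Rightarrow> 'p::complex_algebra_1 \<Rightarrow> 'p \<Rightarrow> ('p \<Rightarrow> 'w::complex_vector \<Rightarrow> 'w) \<Rightarrow> ('w \<Rightarrow> 'p \<Rightarrow> 'w)
      \<Rightarrow> ('p \<Rightarrow> 'w) \<Rightarrow> bool"
  where "Pol_calculus q z zs l r d \<longleftrightarrow>
    first_order_calculus l r d \<and>
    {x. free_bimod_eval l r (d z) (d zs) x = 0} = sub_bimod (calculus_rels q z zs)"

text \<open>The pairs of partial derivatives in $z$ and in $z^*$.\<close>

definition partials_r ::
    "'p::complex_algebra_1 \<Rightarrow> 'p \<Rightarrow> ('p \<Rightarrow> 'w::complex_vector \<Rightarrow> 'w) \<Rightarrow> ('p \<Rightarrow> 'w) \<Rightarrow> 'p \<Rightarrow> 'p \<times> 'p"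
  where "partials_r z zs l d f = (THE (a, b). d f = l a (d z) + l b (d zs))"

definition partials_l ::
    "'p::complex_algebra_1 \<Rightarrow> 'p \<Rightarrow> ('w::complex_vector \<Rightarrow> 'p \<Rightarrow> 'w) \<Rightarrow> ('p \<Rightarrow> 'w) \<Rightarrow> 'p \<Rightarrow> 'p \<times> 'p"
  where "partials_l z zs r d f = (THE (a, b). d f = r (d z) a + r (d zs) b)"


section \<open>Multiplication and involution of formal power series\<close>

definition m0 :: "('p::complex_algebra_1, 'p) tensor \<Rightarrow> 'p"
  where "m0 = tensor_lift (*)"

definition box ::
    "real \<Rightarrow> 'p::complex_algebra_1 \<Rightarrow> 'p \<Rightarrow> ('p \<Rightarrow> 'w::complex_vector \<Rightarrow> 'w) \<Rightarrow> ('w \<Rightarrow> 'p \<Rightarrow> 'w)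
      \<Rightarrow> ('p \<Rightarrow> 'w) \<Rightarrow> ('p, 'p) tensor \<Rightarrow> ('p, 'p) tensor"
  where "box q z zs l r d = tensor_lift (\<lambda>f1 f2.
    (snd (partials_r z zs l d f1) \<otimes> 1)
    * (complex_of_real (1 / q^2) *\<^sub>C
        (1 - complex_of_real (1 + 1 / q^2) *\<^sub>C (zs \<otimes> z)
           + complex_of_real (1 / q^2) *\<^sub>C ((zs^2) \<otimes> (z^2))))
    * (1 \<otimes> fst (partials_l z zs r d f2)))"

definition qpoch :: "real \<Rightarrow> real \<Rightarrow> nat \<Rightarrow> real"  \<comment> \<open>$(a;q^2)_k$\<close>
  where "qpoch q a k = (\<Prod>i<k. 1 - q^(2 * i) * a)"

definition p_poly :: "real \<Rightarrow> nat \<Rightarrow> real poly"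
  where "p_poly q k = (\<Sum>j\<le>k.
    smult (qpoch q (1 / q^(2 * k)) j / (qpoch q (q^2) j)^2 * q^(2 * j))
      (\<Prod>i<j. [:1:] - smult (q^(2 * i)) (smult ((1 - q^2)^2) [:0, 1:] + [:1 + q^2:])
               + [:q^(4 * i + 2):]))"

definition poly_op :: "real poly \<Rightarrow> ('v::complex_vector \<Rightarrow> 'v) \<Rightarrow> 'v \<Rightarrow> 'v"
  where "poly_op p T v = (\<Sum>i\<le>degree p. complex_of_real (coeff p i) *\<^sub>C (T ^^ i) v)"

definition C_coeff ::
    "real \<Rightarrow> 'p::complex_algebra_1 \<Rightarrow> 'p \<Rightarrow> ('p \<Rightarrow> 'w::complex_vector \<Rightarrow> 'w) \<Rightarrow> ('w \<Rightarrow> 'p \<Rightarrow> 'w)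
      \<Rightarrow> ('p \<Rightarrow> 'w) \<Rightarrow> nat \<Rightarrow> 'p \<Rightarrow> 'p \<Rightarrow> 'p"
  where "C_coeff q z zs l r d k f1 f2 =
    m0 (poly_op (p_poly q k) (box q z zs l r d) (f1 \<otimes> f2)
        - poly_op (p_poly q (k - 1)) (box q z zs l r d) (f1 \<otimes> f2))"

definition star_prod ::
    "real \<Rightarrow> 'p::complex_algebra_1 \<Rightarrow> 'p \<Rightarrow> ('p \<Rightarrow> 'w::complex_vector \<Rightarrow> 'w) \<Rightarrow> ('w \<Rightarrow> 'p \<Rightarrow> 'w)
      \<Rightarrow> ('p \<Rightarrow> 'w) \<Rightarrow> 'p \<Rightarrow> 'p \<Rightarrow> 'p fps"
  where "star_prod q z zs l r d f1 f2 =
    Abs_fps (\<lambda>k. if k = 0 then f1 * f2 else C_coeff q z zs l r d k f1 f2)"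

text \<open>The coefficient of $t^n$ in $\sum_i (\sum_{j+k=i} a_j * b_k) t^i$, whose inner sums are
  themselves power series. This is not the Cauchy product \<open>(*)\<close> of type \<open>fps\<close>.\<close>

definition fps_m ::
    "real \<Rightarrow> 'p::complex_algebra_1 \<Rightarrow> 'p \<Rightarrow> ('p \<Rightarrow> 'w::complex_vector \<Rightarrow> 'w) \<Rightarrow> ('w \<Rightarrow> 'p \<Rightarrow> 'w)
      \<Rightarrow> ('p \<Rightarrow> 'w) \<Rightarrow> 'p fps \<Rightarrow> 'p fps \<Rightarrow> 'p fps"
  where "fps_m q z zs l r d a b = Abs_fps (\<lambda>n. \<Sum>i\<le>n.
    fps_nth (\<Sum>j\<le>i. star_prod q z zs l r d (fps_nth a j) (fps_nth b (i - j))) (n - i))"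

definition fps_map :: "('p \<Rightarrow> 'p) \<Rightarrow> 'p fps \<Rightarrow> 'p fps"
  where "fps_map h f = Abs_fps (\<lambda>n. h (fps_nth f n))"


section \<open>The Hopf star-algebra\<close>

datatype uq_gen = GenK | GenKinv | GenE | GenF

definition uq_rels :: "real \<Rightarrow> uq_gen free_alg set"
  where "uq_rels q =
    {gen GenK * gen GenKinv - 1,
     gen GenKinv * gen GenK - 1,
     gen GenK * gen GenE - complex_of_real (q^2) *\<^sub>C (gen GenE * gen GenK),
     gen GenKinv * gen GenE - complex_of_real (1 / q^2) *\<^sub>C (gen GenE * gen GenKinv),
     gen GenK * gen GenF - complex_of_real (1 / q^2) *\<^sub>C (gen GenF * gen GenK),
     gen GenKinv * gen GenF - complex_of_real (q^2) *\<^sub>C (gen GenF * gen GenKinv),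
     gen GenE * gen GenF - gen GenF * gen GenE
       - complex_of_real (1 / (q - 1 / q)) *\<^sub>C (gen GenK - gen GenKinv)}"

text \<open>The comultiplication and counit are algebra homomorphisms, the antipode is an
  antihomomorphism, so that all of them are determined by their values on the generators.\<close>

definition Uq_su11 ::
    "real \<Rightarrow> 'u::complex_algebra_1 \<Rightarrow> 'u \<Rightarrow> 'u \<Rightarrow> 'u \<Rightarrow> ('u \<Rightarrow> ('u, 'u) tensor) \<Rightarrow> ('u \<Rightarrow> complex)
      \<Rightarrow> ('u \<Rightarrow> 'u) \<Rightarrow> ('u \<Rightarrow> 'u) \<Rightarrow> bool"
  where "Uq_su11 q K Kinv E F \<Delta> \<epsilon> S ust \<longleftrightarrow>
    presented_by (case_uq_gen K Kinv E F) (uq_rels q) \<and>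
    alg_hom \<Delta> \<and>
      \<Delta> K = K \<otimes> K \<and> \<Delta> Kinv = Kinv \<otimes> Kinv \<and>
      \<Delta> E = E \<otimes> 1 + K \<otimes> E \<and> \<Delta> F = F \<otimes> Kinv + 1 \<otimes> F \<and>
    alg_hom \<epsilon> \<and>
      \<epsilon> E = 0 \<and> \<epsilon> F = 0 \<and> \<epsilon> (K - 1) = 0 \<and> \<epsilon> (Kinv - 1) = 0 \<and>
    alg_antihom S \<and>
      S K = Kinv \<and> S Kinv = K \<and> S E = - (Kinv * E) \<and> S F = - (F * K) \<and>
    antilinear_antihom ust \<and>
      ust E = - (K * F) \<and> ust F = - (E * Kinv) \<and> ust K = K \<and> ust Kinv = Kinv"


section \<open>Module algebras\<close>

definition is_module :: "('u::complex_algebra_1 \<Rightarrow> 'a::complex_vector \<Rightarrow> 'a) \<Rightarrow> bool"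
  where "is_module act \<longleftrightarrow>
    cbilinear act \<and> (\<forall>f. act 1 f = f) \<and> (\<forall>\<xi> \<eta> f. act (\<xi> * \<eta>) f = act \<xi> (act \<eta> f))"

definition is_algebra :: "('a::complex_vector \<Rightarrow> 'a \<Rightarrow> 'a) \<Rightarrow> bool"
  where "is_algebra mul \<longleftrightarrow>
    cbilinear mul \<and> (\<forall>f g h. mul (mul f g) h = mul f (mul g h))"

definition is_unit_of :: "('a \<Rightarrow> 'a \<Rightarrow> 'a) \<Rightarrow> 'a \<Rightarrow> bool"
  where "is_unit_of mul e \<longleftrightarrow> (\<forall>f. mul e f = f \<and> mul f e = f)"

definition tensor_act ::
    "('u::complex_algebra_1 \<Rightarrow> 'a::complex_vector \<Rightarrow> 'a)
      \<Rightarrow> ('u, 'u) tensor \<Rightarrow> ('a, 'a) tensor \<Rightarrow> ('a, 'a) tensor"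
  where "tensor_act act u t = tensor_lift (\<lambda>\<xi> \<eta>. tensor_map (act \<xi>) (act \<eta>) t) u"

definition module_algebra ::
    "('u::complex_algebra_1 \<Rightarrow> ('u, 'u) tensor) \<Rightarrow> ('u \<Rightarrow> complex)
      \<Rightarrow> ('u \<Rightarrow> 'a::complex_vector \<Rightarrow> 'a) \<Rightarrow> ('a \<Rightarrow> 'a \<Rightarrow> 'a) \<Rightarrow> bool"
  where "module_algebra \<Delta> \<epsilon> act mul \<longleftrightarrow>
    is_algebra mul \<and> is_module act \<and>
    (\<forall>\<xi> t. act \<xi> (tensor_lift mul t) = tensor_lift mul (tensor_act act (\<Delta> \<xi>) t)) \<and>
    (\<forall>e. is_unit_of mul e \<longrightarrow> (\<forall>\<xi>. act \<xi> e = \<epsilon> \<xi> *\<^sub>C e))"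

definition is_involution :: "('a::complex_vector \<Rightarrow> 'a \<Rightarrow> 'a) \<Rightarrow> ('a \<Rightarrow> 'a) \<Rightarrow> bool"
  where "is_involution mul st \<longleftrightarrow>
    antilinear st \<and> (\<forall>f. st (st f) = f) \<and> (\<forall>f g. st (mul f g) = mul (st g) (st f))"

definition star_module_algebra ::
    "('u::complex_algebra_1 \<Rightarrow> ('u, 'u) tensor) \<Rightarrow> ('u \<Rightarrow> complex) \<Rightarrow> ('u \<Rightarrow> 'u) \<Rightarrow> ('u \<Rightarrow> 'u)
      \<Rightarrow> ('u \<Rightarrow> 'a::complex_vector \<Rightarrow> 'a) \<Rightarrow> ('a \<Rightarrow> 'a \<Rightarrow> 'a) \<Rightarrow> ('a \<Rightarrow> 'a) \<Rightarrow> bool"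
  where "star_module_algebra \<Delta> \<epsilon> S ust act mul st \<longleftrightarrow>
    module_algebra \<Delta> \<epsilon> act mul \<and> is_involution mul st \<and>
    (\<forall>\<xi> f. st (act \<xi> f) = act (ust (S \<xi>)) (st f))"

end

theory Submission
  imports Defs
begin

text \<open>
  Put $w = q^2$, $s_0 = 1$ and $s_n = p_n - p_{n-1}$, so that $C_n = m_0 \circ s_n(\widetilde\square)$.
  The operator $\widetilde\square$ commutes with left multiplication by $z$, with right multiplication
  by $z^*$, with the action on the tensor square and with the flip composed with the involution;
  hence each $C_n$ is covariant and compatible with the involution, and only associativity is at stake.

  The $s_n$ obey the recurrence
  $(1-w^{n+1}) s_{n+1} = (1-w)^2 x s_n + (1+w)(1-w^n) s_n - w(1-w^{n-1}) s_{n-1}$.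
  Applied to $z^{*i} \otimes z^{i+d}$, it shows that the coefficient of $z^d$ in $z^{*i} * z^{i+d}$ is
  $G(i+d)/G(d)$ with $G(i) = \prod_{s=1}^i (1-w^s)/(1-t w^s)$, the value found in the weighted Bergman
  space. Therefore the constant term of the associator of $z^{*k}$, $z^l z^{*m}$, $z^n$ vanishes: for
  $k - l = n - m = e$ both bracketings give $G(k) G(n)/G(e)$. The associator is covariant, and an invariant family
  of elements without constant terms is zero, because $F$ and $E$ move any coefficient to the constant
  term.
\<close>

section \<open>Recurrences for the polynomials and the vacuum expectation values\<close>

text \<open>With w = q^2, the substitution (1 - w)^2 x + 1 + w = s + w / s turns the factors of p_k
  into (1 - w^i s) (1 - w^(i+1) / s). Thus p_k is the terminating series 3phi2 with upper parameters
  w^(-k), s, w / s, lower parameters w, 0 and argument w, an Al-Salam-Chihara polynomial up to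
  normalisation, for which a three-term recurrence is to be expected. The obstacle is that p_k of
  the operator has no manageable closed form on general tensors. On zs^i \<otimes> z^(i+d), however,
  the operator is a difference operator in i, so the wanted coefficients form a table in n and i
  that the recurrence in n determines, and a known table only has to be verified. The table is
  predicted by orthogonality: if the monomials are orthogonal with square norms G(i), the adjoint of
  multiplication by z^i maps z^(i+d) to G(i+d) / G(d) z^d. The space itself is never constructed.
  Covariance makes up for ignoring all other coefficients, because F and E are twisted commutators
  with zs and z (\<open>ff_eq\<close>, \<open>ee_eq\<close>).\<close>

definition q_poch :: "real \<Rightarrow> real \<Rightarrow> nat \<Rightarrow> real"
  where "q_poch w a k = (\<Prod>i<k. 1 - w ^ i * a)"

lemma q_poch_0 [simp]: "q_poch w a 0 = 1"
  by (simp add: q_poch_def)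

lemma q_poch_Suc: "q_poch w a (Suc k) = q_poch w a k * (1 - w ^ k * a)"
  by (simp add: q_poch_def)

lemma q_poch_Suc_shift: "q_poch w a (Suc k) = (1 - a) * q_poch w (w * a) k"
  unfolding q_poch_def prod.lessThan_Suc_shift by (simp add: mult_ac)

text \<open>Both products contain \<open>q_poch w (w * a) i\<close>. For a = w^(-n) they belong to
  p_n and p_(n-1), so the difference of consecutive polynomials again has product
  coefficients.\<close>

lemma q_poch_diff: "q_poch w a (Suc i) - q_poch w (w * a) (Suc i) = - (a * (1 - w ^ Suc i) * q_poch w (w * a) i)"
  by (subst q_poch_Suc_shift, subst q_poch_Suc) (simp add: algebra_simps)

lemma q_poch_eq_0: "k < j \<Longrightarrow> w \<noteq> 0 \<Longrightarrow> q_poch w (1 / w ^ k) j = 0"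
  unfolding q_poch_def by (rule prod_zero) auto

lemma q_poch_nonzero: "0 < w \<Longrightarrow> w < 1 \<Longrightarrow> q_poch w w k \<noteq> 0"
proof (induction k)
  case (Suc k)
  have "w ^ Suc k < 1" using Suc.prems by (intro power_Suc_less_one)
  then show ?case using Suc by (simp add: q_poch_Suc mult.commute)
qed simp

lemma qpoch_eq_q_poch: "qpoch q a k = q_poch (q\<^sup>2) a k"
  by (simp add: qpoch_def q_poch_def power_mult)

section \<open>Expansion of the polynomials in an adapted basis\<close>

definition lap_prod :: "real \<Rightarrow> real \<Rightarrow> nat \<Rightarrow> real"
  where "lap_prod w x j = (\<Prod>i<j. 1 - w ^ i * ((1 - w)\<^sup>2 * x + 1 + w) + w ^ (2 * i + 1))"

text \<open>The last factor of \<open>lap_prod w x (Suc j)\<close> is affine in x. Solving for x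
  makes multiplication by x bidiagonal in this basis.\<close>

lemma lap_prod_shift:
  assumes "w \<noteq> 0"
  shows "(1 - w)\<^sup>2 * x * lap_prod w x j =
    (1 - w ^ j) * (1 - w ^ Suc j) / w ^ j * lap_prod w x j - lap_prod w x (Suc j) / w ^ j"
proof -
  define u where "u = w ^ j"
  have u: "u \<noteq> 0" using assms by (simp add: u_def)
  have L: "lap_prod w x (Suc j) = lap_prod w x j * (1 - u * ((1 - w)\<^sup>2 * x + 1 + w) + w * u\<^sup>2)"
    by (simp add: lap_prod_def u_def power_mult[symmetric] mult.commute)
  have "(1 - w)\<^sup>2 * x * y * u = (1 - u) * (1 - w * u) * y - y * (1 - u * ((1 - w)\<^sup>2 * x + 1 + w) + w * u\<^sup>2)" for y
    by algebra
  then show ?thesis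
    unfolding L power_Suc u_def[symmetric] using u by (simp add: nonzero_eq_divide_eq diff_divide_distrib[symmetric])
qed

text \<open>The terms with j > k vanish by \<open>q_poch_eq_0\<close>, so polynomials of different
  degree can be summed over one common range.\<close>

lemma poly_p_poly:
  assumes "q \<noteq> 0" "k \<le> N"
  shows "poly (p_poly q k) x =
    (\<Sum>j\<le>N. q_poch (q\<^sup>2) (1 / (q\<^sup>2) ^ k) j / (q_poch (q\<^sup>2) (q\<^sup>2) j)\<^sup>2 * (q\<^sup>2) ^ j * lap_prod (q\<^sup>2) x j)"
proof -
  have e: "q ^ (4 * i + 2) = (q\<^sup>2) ^ (2 * i + 1)" for i
    unfolding power_mult[symmetric] by (simp add: algebra_simps)
  have "poly (p_poly q k) x =
      (\<Sum>j\<le>k. q_poch (q\<^sup>2) (1 / (q\<^sup>2) ^ k) j / (q_poch (q\<^sup>2) (q\<^sup>2) j)\<^sup>2 * (q\<^sup>2) ^ j * lap_prod (q\<^sup>2) x j)"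
    unfolding p_poly_def qpoch_eq_q_poch lap_prod_def poly_sum e power_mult[of q 2]
    by (simp add: poly_prod algebra_simps)
  also have "\<dots> = (\<Sum>j\<le>N. q_poch (q\<^sup>2) (1 / (q\<^sup>2) ^ k) j / (q_poch (q\<^sup>2) (q\<^sup>2) j)\<^sup>2 * (q\<^sup>2) ^ j * lap_prod (q\<^sup>2) x j)"
    by (rule sum.mono_neutral_left) (use assms in \<open>auto simp: q_poch_eq_0\<close>)
  finally show ?thesis .
qed

definition s_poly :: "real \<Rightarrow> nat \<Rightarrow> real poly"
  where "s_poly q n = (if n = 0 then 1 else p_poly q n - p_poly q (n - 1))"

text \<open>For a = w^(-n) this is the coefficient of \<open>lap_prod w x (Suc i)\<close> in s_n.
  The index is shifted because the terms j = 0 of p_n and p_(n-1) are both 1 and cancel.\<close>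

definition s_coeff :: "real \<Rightarrow> real \<Rightarrow> nat \<Rightarrow> real"
  where "s_coeff w a i = - (w ^ Suc i * (1 - w ^ Suc i) / (q_poch w w (Suc i))\<^sup>2 * (a * q_poch w (w * a) i))"

lemma poly_s_poly:
  assumes q: "q \<noteq> 0" and n: "Suc n \<le> N"
  shows "poly (s_poly q (Suc n)) x =
    (\<Sum>i<N. s_coeff (q\<^sup>2) (1 / (q\<^sup>2) ^ Suc n) i * lap_prod (q\<^sup>2) x (Suc i))"
proof -
  define w where "w = q\<^sup>2"
  have w: "w \<noteq> 0" using q by (simp add: w_def)
  have a: "1 / w ^ n = w * (1 / w ^ Suc n)" using w by simp
  have "poly (s_poly q (Suc n)) x =
      (\<Sum>j\<le>N. (q_poch w (1 / w ^ Suc n) j - q_poch w (w * (1 / w ^ Suc n)) j) / (q_poch w w j)\<^sup>2 * w ^ j * lap_prod w x j)"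
    using n unfolding s_poly_def
    by (simp add: poly_p_poly[OF q, of _ N] sum_subtractf[symmetric] diff_divide_distrib
        left_diff_distrib flip: w_def a del: power_Suc times_divide_eq_right)
  also have "\<dots> = (\<Sum>i<N. s_coeff w (1 / w ^ Suc n) i * lap_prod w x (Suc i))"
    unfolding lessThan_Suc_atMost[symmetric] sum.lessThan_Suc_shift q_poch_diff s_coeff_def
    by (simp add: field_simps)
  finally show ?thesis by (simp add: w_def)
qed

text \<open>The recurrence of the \<open>s_poly\<close> in the basis \<open>lap_prod\<close>: here \<open>a\<close> stands for \<open>1 / w ^ Suc n\<close>.\<close>

lemma s_coeff_rec:
  assumes w: "0 < w" "w < 1" and a: "a \<noteq> 0"
  shows "(1 - w / a) * s_coeff w (a / w) (Suc m) =
    (1 - w ^ (m + 2)) * (1 - w ^ (m + 3)) / w ^ (m + 2) * s_coeff w a (Suc m)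
    - s_coeff w a m / w ^ Suc m + (1 + w) * (1 - 1 / a) * s_coeff w a (Suc m)
    - w * (1 - 1 / (w * a)) * s_coeff w (w * a) (Suc m)" (is ?A)
    and "(1 - w / a) * s_coeff w (a / w) 0 =
    (1 - w) * (1 - w\<^sup>2) / w * s_coeff w a 0 + (1 + w) * (1 - 1 / a) * s_coeff w a 0
    - w * (1 - 1 / (w * a)) * s_coeff w (w * a) 0" (is ?B)
proof -
  have w0: "w \<noteq> 0" using w by simp
  have nz: "q_poch w w (Suc m) \<noteq> 0" "1 - w ^ (m + 2) \<noteq> 0" "1 - w \<noteq> 0"
    using q_poch_nonzero[OF w] w power_Suc_less_one[OF w, of "Suc m"] by auto
  define y where "y = q_poch w (w * a) m"
  define u where "u = w ^ m"
  define R where "R = q_poch w w (Suc m)"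
  have u: "u \<noteq> 0" using w0 by (simp add: u_def)
  have R: "R \<noteq> 0" and wu: "1 - w * (w * u) \<noteq> 0" using nz by (simp_all add: R_def u_def)
  have pw: "w ^ Suc m = w * u" "w ^ Suc (Suc m) = w * (w * u)" "w ^ (m + 2) = w * (w * u)"
    "w ^ (m + 3) = w * (w * (w * u))"
    by (simp_all add: u_def power_add numeral_eq_Suc)
  have R2: "q_poch w w (Suc (Suc m)) = R * (1 - w * (w * u))"
    unfolding R_def by (subst q_poch_Suc) (simp add: u_def mult_ac)
  have q1: "q_poch w (w * (a / w)) (Suc m) = (1 - a) * y"
    using w0 by (simp add: q_poch_Suc_shift y_def)
  have q2: "q_poch w (w * a) (Suc m) = (1 - w * u * a) * y"
    by (simp add: q_poch_Suc y_def u_def mult_ac)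
  \<comment> \<open>The factor 1 - w a stays on the left: it vanishes at a = 1 / w, which is the
    case n = 0 of the recurrence, so it must not be divided out.\<close>
  have q3: "(1 - w * a) * q_poch w (w * (w * a)) (Suc m) = (1 - w * u * a) * (1 - w * (w * u) * a) * y"
    by (subst q_poch_Suc_shift[symmetric]) (simp add: q_poch_Suc y_def u_def mult_ac)
  \<comment> \<open>All four coefficients are multiples of C, after which the claim is a polynomial
    identity in w, a and u = w^m.\<close>
  define C where "C = (1 - w * (w * u)) / (R * (1 - w * (w * u)))\<^sup>2"
  have C: "1 / R\<^sup>2 = C * (1 - w * (w * u))"
    unfolding C_def using R wu by (simp add: divide_simps power2_eq_square)
  have s1: "s_coeff w (a / w) (Suc m) = - (w * (w * u) * C * (a / w * ((1 - a) * y)))"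
    unfolding s_coeff_def pw R2 C_def q1 by simp
  have s2: "s_coeff w a (Suc m) = - (w * (w * u) * C * (a * ((1 - w * u * a) * y)))"
    unfolding s_coeff_def pw R2 C_def q2 by simp
  have "s_coeff w (w * a) (Suc m) = - (w * (w * u) * C * (w * a * q_poch w (w * (w * a)) (Suc m)))"
    unfolding s_coeff_def pw R2 C_def by simp
  moreover have "w * (1 - 1 / (w * a)) * - (w * (w * u) * C * (w * a * Z)) =
      w * (w * (w * u)) * C * ((1 - w * a) * Z)" for Z
    using w0 a by (simp add: field_simps)
  ultimately have s3: "w * (1 - 1 / (w * a)) * s_coeff w (w * a) (Suc m) =
      w * (w * (w * u)) * C * ((1 - w * u * a) * (1 - w * (w * u) * a) * y)"
    by (simp only: q3)
  have "s_coeff w a m = - (w * u * (1 - w * u) * (1 / R\<^sup>2) * (a * y))"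
    unfolding s_coeff_def pw R_def[symmetric] y_def[symmetric] by simp
  then have s4: "s_coeff w a m / (w * u) = - ((1 - w * u) * (1 - w * (w * u)) * C * a * y)"
    using w0 u by (simp add: C)
  have e1: "(1 - w / a) * s_coeff w (a / w) (Suc m) = - (w * u * C * (a - w) * (1 - a) * y)"
    unfolding s1 using w0 a by (simp add: field_simps)
  have e2: "(1 - w * (w * u)) * (1 - w * (w * (w * u))) / (w * (w * u)) * s_coeff w a (Suc m) =
     - ((1 - w * (w * u)) * (1 - w * (w * (w * u))) * C * a * (1 - w * u * a) * y)"
    unfolding s2 using w0 u by simp
  have e3: "(1 + w) * (1 - 1 / a) * s_coeff w a (Suc m) =
     - ((1 + w) * (a - 1) * (w * (w * u)) * C * (1 - w * u * a) * y)"
    unfolding s2 using a by (simp add: field_simps)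
  show ?A
    unfolding pw s3 s4 e1 e2 e3 by algebra
  show ?B
  proof -
    define C where "C = (1 - w) / (q_poch w w (Suc 0))\<^sup>2"
    have s: "s_coeff w b 0 = - (w * C * b)" for b
      by (simp add: s_coeff_def C_def)
    have "(1 - w / a) * (w * C * (a / w)) = C * (a - w)"
      "(1 - w) * (1 - w\<^sup>2) / w * (w * C * a) = (1 - w) * (1 - w\<^sup>2) * C * a"
      "(1 + w) * (1 - 1 / a) * (w * C * a) = (1 + w) * (a - 1) * w * C"
      "w * (1 - 1 / (w * a)) * (w * C * (w * a)) = w * (w * a - 1) * w * C"
      using w0 a by (simp_all add: field_simps)
    then show ?thesis unfolding s mult_minus_right by algebra
  qed
qed

section \<open>The three-term recurrence\<close>

lemma s_poly_0 [simp]: "s_poly q 0 = 1"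
  by (simp add: s_poly_def)

lemma s_poly_1:
  assumes "0 < q" "q < 1"
  shows "s_poly q (Suc 0) = smult (1 - q\<^sup>2) [:0, 1:]"
proof -
  have w: "0 < q\<^sup>2" "q\<^sup>2 < 1" using assms by (simp_all add: power_less_one_iff)
  have "poly (s_poly q (Suc 0)) x = poly (smult (1 - q\<^sup>2) [:0, 1:]) x" for x
  proof -
    have "poly (s_poly q (Suc 0)) x = s_coeff (q\<^sup>2) (1 / q\<^sup>2) 0 * lap_prod (q\<^sup>2) x (Suc 0)"
      using poly_s_poly[of q 0 1 x] assms by simp
    also have "s_coeff (q\<^sup>2) (1 / q\<^sup>2) 0 = - 1 / (1 - q\<^sup>2)"
      using w assms by (simp add: s_coeff_def q_poch_def power2_eq_square)
    also have "lap_prod (q\<^sup>2) x (Suc 0) = - ((1 - q\<^sup>2)\<^sup>2 * x)"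
      by (simp add: lap_prod_def)
    also have "- 1 / (1 - q\<^sup>2) * - ((1 - q\<^sup>2)\<^sup>2 * x) = poly (smult (1 - q\<^sup>2) [:0, 1:]) x"
      using w by (simp add: power2_eq_square)
    finally show ?thesis .
  qed
  then show ?thesis by (simp add: poly_eq_poly_eq_iff[symmetric] fun_eq_iff)
qed

lemma s_poly_rec:
  assumes q: "0 < q" "q < 1"
  defines "w \<equiv> q\<^sup>2"
  shows "smult (1 - w ^ (n + 2)) (s_poly q (n + 2)) =
    smult ((1 - w)\<^sup>2) ([:0, 1:] * s_poly q (n + 1))
    + smult ((1 + w) * (1 - w ^ (n + 1))) (s_poly q (n + 1)) - smult (w * (1 - w ^ n)) (s_poly q n)"
proof -
  have w: "0 < w" "w < 1" "q \<noteq> 0" using q by (simp_all add: w_def power_less_one_iff)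
  define a where "a = 1 / w ^ Suc n"
  have a: "a \<noteq> 0" using w by (simp add: a_def)
  have a': "1 / w ^ Suc (Suc n) = a / w" "1 / w ^ n = w * a" "w ^ (n + 2) = w / a" "w ^ (n + 1) = 1 / a"
      "w ^ n = 1 / (w * a)"
    using w by (simp_all add: a_def)
  have "poly (smult (1 - w ^ (n + 2)) (s_poly q (n + 2))) x =
    poly (smult ((1 - w)\<^sup>2) ([:0, 1:] * s_poly q (n + 1))
    + smult ((1 + w) * (1 - w ^ (n + 1))) (s_poly q (n + 1)) - smult (w * (1 - w ^ n)) (s_poly q n)) x" for x
  proof -
    define N where "N = n + 2"
    let ?L = "\<lambda>i. lap_prod w x (Suc i)"
    have s2: "poly (s_poly q (n + 2)) x = (\<Sum>i<Suc N. s_coeff w (a / w) i * ?L i)"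
      using poly_s_poly[of q "Suc n" "Suc N" x] w by (simp add: N_def flip: w_def a'(1))
    have s1: "poly (s_poly q (n + 1)) x = (\<Sum>i<N'. s_coeff w a i * ?L i)" if "Suc n \<le> N'" for N'
      using poly_s_poly[of q n N' x] w that by (simp flip: w_def add: a_def)
    \<comment> \<open>\<open>s_poly q 0\<close> is 1 and does not follow the pattern of
      \<open>s_coeff\<close>. The recurrence meets it only with the factor 1 - w^n, which is then
      0.\<close>
    have s0: "(1 - w ^ n) * poly (s_poly q n) x = (1 - w ^ n) * (\<Sum>i<Suc N. s_coeff w (w * a) i * ?L i)"
    proof (cases n)
      case (Suc n')
      have "w * a = 1 / w ^ Suc n'" using a'(2) Suc by simp
      then show ?thesis using poly_s_poly[of q n' "Suc N" x] w
        by (simp add: N_def Suc flip: w_def)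
    qed simp
    have sh: "(1 - w)\<^sup>2 * x * (\<Sum>i<N. s_coeff w a i * ?L i) =
      (\<Sum>i<N. s_coeff w a i * ((1 - w ^ Suc i) * (1 - w ^ Suc (Suc i)) / w ^ Suc i * ?L i))
      - (\<Sum>i<N. s_coeff w a i / w ^ Suc i * ?L (Suc i))"
    proof -
      have "(1 - w)\<^sup>2 * x * (c * ?L i) =
          c * ((1 - w ^ Suc i) * (1 - w ^ Suc (Suc i)) / w ^ Suc i * ?L i) - c / w ^ Suc i * ?L (Suc i)" for c i
      proof -
        have "(1 - w)\<^sup>2 * x * (c * ?L i) = c * ((1 - w)\<^sup>2 * x * ?L i)"
          by (simp only: mult_ac)
        also have "(1 - w)\<^sup>2 * x * ?L i =
            (1 - w ^ Suc i) * (1 - w ^ Suc (Suc i)) / w ^ Suc i * ?L i - ?L (Suc i) / w ^ Suc i"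
          using w by (intro lap_prod_shift) simp
        finally show ?thesis by (simp only: right_diff_distrib times_divide_eq_left times_divide_eq_right)
      qed
      then show ?thesis by (simp add: sum_distrib_left sum_subtractf del: power_Suc)
    qed
    \<comment> \<open>Since w a = w^(-n) and n < N, the product contains a zero factor. This lets
      the diagonal part of multiplication by x run over the same range as the expansion of
      s_(n+2).\<close>
    have aN: "s_coeff w a N = 0"
    proof -
      have "w * a = 1 / w ^ n" using a' by simp
      then have "q_poch w (w * a) N = 0" using w by (simp add: q_poch_eq_0 N_def)
      then show ?thesis by (simp add: s_coeff_def)
    qed
    have sh1: "(\<Sum>i<N. s_coeff w a i * ((1 - w ^ Suc i) * (1 - w ^ Suc (Suc i)) / w ^ Suc i * ?L i)) =
       (\<Sum>i<Suc N. s_coeff w a i * ((1 - w ^ Suc i) * (1 - w ^ Suc (Suc i)) / w ^ Suc i * ?L i))"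
      by (simp add: aN)
    define t where "t i = (1 - w ^ Suc i) * (1 - w ^ Suc (Suc i)) / w ^ Suc i" for i
    define A where "A = (1 + w) * (1 - 1 / a)"
    define B where "B = w * (1 - 1 / (w * a))"
    \<comment> \<open>The contribution of the right-hand side at index i without the off-diagonal
      part of multiplication by x, which arrives from index i - 1 and is therefore absent at i = 0
      (\<open>r0\<close> against \<open>r1\<close>).\<close>
    define T where "T i = t i * s_coeff w a i + A * s_coeff w a i - B * s_coeff w (w * a) i" for i
    have r0: "(1 - w / a) * s_coeff w (a / w) 0 = T 0"
      using s_coeff_rec(2)[OF w(1,2) a] by (simp add: T_def t_def A_def B_def power2_eq_square)
    have r1: "(1 - w / a) * s_coeff w (a / w) (Suc m) = T (Suc m) - s_coeff w a m / w ^ Suc m" for m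
      using s_coeff_rec(1)[OF w(1,2) a, of m] by (simp add: T_def t_def A_def B_def numeral_eq_Suc)
    have "poly (smult (1 - w ^ (n + 2)) (s_poly q (n + 2))) x = (\<Sum>i<Suc N. (1 - w / a) * s_coeff w (a / w) i * ?L i)"
      by (simp only: poly_smult s2 a' sum_distrib_left mult.assoc)
    also have "\<dots> = (\<Sum>i<Suc N. T i * ?L i) - (\<Sum>i<N. s_coeff w a i / w ^ Suc i * ?L (Suc i))"
      by (simp only: sum.lessThan_Suc_shift r0 r1) (simp only: left_diff_distrib sum_subtractf add_diff_eq)
    also have "(\<Sum>i<Suc N. T i * ?L i) =
       (\<Sum>i<Suc N. s_coeff w a i * (t i * ?L i)) + A * (\<Sum>i<Suc N. s_coeff w a i * ?L i)
       - B * (\<Sum>i<Suc N. s_coeff w (w * a) i * ?L i)"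
      unfolding sum_distrib_left sum.distrib[symmetric] sum_subtractf[symmetric] T_def
      by (rule sum.cong) (simp_all add: algebra_simps)
    also have "\<dots> - (\<Sum>i<N. s_coeff w a i / w ^ Suc i * ?L (Suc i)) =
       (1 - w)\<^sup>2 * x * (\<Sum>i<N. s_coeff w a i * ?L i) + A * (\<Sum>i<Suc N. s_coeff w a i * ?L i)
       - B * (\<Sum>i<Suc N. s_coeff w (w * a) i * ?L i)"
      by (simp only: sh sh1 t_def)
    also have "\<dots> = (1 - w)\<^sup>2 * x * (\<Sum>i<N. s_coeff w a i * ?L i) + A * (\<Sum>i<Suc N. s_coeff w a i * ?L i)
       - w * ((1 - w ^ n) * poly (s_poly q n) x)"
      unfolding s0 by (simp only: B_def a'(5) mult.assoc)
    also have "\<dots> = (1 - w)\<^sup>2 * x * poly (s_poly q (n + 1)) x + A * poly (s_poly q (n + 1)) x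
       - w * ((1 - w ^ n) * poly (s_poly q n) x)"
    proof -
      have "Suc n \<le> N" "Suc n \<le> Suc N" by (simp_all add: N_def)
      then show ?thesis
        unfolding s1[OF \<open>Suc n \<le> N\<close>, symmetric] s1[OF \<open>Suc n \<le> Suc N\<close>, symmetric] by simp
    qed
    also have "\<dots> = poly (smult ((1 - w)\<^sup>2) ([:0, 1:] * s_poly q (n + 1))
    + smult ((1 + w) * (1 - w ^ (n + 1))) (s_poly q (n + 1)) - smult (w * (1 - w ^ n)) (s_poly q n)) x"
      unfolding A_def a'(4)[symmetric] by (simp add: mult_ac del: power_Suc)
    finally show ?thesis .
  qed
  then show ?thesis
    unfolding poly_eq_poly_eq_iff[symmetric] by (intro ext)
qed

text \<open>\<open>vac w d n i\<close> is the coefficient of $t^n$ in $\prod_{s=d+1}^{d+i} (1 - w^s) / (1 - t w^s)$.\<close>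

definition vac :: "real \<Rightarrow> nat \<Rightarrow> nat \<Rightarrow> nat \<Rightarrow> real"
  where "vac w d n i = q_poch w w (i + d) / q_poch w w d * w ^ ((d + 1) * n) * q_poch w (w ^ i) n / q_poch w w n"

lemma vac_0 [simp]: "0 < w \<Longrightarrow> w < 1 \<Longrightarrow> vac w d n 0 = (if n = 0 then 1 else 0)"
  by (cases n) (simp_all add: vac_def q_poch_nonzero q_poch_Suc_shift)

lemma vac_first_0: "vac w d 0 i = q_poch w w (i + d) / q_poch w w d"
  by (simp add: vac_def)

text \<open>The counterpart of (1 - w)^2 x: how (1 - w)^2 times the operator on zs^(i+1) \<otimes>
  z^(i+1+d) acts on the table, see \<open>T_monomial\<close>. The first two parentheses come from
  the q-integers produced by the two derivatives.\<close>

definition vac_lap :: "real \<Rightarrow> nat \<Rightarrow> nat \<Rightarrow> nat \<Rightarrow> real"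
  where "vac_lap w d n i = w * (1 - 1 / w ^ Suc i) * (1 - 1 / w ^ (Suc i + d)) *
    (vac w d n i - (1 + 1 / w) * vac w d n (Suc i) + 1 / w * vac w d n (i + 2))"

text \<open>The table satisfies the recurrence of \<open>s_poly_rec\<close> with (1 - w)^2 x
  replaced by \<open>vac_lap\<close>; the second equation is its start, matching
  \<open>s_poly_1\<close>. After extraction of the common factor c, what remains is polynomial in w,
  I = w^(i+1), D = w^d and N = w^n.\<close>

lemma vac_rec:
  assumes w: "0 < w" "w < 1"
  shows "(1 - w ^ (n + 2)) * vac w d (n + 2) (Suc i) =
    vac_lap w d (n + 1) i + (1 + w) * (1 - w ^ (n + 1)) * vac w d (n + 1) (Suc i)
    - w * (1 - w ^ n) * vac w d n (Suc i)"
    and "(1 - w) * vac w d 1 (Suc i) = vac_lap w d 0 i"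
proof -
  define I where "I = w ^ Suc i"
  define D where "D = w ^ d"
  define N where "N = w ^ n"
  define P where "P = w ^ ((d + 1) * n)"
  define A where "A = q_poch w w (i + d) / q_poch w w d"
  define u where "u = q_poch w I n"
  define R where "R = q_poch w w n"
  have w0: "w \<noteq> 0" using w by simp
  have I: "I \<noteq> 0" "I < 1" and D: "D \<noteq> 0"
    using w power_Suc_less_one[OF w, of i] by (simp_all add: I_def D_def)
  have R: "R \<noteq> 0" using q_poch_nonzero[OF w] by (simp add: R_def)
  have wN: "1 - w * N \<noteq> 0" "1 - w * (w * N) \<noteq> 0"
    using power_Suc_less_one[OF w, of n] power_Suc_less_one[OF w, of "Suc n"] by (auto simp: N_def)
  have pw: "w ^ (n + 2) = w * (w * N)" "w ^ (n + 1) = w * N" "w ^ n = N" "w ^ Suc i = I"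
    "w ^ (Suc i + d) = I * D" "w ^ i = I / w" "w ^ (i + 2) = w * I"
    using w0 by (simp_all add: N_def I_def D_def power_add)
  have pP: "w ^ ((d + 1) * (n + 2)) = P * (w * D)\<^sup>2" "w ^ ((d + 1) * (n + 1)) = P * (w * D)"
    by (simp_all add: P_def D_def power_add algebra_simps power2_eq_square power_mult[symmetric])
  have qR: "q_poch w w (n + 2) = R * (1 - w * N) * (1 - w * (w * N))" "q_poch w w (n + 1) = R * (1 - w * N)"
    by (simp_all add: R_def N_def q_poch_Suc mult_ac)
  have qA: "q_poch w w (Suc i + d) / q_poch w w d = A * (1 - I * D)"
    "q_poch w w (i + 2 + d) / q_poch w w d = A * (1 - I * D) * (1 - w * (I * D))"
    by (simp_all add: A_def I_def D_def q_poch_Suc power_add mult_ac)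
  have qI: "q_poch w I (n + 2) = u * (1 - N * I) * (1 - w * N * I)" "q_poch w I (n + 1) = u * (1 - N * I)"
    by (simp_all add: u_def N_def q_poch_Suc)
  have qI': "q_poch w (I / w) (n + 1) = (1 - I / w) * u"
    using w0 by (simp add: q_poch_Suc_shift u_def)
  \<comment> \<open>The factor 1 - I, needed to compare products based at w I and at I, is supplied
    by 1 - 1 / I in \<open>vac_lap\<close>.\<close>
  have qI'': "(1 - I) * q_poch w (w * I) (n + 1) = u * (1 - N * I) * (1 - w * N * I)"
    unfolding qI(1)[symmetric] by (simp add: q_poch_Suc_shift)
  define c where "c = A * P * u / (R * (1 - w * N))"
  have v1: "(1 - w * (w * N)) * vac w d (n + 2) (Suc i) = c * (1 - I * D) * (w * D)\<^sup>2 * (1 - N * I) * (1 - w * N * I)"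
    unfolding vac_def pw pP qR qA qI c_def using R wN by (simp add: divide_simps)
  have "vac w d (n + 1) i = c * (w * D) * (1 - I / w)"
    unfolding vac_def pw pP qR A_def[symmetric] qI' c_def using R wN by (simp add: divide_simps)
  then have v3: "vac w d (n + 1) i = c * D * (w - I)"
    using w0 by (simp add: right_diff_distrib mult.assoc)
  have v2: "vac w d (n + 1) (Suc i) = c * (1 - I * D) * (w * D) * (1 - N * I)"
    unfolding vac_def pw pP qR qA qI c_def using R wN by (simp add: divide_simps)
  have v4: "(1 - I) * vac w d (n + 1) (i + 2) = c * (1 - I * D) * (1 - w * (I * D)) * (w * D) * (1 - N * I) * (1 - w * N * I)"
  proof -
    have "(1 - I) * vac w d (n + 1) (i + 2) =
        A * (1 - I * D) * (1 - w * (I * D)) * (P * (w * D)) * ((1 - I) * q_poch w (w * I) (n + 1)) / (R * (1 - w * N))"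
      unfolding vac_def pw pP qR qA by simp
    then show ?thesis unfolding qI'' c_def by simp
  qed
  have v5: "vac w d n (Suc i) = c * (1 - I * D) * (1 - w * N)"
    unfolding vac_def pw qA P_def[symmetric] u_def[symmetric] R_def[symmetric] c_def
    using R wN by (simp add: divide_simps)
  have v6: "w * (1 - 1 / I) * (1 - 1 / (I * D)) * (x - (1 + 1 / w) * y + 1 / w * z) * (I * I * D) =
      w * (I - 1) * (I * D - 1) * x - (w + 1) * (I - 1) * (I * D - 1) * y - (I * D - 1) * ((1 - I) * z)" for x y z
    using w0 I D by (simp add: field_simps)
  \<comment> \<open>Multiplication by I * I * D clears the denominators of (1 - 1 / I) (1 - 1 / (I
    D)) and leaves one power of I to spare for w^i = I / w and the like.\<close>
  have "(1 - w ^ (n + 2)) * vac w d (n + 2) (Suc i) * (I * I * D) =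
    (vac_lap w d (n + 1) i + (1 + w) * (1 - w ^ (n + 1)) * vac w d (n + 1) (Suc i)
    - w * (1 - w ^ n) * vac w d n (Suc i)) * (I * I * D)"
    unfolding vac_lap_def pw left_diff_distrib[of _ _ "I * I * D"] distrib_right[of _ _ "I * I * D"]
      v1 v6 v4 v2 v3 v5 by algebra
  then show "(1 - w ^ (n + 2)) * vac w d (n + 2) (Suc i) =
    vac_lap w d (n + 1) i + (1 + w) * (1 - w ^ (n + 1)) * vac w d (n + 1) (Suc i)
    - w * (1 - w ^ n) * vac w d n (Suc i)"
    using I D by simp
  have v: "vac w d 0 i = A" "vac w d 0 (Suc i) = A * (1 - I * D)"
    "vac w d 0 (i + 2) = A * (1 - I * D) * (1 - w * (I * D))"
    unfolding vac_first_0 qA by (simp_all add: A_def)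
  have "(1 - w) * vac w d 1 (Suc i) = A * (1 - I * D) * (w * D) * (1 - I)"
    unfolding vac_def qA using w by (simp add: q_poch_Suc pw(4)[simplified] D_def)
  also have "\<dots> = vac_lap w d 0 i"
    unfolding vac_lap_def v pw using w0 I D by (simp add: field_simps)
  finally show "(1 - w) * vac w d 1 (Suc i) = vac_lap w d 0 i" .
qed

section \<open>Generating functions in t\<close>

definition vac_series :: "real \<Rightarrow> nat \<Rightarrow> nat \<Rightarrow> real fps"
  where "vac_series w d i = Abs_fps (\<lambda>n. vac w d n i)"

text \<open>The product gains its factor with s = i + d + 1. The closed form in \<open>vac\<close>
  is the q-binomial series for the denominators, and comparing neighbouring coefficients verifies
  it.\<close>

lemma vac_series_Suc:
  assumes w: "0 < w" "w < 1"
  shows "(1 - fps_const (w ^ (i + d + 1)) * fps_X) * vac_series w d (Suc i) =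
    fps_const (1 - w ^ (i + d + 1)) * vac_series w d i"
proof (rule fps_ext)
  fix n
  have A: "q_poch w w (Suc i + d) = q_poch w w (i + d) * (1 - w ^ (i + d + 1))"
    by (simp add: q_poch_Suc mult.commute)
  show "fps_nth ((1 - fps_const (w ^ (i + d + 1)) * fps_X) * vac_series w d (Suc i)) n =
      fps_nth (fps_const (1 - w ^ (i + d + 1)) * vac_series w d i) n"
  proof (cases n)
    case 0
    then show ?thesis by (simp add: vac_series_def left_diff_distrib mult.assoc vac_first_0 q_poch_Suc algebra_simps)
  next
    case (Suc m)
    define u where "u = q_poch w (w ^ Suc i) m"
    define c where "c = q_poch w w (i + d) / q_poch w w d * (1 - w ^ (i + d + 1)) * w ^ ((d + 1) * m) / q_poch w w m"
    have nz: "1 - w * w ^ m \<noteq> 0" using power_Suc_less_one[OF w, of m] by auto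
    have v1: "vac w d (Suc m) (Suc i) = c * (w * w ^ d) * (u * (1 - w ^ m * w ^ Suc i)) / (1 - w * w ^ m)"
      unfolding vac_def A c_def u_def by (simp add: q_poch_Suc power_add mult_ac)
    have v2: "(1 - w ^ (i + d + 1)) * vac w d (Suc m) i = c * (w * w ^ d) * ((1 - w ^ i) * u) / (1 - w * w ^ m)"
    proof -
      have "q_poch w (w ^ i) (Suc m) = (1 - w ^ i) * u" by (simp add: q_poch_Suc_shift u_def)
      then show ?thesis unfolding vac_def c_def by (simp add: q_poch_Suc power_add mult_ac)
    qed
    have v3: "vac w d m (Suc i) = c * u"
      unfolding vac_def A c_def u_def by simp
    have pw: "w ^ (i + d + 1) = w ^ i * (w * w ^ d)" "w ^ Suc i = w * w ^ i"
      by (simp_all add: power_add)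
    have "vac w d (Suc m) (Suc i) - w ^ (i + d + 1) * vac w d m (Suc i) =
        (1 - w ^ (i + d + 1)) * vac w d (Suc m) i"
      unfolding v1 v2 v3 unfolding pw nonzero_eq_divide_eq[OF nz] left_diff_distrib
        nonzero_divide_eq_eq[OF nz] times_divide_eq_left nonzero_mult_div_cancel_right[OF nz] using nz
      by (simp add: nonzero_divide_eq_eq[OF nz]) algebra
    then show ?thesis by (simp add: Suc vac_series_def left_diff_distrib mult.assoc)
  qed
qed

text \<open>This is G(e) (G(i+e) / G(e)) = G(i+e). In the induction step the factor 1 - w^(i+e+1) t
  is cancelled, which is possible because its constant term is 1.\<close>

lemma vac_series_mult:
  assumes w: "0 < w" "w < 1"
  shows "vac_series w 0 e * vac_series w e i = vac_series w 0 (i + e)"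
proof (induction i)
  case 0
  have "vac_series w e 0 = 1"
    by (rule fps_ext) (simp add: vac_series_def w)
  then show ?case by simp
next
  case (Suc i)
  let ?f = "1 - fps_const (w ^ (i + e + 1)) * fps_X :: real fps"
  have "?f * (vac_series w 0 e * vac_series w e (Suc i)) = vac_series w 0 e * (?f * vac_series w e (Suc i))"
    by (simp only: mult_ac)
  also have "\<dots> = fps_const (1 - w ^ (i + e + 1)) * (vac_series w 0 e * vac_series w e i)"
    unfolding vac_series_Suc[OF w] by (simp only: mult_ac)
  also have "\<dots> = ?f * vac_series w 0 (Suc i + e)"
    using vac_series_Suc[OF w, of "i + e" 0] Suc.IH by simp
  finally have *: "?f * (vac_series w 0 e * vac_series w e (Suc i)) = ?f * vac_series w 0 (Suc i + e)" .
  have "fps_nth ?f 0 = 1" by simp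
  then have "?f \<noteq> 0" by (metis fps_zero_nth zero_neq_one)
  with * show ?case by simp
qed

text \<open>Both sides are the coefficient of $t^p$ in $G(m + e) G(l + e) / G(e)$, where
  $G(i) = \prod_{s=1}^i (1 - w^s) / (1 - t w^s)$.\<close>

lemma vac_convolution:
  assumes w: "0 < w" "w < 1"
  shows "(\<Sum>a\<le>p. vac w 0 (p - a) (m + e) * vac w e a l) = (\<Sum>a\<le>p. vac w 0 (p - a) (l + e) * vac w e a m)"
proof -
  have "vac_series w e l * vac_series w 0 (m + e) = vac_series w e m * vac_series w 0 (l + e)"
    unfolding vac_series_mult[OF w, symmetric] by (simp only: mult_ac)
  then have "fps_nth (vac_series w e l * vac_series w 0 (m + e)) p =
      fps_nth (vac_series w e m * vac_series w 0 (l + e)) p"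
    by simp
  then show ?thesis
    by (simp add: fps_mult_nth vac_series_def atLeast0AtMost mult.commute)
qed

section \<open>Tensor products, presentations and operator polynomials\<close>

lemma clinear_compose: "clinear f \<Longrightarrow> clinear g \<Longrightarrow> clinear (\<lambda>x. f (g x))"
  by (rule clinearI) (simp_all add: clinear_add clinear_scaleC)

lemma clinear_ident: "clinear (\<lambda>x. x)"
  by (rule clinearI) simp_all

lemma clinear_sum: "clinear f \<Longrightarrow> f (sum g A) = (\<Sum>x\<in>A. f (g x))"
  by (induction A rule: infinite_finite_induct) (simp_all add: clinear_zero clinear_add)

lemma clinear_minus: "clinear f \<Longrightarrow> f (- x) = - f x"
  using clinear_diff[of f 0 x] by (simp add: clinear_zero)

lemma cbilinear_clinear:
  assumes "cbilinear f"
  shows "clinear (f x)" "clinear (\<lambda>x. f x y)"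
  using assms by (auto simp: cbilinear_def)

lemma cbilinear_sum:
  assumes "cbilinear f"
  shows "f (sum g A) y = (\<Sum>x\<in>A. f (g x) y)" "f x (sum h B) = (\<Sum>y\<in>B. f x (h y))"
  using clinear_sum[OF cbilinear_clinear(2)[OF assms]] clinear_sum[OF cbilinear_clinear(1)[OF assms]] by auto

lemma cbilinear_zero:
  assumes "cbilinear f"
  shows "f 0 y = 0" "f x 0 = 0"
  using clinear_zero[OF cbilinear_clinear(2)[OF assms]] clinear_zero[OF cbilinear_clinear(1)[OF assms]] by auto

section \<open>Evaluation in a presented algebra\<close>

lemma prod_list_free_eval:
  "free_eval \<phi> (Poly_Mapping.single (Word gs) 1) = prod_list (map \<phi> gs)"
  by (simp add: free_eval_def scaleC_one)

lemma gen_mult: "gen g * gen h = Poly_Mapping.single (Word [g, h]) 1"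
  by (simp add: gen_def mult_single plus_word_def)

lemma one_free_alg: "(1 :: 'g free_alg) = Poly_Mapping.single (Word []) 1"
  by (simp add: single_one[symmetric] zero_word_def)

lemma clinear_free_eval: "clinear (free_eval \<phi>)"
  unfolding free_eval_def by (rule clinear_lin_ext)

lemma free_eval_simps:
  "free_eval \<phi> (gen g * gen h) = \<phi> g * \<phi> h" "free_eval \<phi> (gen g) = \<phi> g" "free_eval \<phi> 1 = 1"
  "free_eval \<phi> (x + y) = free_eval \<phi> x + free_eval \<phi> y"
  "free_eval \<phi> (x - y) = free_eval \<phi> x - free_eval \<phi> y"
  "free_eval \<phi> (c *\<^sub>C x) = c *\<^sub>C free_eval \<phi> x"
  by (simp_all add: gen_mult[unfolded gen_def] one_free_alg prod_list_free_eval gen_def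
      clinear_add[OF clinear_free_eval] clinear_diff[OF clinear_free_eval] clinear_scaleC[OF clinear_free_eval])

lemma presented_by_induct [consumes 1, case_names one mult add scale]:
  assumes "presented_by \<phi> R" and one: "P 1" and mult: "\<And>g f. P f \<Longrightarrow> P (\<phi> g * f)"
    and add: "\<And>f g. P f \<Longrightarrow> P g \<Longrightarrow> P (f + g)" and scale: "\<And>c f. P f \<Longrightarrow> P (c *\<^sub>C f)"
  shows "P f"
proof -
  have zero: "P 0" using scale[OF one, of 0] by simp
  have words: "P (prod_list (map \<phi> gs))" for gs
    by (induction gs) (simp_all add: one mult)
  from assms(1) obtain x where f: "f = free_eval \<phi> x"
    unfolding presented_by_def by (metis surjD)
  have "P (\<Sum>k\<in>A. Poly_Mapping.lookup x k *\<^sub>C prod_list (map \<phi> (letters k)))" for A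
    by (induction A rule: infinite_finite_induct) (simp_all add: zero add scale words)
  then show ?thesis by (simp add: f free_eval_def lin_ext_def)
qed

lemma presented_by_rel:
  assumes "presented_by \<phi> R" "r \<in> R"
  shows "free_eval \<phi> r = 0"
proof -
  have "1 * r * 1 \<in> complex_vector.span {a * r * b | a r b. r \<in> R}"
    by (rule complex_vector.span_base) (use assms(2) in blast)
  then show ?thesis using assms(1) by (simp add: presented_by_def set_eq_iff)
qed

section \<open>The action on a tensor product\<close>

lemma cbilinear_tensor_map:
  "clinear f \<Longrightarrow> clinear g \<Longrightarrow> cbilinear (\<lambda>x y. f x \<otimes> g y)"
  by (rule cbilinear_comp[OF cbilinear_tens])

lemma tensor_map_tens: "clinear f \<Longrightarrow> clinear g \<Longrightarrow> tensor_map f g (x \<otimes> y) = f x \<otimes> g y"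
  unfolding tensor_map_def by (rule tensor_lift_tens) (rule cbilinear_tensor_map)

lemma clinear_tensor_map: "clinear f \<Longrightarrow> clinear g \<Longrightarrow> clinear (tensor_map f g)"
  unfolding tensor_map_def by (rule clinear_tensor_lift) (rule cbilinear_tensor_map)

lemma clinear_eq_tensorI:
  assumes "clinear f" "clinear g" "\<And>x y. f (x \<otimes> y) = g (x \<otimes> y)"
  shows "f t = g t"
  by (induction t rule: tensor_induct) (simp_all add: assms clinear_zero clinear_add)

lemma cbilinear_tensor_act:
  assumes "cbilinear act"
  shows "cbilinear (\<lambda>\<xi> \<eta>. tensor_map (act \<xi>) (act \<eta>) t)"
proof -
  note lin = cbilinear_clinear(1)[OF assms]
  have *: "tensor_map (act (\<xi> + \<xi>')) (act \<eta>) t = tensor_map (act \<xi>) (act \<eta>) t + tensor_map (act \<xi>') (act \<eta>) t"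
    "tensor_map (act \<eta>) (act (\<xi> + \<xi>')) t = tensor_map (act \<eta>) (act \<xi>) t + tensor_map (act \<eta>) (act \<xi>') t"
    "tensor_map (act (c *\<^sub>C \<xi>)) (act \<eta>) t = c *\<^sub>C tensor_map (act \<xi>) (act \<eta>) t"
    "tensor_map (act \<eta>) (act (c *\<^sub>C \<xi>)) t = c *\<^sub>C tensor_map (act \<eta>) (act \<xi>) t" for \<xi> \<xi>' \<eta> c
    by (induction t rule: tensor_induct)
      (simp_all add: tensor_map_tens lin clinear_zero clinear_add clinear_tensor_map
        cbilinearD[OF assms] cbilinearD[OF cbilinear_tens] scaleC_add_right)
  show ?thesis by (rule cbilinearI) (fact *)+
qed

lemma tensor_act_tens:
  "cbilinear act \<Longrightarrow> tensor_act act (\<xi> \<otimes> \<eta>) t = tensor_map (act \<xi>) (act \<eta>) t"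
  unfolding tensor_act_def by (rule tensor_lift_tens) (rule cbilinear_tensor_act)

lemma clinear_tensor_act_left: "cbilinear act \<Longrightarrow> clinear (\<lambda>u. tensor_act act u t)"
  unfolding tensor_act_def by (rule clinear_tensor_lift) (rule cbilinear_tensor_act)

lemma clinear_tensor_act:
  assumes "cbilinear act"
  shows "clinear (tensor_act act u)"
proof (induction u rule: tensor_induct)
  case zero
  show ?case
    by (rule clinearI) (simp_all add: clinear_zero[OF clinear_tensor_act_left[OF assms]])
next
  case (add u v)
  then show ?case
    by (intro clinearI) (simp_all add: clinear_add[OF clinear_tensor_act_left[OF assms]]
        clinear_add clinear_scaleC scaleC_add_right add_ac)
next
  case (tens \<xi> \<eta>)
  have "clinear (tensor_map (act \<xi>) (act \<eta>))"
    by (intro clinear_tensor_map cbilinear_clinear(1)[OF assms])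
  then show ?case by (simp add: tensor_act_tens[OF assms])
qed

lemma tensor_act_mult:
  assumes "is_module act"
  shows "tensor_act act (u * v) t = tensor_act act u (tensor_act act v t)"
proof -
  have bil: "cbilinear act" and m: "act (\<xi> * \<eta>) f = act \<xi> (act \<eta> f)" for \<xi> \<eta> f
    using assms by (simp_all add: is_module_def)
  note lin = cbilinear_clinear(1)[OF bil]
  note l = clinear_add[OF clinear_tensor_act_left[OF bil]] clinear_zero[OF clinear_tensor_act_left[OF bil]]
    clinear_add[OF clinear_tensor_act[OF bil]] clinear_zero[OF clinear_tensor_act[OF bil]]
  show ?thesis
  proof (induction u rule: tensor_induct)
    case (tens a b)
    show ?case
    proof (induction v rule: tensor_induct)
      case (tens a' b')
      show ?case
        by (induction t rule: tensor_induct)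
          (simp_all add: l tensor_mult_tens tensor_act_tens[OF bil] tensor_map_tens lin m)
    qed (simp_all add: l distrib_left)
  qed (simp_all add: l distrib_right)
qed

lemma tensor_act_one:
  assumes "is_module act"
  shows "tensor_act act 1 t = t"
proof -
  have bil: "cbilinear act" and m: "act 1 f = f" for f
    using assms by (simp_all add: is_module_def)
  show ?thesis unfolding one_tensor_def
    by (rule clinear_eq_tensorI[OF clinear_tensor_act[OF bil] clinear_ident])
      (simp add: tensor_act_tens[OF bil] tensor_map_tens cbilinear_clinear(1)[OF bil] m)
qed

section \<open>Polynomials in an operator\<close>

lemma poly_op_eq_sum:
  assumes "degree p \<le> N"
  shows "poly_op p T v = (\<Sum>i\<le>N. complex_of_real (coeff p i) *\<^sub>C (T ^^ i) v)"
  unfolding poly_op_def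
  by (rule sum.mono_neutral_left) (use assms in \<open>auto simp: coeff_eq_0\<close>)

lemma poly_op_add: "poly_op (p + p') T v = poly_op p T v + poly_op p' T v"
proof -
  define N where "N = max (degree p) (degree p')"
  have "degree (p + p') \<le> N" by (simp add: N_def degree_add_le_max)
  then show ?thesis
    by (simp add: poly_op_eq_sum[of _ N] N_def scaleC_add_left sum.distrib)
qed

lemma poly_op_smult: "poly_op (smult c p) T v = complex_of_real c *\<^sub>C poly_op p T v"
  by (subst (1 2) poly_op_eq_sum[of _ "degree p"])
    (simp_all add: complex_vector.scale_sum_right scaleC_scaleC)

lemma poly_op_diff: "poly_op (p - p') T v = poly_op p T v - poly_op p' T v"
  using poly_op_add[of p "smult (- 1) p'" T v] poly_op_smult[of "- 1" p' T v] by (simp add: scaleC_one)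

text \<open>The factor x is moved to the argument, so that \<open>M_rec\<close> involves lower
  orders evaluated at \<open>T t\<close>.\<close>

lemma poly_op_X: "poly_op ([:0, 1:] * p) T v = poly_op p T (T v)"
proof -
  have "poly_op (pCons 0 p) T v = (\<Sum>i\<le>Suc (degree p). complex_of_real (coeff (pCons 0 p) i) *\<^sub>C (T ^^ i) v)"
    by (rule poly_op_eq_sum) (rule degree_pCons_le)
  also have "\<dots> = poly_op p T (T v)"
    unfolding sum.atMost_Suc_shift by (simp add: poly_op_def funpow_swap1)
  finally show ?thesis by simp
qed

lemma poly_op_1: "poly_op 1 T v = v"
  by (simp add: poly_op_def scaleC_one)

section \<open>The quantum plane with its partial derivatives\<close>

text \<open>The interface between the algebra and the proof of associativity: \<open>kk\<close>,
  \<open>ki\<close>, \<open>ee\<close>, \<open>ff\<close> are the actions of K, its inverse, E and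
  F; r is q^(1/2); \<open>D\<close> is the right derivative in zs and \<open>D'\<close> the left
  derivative in z, the two that enter the operator. Their twists arise when dzs is moved to the left
  end and dz to the right place at the front of a product (\<open>r_generator\<close>,
  \<open>l_generator\<close>).\<close>

locale disc_calculus =
  fixes q :: real and r :: complex and z zs :: "'p::complex_algebra_1"
    and st kk ki ee ff D D' :: "'p \<Rightarrow> 'p"
  assumes q: "0 < q" "q < 1" and r: "r \<noteq> 0" "cnj r = r"
    and rel: "zs * z = complex_of_real (q\<^sup>2) *\<^sub>C (z * zs) + complex_of_real (1 - q\<^sup>2) *\<^sub>C 1"
    and gen_induct: "\<And>P f. P 1 \<Longrightarrow> (\<And>f. P f \<Longrightarrow> P (z * f)) \<Longrightarrow> (\<And>f. P f \<Longrightarrow> P (zs * f)) \<Longrightarrow>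
      (\<And>f g. P f \<Longrightarrow> P g \<Longrightarrow> P (f + g)) \<Longrightarrow> (\<And>c f. P f \<Longrightarrow> P (c *\<^sub>C f)) \<Longrightarrow> P f"
    and lin: "clinear kk" "clinear ki" "clinear ee" "clinear ff" "clinear D" "clinear D'"
    and kk_mult: "kk (f * g) = kk f * kk g" and ki_mult: "ki (f * g) = ki f * ki g"
    and kk_one: "kk 1 = 1" and ki_one: "ki 1 = 1"
    and kk_z: "kk z = complex_of_real (q\<^sup>2) *\<^sub>C z" and ki_z: "ki z = (1 / complex_of_real (q\<^sup>2)) *\<^sub>C z"
    and ff_mult: "ff (f * g) = ff f * ki g + f * ff g" and ff_z: "ff z = r *\<^sub>C 1"
    and st: "antilinear st" "st (st f) = f" "st (f * g) = st g * st f" "st z = zs"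
    and st_kk: "st (kk f) = ki (st f)" and st_ff: "st (ff f) = complex_of_real (q\<^sup>2) *\<^sub>C ee (st f)"
    and ff_zs: "ff zs = - ((r * complex_of_real (q\<^sup>2)) *\<^sub>C zs\<^sup>2)"
    and D_mult: "D (f * g) = D f * kk g + f * D g" and D_z: "D z = 0" and D_zs: "D zs = 1"
    and D'_mult: "D' (f * g) = D' f * g + ki f * D' g" and D'_z: "D' z = 1" and D'_zs: "D' zs = 0"
begin

section \<open>Scalars, involution and twisted commutators\<close>

definition w :: complex where "w = complex_of_real (q\<^sup>2)"
definition iw :: complex where "iw = 1 / complex_of_real (q\<^sup>2)"

lemma w_iw: "w * iw = 1" "iw * w = 1" "w * (iw * x) = x" "iw * (w * x) = x"
  and w_nz: "w \<noteq> 0" "iw \<noteq> 0" and cnj_w: "cnj w = w" "cnj iw = iw"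
  using q by (simp_all add: w_def iw_def)

lemma iw_eq: "iw = 1 / w"
  by (simp add: w_def iw_def)

lemma q2: "0 < q\<^sup>2" "q\<^sup>2 < 1"
  using q by (simp_all add: power_less_one_iff)

lemma w_power: "w ^ n = complex_of_real ((q\<^sup>2) ^ n)"
  by (simp add: w_def)

lemma w_power_neq_1: "w ^ Suc n \<noteq> 1"
proof -
  have "(q\<^sup>2) ^ Suc n < 1" by (rule power_Suc_less_one) (fact q2)+
  then show ?thesis unfolding w_power of_real_eq_1_iff by simp
qed

lemma w_neq_1: "w \<noteq> 1"
  using w_power_neq_1[of 0] by simp

lemma iw_power: "iw ^ n = 1 / w ^ n"
  by (simp add: iw_eq power_one_over)

lemma iw_power_neq_1: "iw ^ Suc n \<noteq> 1"
  using w_power_neq_1[of n] by (simp add: iw_power del: power_Suc)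

lemma zs_z: "zs * z = w *\<^sub>C (z * zs) + (1 - w) *\<^sub>C 1"
  using rel by (simp add: w_def)

lemmas st_add = st(1)[unfolded antilinear_def, THEN conjunct1, rule_format]
lemmas st_scale = st(1)[unfolded antilinear_def, THEN conjunct2, rule_format]

lemma st_zs: "st zs = z"
  using st(2)[of z] by (simp add: st(4))

lemma st_one: "st 1 = 1"
  using st(3)[of 1 "st 1"] by (simp add: st(2))

lemma st_zero: "st 0 = 0"
  using st_scale[of 0 0] by simp

lemma st_diff: "st (f - g) = st f - st g"
  using st_add[of "f - g" g] by (simp add: algebra_simps)

lemma st_power: "st (f ^ n) = st f ^ n"
  by (induction n) (simp_all add: st_one st(3) power_commutes)

lemma st_ki: "st (ki f) = kk (st f)"
  using st_kk[of "st f"] by (metis st(2) st_kk)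

lemma kk_z': "kk z = w *\<^sub>C z" and ki_z': "ki z = iw *\<^sub>C z"
  and kk_zs: "kk zs = iw *\<^sub>C zs" and ki_zs: "ki zs = w *\<^sub>C zs"
  using st_kk[of z] st_ki[of z]
  by (simp_all add: kk_z ki_z w_def iw_def st(4) st_scale)

lemmas lin_simps = lin[THEN clinear_add] lin[THEN clinear_scaleC] lin[THEN clinear_diff] lin[THEN clinear_zero]
lemmas scale_simps = mult_scaleC_left mult_scaleC_right scaleC_scaleC scaleC_one
  scaleC_add_right scaleC_add_left complex_vector.scale_right_diff_distrib complex_vector.scale_left_diff_distrib
  complex_vector.scale_minus_left complex_vector.scale_minus_right

lemma kk_ki: "kk (ki f) = f" "ki (kk f) = f"
  by (induction f rule: gen_induct)
    (simp_all add: kk_one ki_one kk_mult ki_mult kk_z' ki_z' kk_zs ki_zs lin_simps scale_simps w_iw)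

lemma gen_D: "D 1 = 0" "D' 1 = 0" "ff 1 = 0"
  using D_mult[of 1 1] D'_mult[of 1 1] ff_mult[of 1 1] by (simp_all add: kk_one ki_one)

text \<open>The commutator on the right obeys the same twisted Leibniz rule as F, so agreement on
  the generators suffices. The factor 1 - w keeps division out of the induction.\<close>

lemma ff_inner: "(1 - w) *\<^sub>C ff f = (r * w) *\<^sub>C (zs * ki f - f * zs)"
proof (induction f rule: gen_induct)
  case 2
  fix f assume "(1 - w) *\<^sub>C ff f = (r * w) *\<^sub>C (zs * ki f - f * zs)"
  then have IH: "z * ((1 - w) *\<^sub>C ff f) = z * ((r * w) *\<^sub>C (zs * ki f - f * zs))" by simp
  have "(1 - w) *\<^sub>C ff (z * f) = ((1 - w) * r) *\<^sub>C ki f + z * ((1 - w) *\<^sub>C ff f)"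
    by (simp add: ff_mult ff_z scale_simps right_diff_distrib)
  also have "\<dots> = (r * w) *\<^sub>C (zs * ki (z * f) - z * f * zs)"
  proof -
    have "zs * ki (z * f) = iw *\<^sub>C ((zs * z) * ki f)"
      by (simp add: ki_mult ki_z' scale_simps mult.assoc)
    also have "\<dots> = z * (zs * ki f) + (iw - 1) *\<^sub>C ki f"
      unfolding zs_z by (simp add: scale_simps distrib_right left_diff_distrib right_diff_distrib w_iw mult.assoc)
    finally have X: "zs * ki (z * f) = z * (zs * ki f) + (iw - 1) *\<^sub>C ki f" .
    show ?thesis unfolding IH X by (simp add: scale_simps algebra_simps w_iw)
  qed
  finally show "(1 - w) *\<^sub>C ff (z * f) = (r * w) *\<^sub>C (zs * ki (z * f) - z * f * zs)" .
next
  case 3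
  fix f assume "(1 - w) *\<^sub>C ff f = (r * w) *\<^sub>C (zs * ki f - f * zs)"
  then have IH: "zs * ((1 - w) *\<^sub>C ff f) = zs * ((r * w) *\<^sub>C (zs * ki f - f * zs))" by simp
  have "(1 - w) *\<^sub>C ff (zs * f) = - ((1 - w) * (r * w)) *\<^sub>C (zs * zs * ki f) + zs * ((1 - w) *\<^sub>C ff f)"
    by (simp add: ff_mult ff_zs scale_simps right_diff_distrib w_def power2_eq_square)
  then show "(1 - w) *\<^sub>C ff (zs * f) = (r * w) *\<^sub>C (zs * ki (zs * f) - zs * f * zs)"
    unfolding IH by (simp add: ki_mult ki_zs scale_simps algebra_simps)
next
  case (5 c f)
  have "(1 - w) *\<^sub>C ff (c *\<^sub>C f) = c *\<^sub>C ((1 - w) *\<^sub>C ff f)"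
    by (simp only: lin_simps scaleC_scaleC mult.commute)
  also have "\<dots> = (r * w) *\<^sub>C (zs * ki (c *\<^sub>C f) - c *\<^sub>C f * zs)"
    unfolding 5 by (simp add: lin_simps scale_simps mult_ac)
  finally show ?case .
qed (simp_all add: gen_D ki_one lin_simps scale_simps algebra_simps)

lemma ff_eq: "ff f = (r * w / (1 - w)) *\<^sub>C (zs * ki f - f * zs)"
proof -
  have "(1 / (1 - w)) *\<^sub>C ((1 - w) *\<^sub>C ff f) = (1 / (1 - w)) *\<^sub>C ((r * w) *\<^sub>C (zs * ki f - f * zs))"
    by (simp only: ff_inner)
  then show ?thesis using w_neq_1 by (simp add: scaleC_scaleC scaleC_one)
qed

lemma ee_eq: "ee f = (r / (1 - w)) *\<^sub>C (kk f * z - z * f)"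
proof -
  have "w *\<^sub>C ee f = st (ff (st f))"
    by (simp add: st_ff st(2) w_def)
  also have "\<dots> = (r * w / (1 - w)) *\<^sub>C (kk f * z - z * f)"
    by (simp add: ff_eq st_scale st_diff st(2,3) st_zs st_ki r cnj_w)
  finally have "iw *\<^sub>C (w *\<^sub>C ee f) = iw *\<^sub>C ((r * w / (1 - w)) *\<^sub>C (kk f * z - z * f))" by simp
  then show ?thesis using w_nz by (simp add: scaleC_scaleC w_iw scaleC_one iw_eq)
qed

lemma D_z_left: "D (z * f) = z * D f" "D (zs * f) = kk f + zs * D f"
  and D'_z_left: "D' (z * f) = f + iw *\<^sub>C (z * D' f)" "D' (zs * f) = w *\<^sub>C (zs * D' f)"
  and D_zs_right: "D (f * zs) = iw *\<^sub>C (D f * zs) + f" and D'_zs_right: "D' (f * zs) = D' f * zs"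
  by (simp_all add: D_mult D'_mult D_z D_zs D'_z D'_zs kk_z' kk_zs ki_z' ki_zs scale_simps)

lemma D_kk: "D (kk f) = iw *\<^sub>C kk (D f)"
  by (induction f rule: gen_induct)
    (simp_all add: gen_D kk_one kk_mult D_z_left kk_z' kk_zs lin_simps scale_simps w_iw mult.commute)

lemma D_ki: "D (ki f) = w *\<^sub>C ki (D f)"
  using D_kk[of "ki f"] by (metis kk_ki lin_simps(8) scaleC_scaleC w_iw(1) scaleC_one)

lemma D'_ki: "D' (ki f) = iw *\<^sub>C ki (D' f)"
  by (induction f rule: gen_induct)
    (simp_all add: gen_D ki_one ki_mult D'_z_left ki_z' ki_zs lin_simps scale_simps w_iw mult.commute)

lemma D'_kk: "D' (kk f) = w *\<^sub>C kk (D' f)"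
  using D'_ki[of "kk f"] by (metis kk_ki lin_simps(7) scaleC_scaleC w_iw(1) scaleC_one)

lemma D'_ff: "D' (ff f) = ff (D' f)"
  by (simp add: ff_eq lin_simps D'_z_left D'_zs_right D'_ki scale_simps w_iw)

text \<open>In the commutator form of F, left and right multiplication by \<open>zs\<close> give the
  weights w and 1 / w under \<open>D\<close>. Their mismatch c (1 / w - w) = r (1 + w) is the
  correction term, which \<open>T_Delta_F\<close> absorbs.\<close>

lemma D_ff: "D (ff f) = w *\<^sub>C ff (D f) - (r * (1 + w)) *\<^sub>C (D f * zs)"
proof -
  define c where "c = r * w / (1 - w)"
  have c: "c * iw = c * w + r * (1 + w)"
    unfolding c_def iw_eq using w_nz w_neq_1 by (simp add: field_simps)
  have "D (ff f) = (c * w) *\<^sub>C (zs * ki (D f)) - (c * iw) *\<^sub>C (D f * zs)"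
    by (simp add: ff_eq lin_simps D_z_left D_zs_right D_ki scale_simps kk_ki flip: c_def)
  then show ?thesis
    unfolding c by (simp add: ff_eq scale_simps mult.commute flip: c_def)
qed

lemma st_D: "st (D f) = D' (st f)"
  by (induction f rule: gen_induct)
    (simp_all add: gen_D st_one st_zero st_add st_scale st(3,4) st_zs D_z_left D'_zs_right D'_mult D'_z D'_zs lin_simps st_kk)

subsection \<open>Monomial basis\<close>

definition mon :: "nat \<times> nat \<Rightarrow> 'p" where "mon p = z ^ fst p * zs ^ snd p"

lemma zs_z_power: "zs * z ^ j = w ^ j *\<^sub>C (z ^ j * zs) + (1 - w ^ j) *\<^sub>C z ^ (j - 1)"
proof (induction j)
  case (Suc j)
  have "zs * z ^ Suc j = (w *\<^sub>C (z * zs) + (1 - w) *\<^sub>C 1) * z ^ j"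
    unfolding zs_z[symmetric] by (simp add: mult.assoc)
  also have "\<dots> = w *\<^sub>C (z * (zs * z ^ j)) + (1 - w) *\<^sub>C z ^ j"
    by (simp add: scale_simps distrib_right left_diff_distrib mult.assoc)
  also have "z * (zs * z ^ j) = w ^ j *\<^sub>C (z ^ Suc j * zs) + (1 - w ^ j) *\<^sub>C z ^ j"
    unfolding Suc.IH by (cases j) (simp_all add: scale_simps distrib_left right_diff_distrib mult.assoc)
  finally show ?case by (simp add: scale_simps algebra_simps)
qed (simp add: scale_simps)

lemma zs_power_z: "zs ^ k * z = w ^ k *\<^sub>C (z * zs ^ k) + (1 - w ^ k) *\<^sub>C zs ^ (k - 1)"
proof -
  have "st (zs * z ^ k) = st (w ^ k *\<^sub>C (z ^ k * zs) + (1 - w ^ k) *\<^sub>C z ^ (k - 1))"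
    by (simp only: zs_z_power)
  then show ?thesis
    by (simp add: st_add st_scale st(3,4) st_zs st_power cnj_w)
qed

lemma span_mon: "complex_vector.span (range mon) = UNIV"
proof -
  let ?S = "complex_vector.span (range mon)"
  note sp = complex_vector.span_base complex_vector.span_add complex_vector.span_scale
  have m: "z ^ j * zs ^ k \<in> ?S" for j k
    by (rule complex_vector.span_base) (auto simp: mon_def intro!: image_eqI[of _ _ "(j, k)"])
  have zl: "z * f \<in> ?S" if "f \<in> ?S" for f
    using that
  proof (induction rule: complex_vector.span_induct_alt)
    case (step c x y)
    then obtain j k where "x = z ^ j * zs ^ k" by (auto simp: mon_def)
    then have "z * x \<in> ?S" using m[of "Suc j" k] by (simp add: mult.assoc)
    then show ?case using step by (simp add: distrib_left scale_simps sp)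
  qed (simp add: complex_vector.span_zero)
  have zsl: "zs * f \<in> ?S" if "f \<in> ?S" for f
    using that
  proof (induction rule: complex_vector.span_induct_alt)
    case (step c x y)
    then obtain j k where "x = z ^ j * zs ^ k" by (auto simp: mon_def)
    then have "zs * x = w ^ j *\<^sub>C (z ^ j * zs ^ Suc k) + (1 - w ^ j) *\<^sub>C (z ^ (j - 1) * zs ^ k)"
      by (simp add: mult.assoc[symmetric] zs_z_power) (simp add: distrib_right left_diff_distrib scale_simps mult.assoc)
    then have "zs * x \<in> ?S" by (simp add: sp m del: power_Suc)
    then show ?case using step by (simp add: distrib_left scale_simps sp)
  qed (simp add: complex_vector.span_zero)
  have "f \<in> ?S" for f
    by (induction f rule: gen_induct) (use m[of 0 0] zl zsl in \<open>simp_all add: sp\<close>)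
  then show ?thesis by auto
qed

lemma mon_induct [case_names mon add scale]:
  assumes mon: "\<And>j k. P (z ^ j * zs ^ k)" and add: "\<And>f g. P f \<Longrightarrow> P g \<Longrightarrow> P (f + g)"
    and scale: "\<And>c f. P f \<Longrightarrow> P (c *\<^sub>C f)"
  shows "P f"
proof -
  have "f \<in> complex_vector.span (range mon)" by (simp add: span_mon)
  then show ?thesis
  proof (induction rule: complex_vector.span_induct_alt)
    case base
    show ?case using scale[OF mon, of 0] by simp
  next
    case (step c x y)
    then show ?case by (auto simp: mon_def intro!: add scale mon)
  qed
qed

section \<open>q-integers and linear independence of the monomials\<close>

definition qnum :: "nat \<Rightarrow> complex" where "qnum n = (\<Sum>s<n. iw ^ s)"

lemma qnum_eq: "qnum n = (1 - iw ^ n) / (1 - iw)"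
proof -
  have "iw \<noteq> 1" using iw_power_neq_1[of 0] by simp
  then show ?thesis unfolding qnum_def by (subst geometric_sum) (simp_all add: field_simps)
qed

lemma qnum_nz: "qnum (Suc n) \<noteq> 0"
  using iw_power_neq_1[of n] iw_power_neq_1[of 0] by (simp add: qnum_eq del: power_Suc)

lemma kk_power: "kk (z ^ j) = w ^ j *\<^sub>C z ^ j" "kk (zs ^ j) = iw ^ j *\<^sub>C zs ^ j"
  by (induction j) (simp_all add: kk_one kk_mult kk_z' kk_zs scale_simps mult.commute)

lemma ki_power: "ki (z ^ j) = iw ^ j *\<^sub>C z ^ j" "ki (zs ^ j) = w ^ j *\<^sub>C zs ^ j"
  by (induction j) (simp_all add: ki_one ki_mult ki_z' ki_zs scale_simps mult.commute)

lemma D_zs_power: "D (zs ^ k) = qnum k *\<^sub>C zs ^ (k - 1)"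
proof (induction k)
  case (Suc k)
  have "D (zs ^ Suc k) = iw ^ k *\<^sub>C zs ^ k + zs * (qnum k *\<^sub>C zs ^ (k - 1))"
    by (simp add: D_z_left Suc.IH kk_power)
  also have "zs * (qnum k *\<^sub>C zs ^ (k - 1)) = qnum k *\<^sub>C zs ^ k"
    by (cases k) (simp_all add: scale_simps qnum_def distrib_left)
  finally show ?case by (simp add: qnum_def scale_simps add_ac)
qed (simp add: gen_D qnum_def)

lemma D'_z_power: "D' (z ^ k) = qnum k *\<^sub>C z ^ (k - 1)"
proof -
  have c: "cnj (qnum k) = qnum k" by (simp add: qnum_def cnj_w)
  have "D' (st (zs ^ k)) = st (D (zs ^ k))" by (simp add: st_D)
  then show ?thesis unfolding D_zs_power by (simp add: st_power st_zs st_scale c)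
qed

lemma D_mon: "D (z ^ j * f) = z ^ j * D f"
  by (induction j) (simp_all add: D_z_left mult.assoc)

lemma D'_mon: "D' (f * zs ^ k) = D' f * zs ^ k"
  by (induction k) (simp_all add: D'_zs_right power_Suc2 mult.assoc[symmetric] del: power_Suc)

lemma D_pow: "(D ^^ b) (z ^ j * zs ^ k) = (\<Prod>i<b. qnum (k - i)) *\<^sub>C (z ^ j * zs ^ (k - b))"
proof (induction b)
  case (Suc b)
  then show ?case
    by (simp add: lin_simps D_mon D_zs_power scale_simps mult.commute)
qed (simp add: scaleC_one)

lemma D'_pow: "(D' ^^ b) (z ^ j * zs ^ k) = (\<Prod>i<b. qnum (j - i)) *\<^sub>C (z ^ (j - b) * zs ^ k)"
proof (induction b)
  case (Suc b)
  then show ?case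
    by (simp add: lin_simps D'_mon D'_z_power scale_simps mult.commute)
qed (simp add: scaleC_one)

lemma qnum_prod_nz: "(\<Prod>i<b. qnum (k - i)) = 0 \<longleftrightarrow> k < b"
proof -
  have "qnum (k - i) = 0 \<longleftrightarrow> k \<le> i" for i
  proof (cases "k - i")
    case (Suc n)
    then show ?thesis using qnum_nz[of n] by auto
  qed (simp add: qnum_def)
  then have "(\<Prod>i<b. qnum (k - i)) = 0 \<longleftrightarrow> (\<exists>i<b. k \<le> i)" by auto
  also have "\<dots> \<longleftrightarrow> k < b" using le_less_trans by blast
  finally show ?thesis .
qed

lemma clinear_funpow: "clinear f \<Longrightarrow> clinear (f ^^ n)" for f :: "'p \<Rightarrow> 'p"
  by (induction n) (auto simp: o_def id_def intro: clinear_ident clinear_compose)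

text \<open>The derivatives lower the two exponents with nonzero factors. For a monomial (a, b) of
  maximal total degree in the support, a applications of \<open>D'\<close> after b of
  \<open>D\<close> kill every other monomial of the support and leave a nonzero constant.\<close>

lemma mon_independent:
  assumes "finite A" "(\<Sum>p\<in>A. c p *\<^sub>C mon p) = 0" "p \<in> A"
  shows "c p = 0"
proof (rule ccontr)
  assume p: "c p \<noteq> 0"
  define B where "B = {p \<in> A. c p \<noteq> 0}"
  have "p \<in> B" using assms p by (simp add: B_def)
  then have B: "finite B" "B \<noteq> {}" using assms by (simp add: B_def, blast)
  define m where "m = Max ((\<lambda>p. fst p + snd p) ` B)"
  have "m \<in> (\<lambda>p. fst p + snd p) ` B"
    unfolding m_def using B by (intro Max_in) auto
  then obtain a b where ab: "(a, b) \<in> B" "a + b = m" by force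
  have le: "fst p' + snd p' \<le> a + b" if "p' \<in> B" for p'
    using B that unfolding ab m_def by (intro Max_ge) auto
  define h where "h f = (D' ^^ a) ((D ^^ b) f)" for f
  have h: "clinear h" unfolding h_def by (rule clinear_compose[OF clinear_funpow[OF lin(6)] clinear_funpow[OF lin(5)]])
  have hm: "h (mon p') = ((\<Prod>i<b. qnum (snd p' - i)) * (\<Prod>i<a. qnum (fst p' - i))) *\<^sub>C
      (z ^ (fst p' - a) * zs ^ (snd p' - b))" for p'
    using clinear_scaleC[OF clinear_funpow[OF lin(6)]]
    by (simp add: h_def mon_def D_pow D'_pow scaleC_scaleC)
  have zero: "h (mon p') = 0" if "p' \<in> B - {(a, b)}" for p'
  proof -
    have "fst p' < a \<or> snd p' < b" using le[of p'] that by (cases p') auto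
    then have "(\<Prod>i<b. qnum (snd p' - i)) * (\<Prod>i<a. qnum (fst p' - i)) = 0"
      using qnum_prod_nz[where b = a] qnum_prod_nz[where b = b] by auto
    then show ?thesis unfolding hm by simp
  qed
  have "0 = h (\<Sum>p\<in>A. c p *\<^sub>C mon p)" by (simp add: assms clinear_zero[OF h])
  also have "\<dots> = (\<Sum>p\<in>A. c p *\<^sub>C h (mon p))"
    by (simp add: clinear_sum[OF h] clinear_scaleC[OF h])
  also have "\<dots> = (\<Sum>p\<in>{(a, b)}. c p *\<^sub>C h (mon p))"
    by (rule sum.mono_neutral_right) (use assms ab zero in \<open>auto simp: B_def\<close>)
  also have "\<dots> = (c (a, b) * ((\<Prod>i<b. qnum (b - i)) * (\<Prod>i<a. qnum (a - i)))) *\<^sub>C 1"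
    by (simp add: hm scaleC_scaleC)
  finally have "c (a, b) * ((\<Prod>i<b. qnum (b - i)) * (\<Prod>i<a. qnum (a - i))) = 0"
    by (metis complex_vector.scale_eq_0_iff zero_neq_one)
  then show False using ab(1) qnum_prod_nz[where k = a and b = a] qnum_prod_nz[where k = b and b = b] by (simp add: B_def)
qed

lemma inj_mon: "inj mon"
proof (rule injI)
  fix p p' assume eq: "mon p = mon p'"
  show "p = p'"
  proof (rule ccontr)
    assume ne: "p \<noteq> p'"
    let ?c = "\<lambda>x. if x = p then 1 else - 1 :: complex"
    have "(\<Sum>x\<in>{p, p'}. ?c x *\<^sub>C mon x) = 0" using ne eq by (simp add: scaleC_one)
    then show False using mon_independent[of "{p, p'}" ?c p] by auto
  qed
qed

lemma independent_mon: "\<not> complex_vector.dependent (range mon)"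
proof
  assume "complex_vector.dependent (range mon)"
  then obtain t u v where t: "finite t" "t \<subseteq> range mon" "(\<Sum>v\<in>t. u v *\<^sub>C v) = 0" "v \<in> t" "u v \<noteq> 0"
    unfolding complex_vector.dependent_explicit by blast
  define A where "A = mon -` t"
  have A: "t = mon ` A" "finite A"
    using t(2) finite_vimageI[OF t(1) inj_mon] by (auto simp: A_def)
  obtain p where p: "p \<in> A" "v = mon p" using t(4) A by auto
  have "inj_on mon A" using inj_mon by (rule inj_on_subset) simp
  then have "(\<Sum>p\<in>A. u (mon p) *\<^sub>C mon p) = 0" using t(3) by (simp add: A sum.reindex)
  from mon_independent[OF A(2) this p(1)] show False using p t(5) by simp
qed

section \<open>Coefficients in the monomial basis\<close>

definition coef :: "nat \<Rightarrow> nat \<Rightarrow> 'p \<Rightarrow> complex"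
  where "coef j k f = complex_vector.representation (range mon) f (mon (j, k))"

lemma coef_add: "coef j k (f + g) = coef j k f + coef j k g"
  and coef_scale: "coef j k (c *\<^sub>C f) = c * coef j k f"
  and coef_mon: "coef j k (z ^ j' * zs ^ k') = (if j = j' \<and> k = k' then 1 else 0)"
proof -
  have f: "f \<in> complex_vector.span (range mon)" for f by (simp add: span_mon)
  show "coef j k (f + g) = coef j k f + coef j k g" "coef j k (c *\<^sub>C f) = c * coef j k f"
    by (simp_all add: coef_def complex_vector.representation_add[OF independent_mon f f]
        complex_vector.representation_scale[OF independent_mon f])
  have "complex_vector.representation (range mon) (mon (j', k')) = (\<lambda>v. if v = mon (j', k') then 1 else 0)"
    by (rule complex_vector.representation_basis[OF independent_mon]) simp
  then show "coef j k (z ^ j' * zs ^ k') = (if j = j' \<and> k = k' then 1 else 0)"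
    unfolding coef_def mon_def[of "(j', k')", simplified, symmetric] using inj_mon by (auto dest: injD)
qed

lemma coef_power: "coef j k (z ^ j') = (if j = j' \<and> k = 0 then 1 else 0)"
    "coef j k (zs ^ k') = (if j = 0 \<and> k = k' then 1 else 0)"
  using coef_mon[of j k j' 0] coef_mon[of j k 0 k'] by simp_all

lemma clinear_coef: "clinear (coef j k)"
  by (rule clinearI) (simp_all add: coef_add coef_scale scaleC_complex_def)

lemma coef_zero: "coef j k 0 = 0"
  using coef_scale[of j k 0 0] by simp

lemma coef_eq_0:
  assumes "\<And>j k. coef j k f = 0"
  shows "f = 0"
proof -
  have f: "f \<in> complex_vector.span (range mon)" by (simp add: span_mon)
  have "complex_vector.representation (range mon) f v = 0" for v
  proof (cases "v \<in> range mon")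
    case True
    then show ?thesis using assms by (auto simp: coef_def)
  next
    case False
    then show ?thesis using complex_vector.representation_ne_zero by blast
  qed
  then show ?thesis
    using complex_vector.sum_nonzero_representation_eq[OF independent_mon f] by simp
qed

lemma coef_z_left: "coef j k (z * f) = (if j = 0 then 0 else coef (j - 1) k f)"
proof (induction f rule: mon_induct)
  case (mon j' k')
  show ?case using coef_mon[of j k "Suc j'" k'] by (auto simp: coef_mon mult.assoc)
qed (simp_all add: distrib_left coef_add scale_simps coef_scale)

lemma coef_zs_right: "coef j k (f * zs) = (if k = 0 then 0 else coef j (k - 1) f)"
proof (induction f rule: mon_induct)
  case (mon j' k')
  show ?case using coef_mon[of j k j' "Suc k'"] by (auto simp: coef_mon mult.assoc power_commutes)
qed (simp_all add: distrib_right coef_add scale_simps coef_scale)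

lemma coef_z_power_left: "coef j k (z ^ i * f) = (if j < i then 0 else coef (j - i) k f)"
  by (induction i arbitrary: j) (auto simp: mult.assoc coef_z_left less_Suc_eq_0_disj)

lemma coef_zs_power_right: "coef j k (f * zs ^ i) = (if k < i then 0 else coef j (k - i) f)"
  by (induction i arbitrary: k) (auto simp: power_Suc2 mult.assoc[symmetric] coef_zs_right less_Suc_eq_0_disj simp del: power_Suc)

lemma coef_z_right: "coef j k (f * z) = (if j = 0 then 0 else w ^ k * coef (j - 1) k f) + (1 - w ^ Suc k) * coef j (Suc k) f"
proof (induction f rule: mon_induct)
  case (mon j' k')
  have "z ^ j' * zs ^ k' * z = w ^ k' *\<^sub>C (z ^ Suc j' * zs ^ k') + (1 - w ^ k') *\<^sub>C (z ^ j' * zs ^ (k' - 1))"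
    by (simp add: mult.assoc zs_power_z) (simp add: distrib_left right_diff_distrib scale_simps power_commutes mult.assoc[symmetric])
  then show ?case
    by (cases k') (auto simp: coef_add coef_scale coef_mon coef_power simp del: power_Suc)
next
  case (add f g)
  then show ?case by (simp only: distrib_right coef_add) (simp add: distrib_left del: power_Suc)
next
  case (scale c f)
  then show ?case by (simp only: mult_scaleC_left coef_scale) (simp add: distrib_left del: power_Suc)
qed

lemma coef_zs_left_0: "coef j 0 (zs * f) = (1 - w ^ Suc j) * coef (Suc j) 0 f"
proof (induction f rule: mon_induct)
  case (mon j' k')
  have "zs * (z ^ j' * zs ^ k') = w ^ j' *\<^sub>C (z ^ j' * zs ^ Suc k') + (1 - w ^ j') *\<^sub>C (z ^ (j' - 1) * zs ^ k')"
    by (simp add: mult.assoc[symmetric] zs_z_power) (simp add: distrib_right left_diff_distrib scale_simps mult.assoc)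
  then show ?case
    by (cases j') (auto simp: coef_add coef_scale coef_mon coef_power simp del: power_Suc)
next
  case (add f g)
  then show ?case by (simp only: distrib_left coef_add)
next
  case (scale c f)
  then show ?case by (simp only: mult_scaleC_right coef_scale mult.left_commute)
qed

lemma coef_kk: "coef j k (kk f) = w ^ j * iw ^ k * coef j k f"
  by (induction f rule: mon_induct)
    (auto simp: kk_mult kk_power scale_simps coef_scale coef_mon lin_simps coef_add algebra_simps)

lemma coef_ki: "coef j k (ki f) = iw ^ j * w ^ k * coef j k f"
  by (induction f rule: mon_induct)
    (auto simp: ki_mult ki_power scale_simps coef_scale coef_mon lin_simps coef_add algebra_simps)

lemma coef_st: "coef j k (st f) = cnj (coef k j f)"
  by (induction f rule: mon_induct)
    (auto simp: st(3,4) st_power st_zs st_scale st_add coef_scale coef_add coef_mon)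

lemma coef_ff: "coef j 0 (ff f) = r * w / (1 - w) * (1 - w ^ Suc j) * iw ^ Suc j * coef (Suc j) 0 f"
  by (simp add: ff_eq coef_scale clinear_diff[OF clinear_coef] coef_zs_left_0 coef_zs_right coef_ki)

text \<open>The constant is left existential because \<open>covariant_eq_0\<close> meets its summand
  only where the coefficients with exponent k of \<open>zs\<close> are already known to
  vanish.\<close>

lemma coef_ee: "\<exists>c. coef j k (ee f) = c * (if j = 0 then 0 else coef (j - 1) k f) +
   r / (1 - w) * (1 - w ^ Suc k) * w ^ j * iw ^ Suc k * coef j (Suc k) f"
proof -
  let ?c = "r / (1 - w) * (w ^ k * w ^ (j - 1) * iw ^ k - 1)"
  have "coef j k (ee f) = ?c * (if j = 0 then 0 else coef (j - 1) k f) +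
   r / (1 - w) * (1 - w ^ Suc k) * w ^ j * iw ^ Suc k * coef j (Suc k) f"
    by (simp add: ee_eq coef_scale clinear_diff[OF clinear_coef] coef_z_left coef_z_right coef_kk algebra_simps)
  then show ?thesis by blast
qed

text \<open>The vacuum functional \<open>coef 0 0\<close> detects covariant families: \<open>ff\<close> lowers the power of \<open>z\<close> and \<open>ee\<close>
  that of \<open>zs\<close>, so every coefficient can be moved to the vacuum.\<close>

lemma covariant_eq_0:
  assumes ff: "\<And>f. f \<in> V \<Longrightarrow> ff f \<in> complex_vector.span V" and ee: "\<And>f. f \<in> V \<Longrightarrow> ee f \<in> complex_vector.span V"
    and vac: "\<And>f. f \<in> V \<Longrightarrow> coef 0 0 f = 0" and f: "f \<in> V"
  shows "f = 0"
proof -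
  let ?S = "complex_vector.span V"
  have closed: "h f \<in> ?S" if "f \<in> ?S" "clinear h" "\<And>f. f \<in> V \<Longrightarrow> h f \<in> ?S" for h f
    using that(1)
  proof (induction rule: complex_vector.span_induct_alt)
    case (step c x y)
    then show ?case using that(2,3)
      by (simp add: clinear_add clinear_scaleC complex_vector.span_add complex_vector.span_scale)
  qed (simp add: clinear_zero[OF that(2)] complex_vector.span_zero)
  have base: "coef 0 0 f = 0" if "f \<in> ?S" for f
    using that by (induction rule: complex_vector.span_induct_alt) (simp_all add: coef_zero coef_add coef_scale vac)
  have c: "r / (1 - w) \<noteq> 0" "r * w / (1 - w) \<noteq> 0" using r w_nz w_neq_1 by auto
  \<comment> \<open>\<open>coef_ff\<close> speaks of exponent 0 of \<open>zs\<close> only, so F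
    first settles all powers of z; E then raises the exponent of \<open>zs\<close> from
    there.\<close>
  have row: "coef j 0 f = 0" if "f \<in> ?S" for f j
    using that
  proof (induction j arbitrary: f)
    case (Suc j)
    have "coef j 0 (ff f) = 0" using Suc closed[OF _ lin(4) ff] by blast
    then show ?case using w_power_neq_1[of j] c w_nz by (simp add: coef_ff del: power_Suc)
  qed (simp add: base)
  have "coef j k f = 0" if "f \<in> ?S" for f j k
    using that
  proof (induction k arbitrary: f j)
    case (Suc k)
    have "coef j k (ee f) = 0" using Suc closed[OF _ lin(3) ee] by blast
    moreover have "coef (j - 1) k f = 0" using Suc by blast
    ultimately have "(if j = 0 then 0 else coef (j - 1) k f) = 0" "coef j k (ee f) = 0" by simp_all
    then show ?case using coef_ee[of j k f] w_power_neq_1[of k] c w_nz by (auto simp del: power_Suc)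
  qed (simp add: row)
  then show ?thesis using complex_vector.span_base[OF f] by (intro coef_eq_0) blast
qed

end

section \<open>The deformed product\<close>

lemmas tens_simps = cbilinearD[OF cbilinear_tens] cbilinear_zero[OF cbilinear_tens]
  clinear_diff[OF cbilinear_clinear(1)[OF cbilinear_tens]] clinear_diff[OF cbilinear_clinear(2)[OF cbilinear_tens]]
  clinear_minus[OF cbilinear_clinear(1)[OF cbilinear_tens]] clinear_minus[OF cbilinear_clinear(2)[OF cbilinear_tens]]

lemma clinear_m0: "clinear m0"
  unfolding m0_def by (rule clinear_tensor_lift) (rule cbilinear_mult)

lemma m0_tens: "m0 (f \<otimes> g) = f * g"
  unfolding m0_def by (rule tensor_lift_tens) (rule cbilinear_mult)

lemma clinear_mult: "clinear (\<lambda>g. f * g)" "clinear (\<lambda>g. g * f)" for f :: "'a::complex_algebra_1"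
  by (rule cbilinear_clinear[OF cbilinear_mult])+

lemma clinear_plus: "clinear f \<Longrightarrow> clinear g \<Longrightarrow> clinear (\<lambda>x. f x + g x)"
  by (rule clinearI) (simp_all add: clinear_add clinear_scaleC scaleC_add_right add_ac)

text \<open>A relation instead of a map: the flip composed with the involution is antilinear, so
  \<open>tensor_lift\<close> does not produce it. \<open>M_transfer\<close> only needs the relation
  to be preserved.\<close>

inductive flip_star :: "('p::complex_vector \<Rightarrow> 'p) \<Rightarrow> ('p, 'p) tensor \<Rightarrow> ('p, 'p) tensor \<Rightarrow> bool"
  for st where
  zero: "flip_star st 0 0"
| add: "flip_star st s s' \<Longrightarrow> flip_star st t t' \<Longrightarrow> flip_star st (s + t) (s' + t')"
| tens: "flip_star st (f \<otimes> g) (st g \<otimes> st f)"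

context disc_calculus
begin

section \<open>The operator and its symmetries\<close>

definition box_term :: "'p \<Rightarrow> 'p \<Rightarrow> ('p, 'p) tensor"
  where "box_term u v = iw *\<^sub>C (u \<otimes> v - (1 + iw) *\<^sub>C ((u * zs) \<otimes> (z * v)) + iw *\<^sub>C ((u * zs * zs) \<otimes> (z * (z * v))))"

definition T :: "('p, 'p) tensor \<Rightarrow> ('p, 'p) tensor"
  where "T = tensor_lift (\<lambda>f g. box_term (D f) (D' g))"

lemma cbilinear_box_term: "cbilinear box_term"
  by (rule cbilinearI)
    (simp_all add: box_term_def distrib_left distrib_right scale_simps tens_simps algebra_simps)

lemma cbilinear_box: "cbilinear (\<lambda>f g. box_term (D f) (D' g))"
  by (rule cbilinear_comp[OF cbilinear_box_term lin(5,6)])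

lemma clinear_T: "clinear T"
  unfolding T_def by (rule clinear_tensor_lift[OF cbilinear_box])

lemma T_tens: "T (f \<otimes> g) = box_term (D f) (D' g)"
  unfolding T_def by (rule tensor_lift_tens[OF cbilinear_box])

lemmas T_simps = clinear_add[OF clinear_T] clinear_scaleC[OF clinear_T] clinear_zero[OF clinear_T]
lemmas box_simps = cbilinearD[OF cbilinear_box_term] cbilinear_zero[OF cbilinear_box_term]
  clinear_diff[OF cbilinear_clinear(2)[OF cbilinear_box_term]]

lemma T_tensor_map:
  assumes "clinear f" "clinear g"
    and "\<And>u v. box_term (D (f u)) (D' (g v)) = tensor_map f g (box_term (D u) (D' v))"
  shows "T (tensor_map f g t) = tensor_map f g (T t)"
proof (rule clinear_eq_tensorI[of "\<lambda>t. T (tensor_map f g t)"])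
  note l = clinear_tensor_map[OF assms(1,2)]
  show "clinear (\<lambda>t. T (tensor_map f g t))" "clinear (\<lambda>t. tensor_map f g (T t))"
    by (rule clinear_compose[OF clinear_T l] clinear_compose[OF l clinear_T])+
  show "T (tensor_map f g (u \<otimes> v)) = tensor_map f g (T (u \<otimes> v))" for u v
    using assms by (simp add: tensor_map_tens T_tens)
qed

lemmas tensor_map_simps = clinear_add[OF clinear_tensor_map] clinear_diff[OF clinear_tensor_map]
  clinear_scaleC[OF clinear_tensor_map]

text \<open>Since \<open>D\<close> kills z without twisting what stands to its right, a leading z in
  the first factor behaves as a constant. Pulling it out is what reduces first arguments to powers
  of \<open>zs\<close>.\<close>

lemma T_z: "T (tensor_map (\<lambda>f. z * f) (\<lambda>g. g) t) = tensor_map (\<lambda>f. z * f) (\<lambda>g. g) (T t)"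
  by (rule T_tensor_map)
    (simp_all add: clinear_mult clinear_ident D_z_left box_term_def tensor_map_simps tensor_map_tens mult.assoc)

lemma T_kk: "T (tensor_map kk kk t) = tensor_map kk kk (T t)"
  by (rule T_tensor_map)
    (simp_all add: lin D_kk D'_kk box_simps, simp add: box_term_def tensor_map_simps tensor_map_tens lin kk_mult
      kk_z' kk_zs tens_simps scale_simps w_iw mult.assoc)

lemma T_ki: "T (tensor_map ki ki t) = tensor_map ki ki (T t)"
  by (rule T_tensor_map)
    (simp_all add: lin D_ki D'_ki box_simps, simp add: box_term_def tensor_map_simps tensor_map_tens lin ki_mult
      ki_z' ki_zs tens_simps scale_simps w_iw mult.assoc)

definition Delta_F :: "('p, 'p) tensor \<Rightarrow> ('p, 'p) tensor"
  where "Delta_F t = tensor_map ff ki t + tensor_map (\<lambda>f. f) ff t"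

lemma clinear_Delta_F: "clinear Delta_F"
  unfolding Delta_F_def by (intro clinear_plus clinear_tensor_map lin clinear_ident)

lemma Delta_F_tens: "Delta_F (f \<otimes> g) = ff f \<otimes> ki g + f \<otimes> ff g"
  by (simp add: Delta_F_def tensor_map_tens lin clinear_ident)

lemma ff_zs': "ff zs = - ((r * w) *\<^sub>C (zs * zs))"
  by (simp add: ff_zs w_def power2_eq_square)

text \<open>The coefficients 1 + 1 / w and 1 / w of \<open>box_term\<close> are tuned to this
  identity. For instance, in the tensor of u * zs with \<open>ki v\<close> the correction from
  \<open>D_ff\<close> has weight (1 + w) / w, and F z = r produces 1 + 1 / w from the middle
  term.\<close>

lemma T_Delta_F: "T (Delta_F t) = Delta_F (T t)"
proof (rule clinear_eq_tensorI[of "\<lambda>t. T (Delta_F t)"])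
  show "clinear (\<lambda>t. T (Delta_F t))" "clinear (\<lambda>t. Delta_F (T t))"
    by (rule clinear_compose[OF clinear_T clinear_Delta_F] clinear_compose[OF clinear_Delta_F clinear_T])+
  fix f g
  define u v where "u = D f" and "v = D' g"
  have rw: "r * (w * x) = w * (r * x)" "r * (iw * x) = iw * (r * x)" "r * w = w * r" "r * iw = iw * r" for x
    by simp_all
  have "T (Delta_F (f \<otimes> g)) = box_term (w *\<^sub>C ff u - (r * (1 + w)) *\<^sub>C (u * zs)) (iw *\<^sub>C ki v) + box_term u (ff v)"
    by (simp add: Delta_F_tens T_simps T_tens D_ff D'_ki D'_ff u_def v_def)
  also have "\<dots> = Delta_F (box_term u v)"
    by (simp add: box_term_def clinear_add[OF clinear_Delta_F] clinear_diff[OF clinear_Delta_F]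
      clinear_scaleC[OF clinear_Delta_F] Delta_F_tens ff_mult ki_mult ff_z ff_zs' ki_z' ki_zs)
     (simp add: tens_simps distrib_left distrib_right left_diff_distrib right_diff_distrib scale_simps
        mult.assoc w_iw rw add_ac; simp add: algebra_simps)
  finally show "T (Delta_F (f \<otimes> g)) = Delta_F (T (f \<otimes> g))"
    by (simp only: T_tens u_def v_def)
qed


lemma flip_scale: "flip_star st t t' \<Longrightarrow> flip_star st (c *\<^sub>C t) (cnj c *\<^sub>C t')"
proof (induction rule: flip_star.induct)
  case (tens f g)
  have "flip_star st ((c *\<^sub>C f) \<otimes> g) (st g \<otimes> st (c *\<^sub>C f))" by (rule flip_star.tens)
  then show ?case by (simp add: st_scale tens_simps)
qed (simp_all add: scaleC_add_right flip_star.intros)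

lemma flip_diff:
  assumes "flip_star st s s'" "flip_star st t t'"
  shows "flip_star st (s - t) (s' - t')"
  using flip_star.add[OF assms(1) flip_scale[OF assms(2), of "- 1"]] by (simp add: scaleC_one)

lemma flip_T: "flip_star st t t' \<Longrightarrow> flip_star st (T t) (T t')"
proof (induction rule: flip_star.induct)
  case (tens f g)
  have "flip_star st (box_term (D f) (D' g)) (box_term (D (st g)) (D' (st f)))"
  proof -
    have st_D': "D (st g) = st (D' g)" using st_D[of "st g"] by (simp add: st(2)) (metis st(2))
    define u v where "u = D f" and "v = D' g"
    have t: "flip_star st ((u * zs) \<otimes> (z * v)) ((st v * zs) \<otimes> (z * st u))"
      "flip_star st ((u * zs * zs) \<otimes> (z * (z * v))) ((st v * zs * zs) \<otimes> (z * (z * st u)))"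
      using flip_star.tens[of st "u * zs" "z * v"] flip_star.tens[of st "u * zs * zs" "z * (z * v)"]
      by (simp_all add: st(3,4) st_zs mult.assoc)
    show ?thesis unfolding st_D' st_D[symmetric] u_def[symmetric] v_def[symmetric] box_term_def
      using flip_scale[where c = iw, unfolded cnj_w] flip_scale[where c = "1 + iw", simplified, unfolded cnj_w]
      by (meson flip_star.add flip_diff flip_star.tens t)
  qed
  then show ?case by (simp add: T_tens)
qed (simp_all add: T_simps flip_star.intros)

section \<open>The coefficients of the deformed product\<close>

definition M :: "nat \<Rightarrow> ('p, 'p) tensor \<Rightarrow> 'p"
  where "M n t = m0 (poly_op (s_poly q n) T t)"

lemma clinear_T_power: "clinear (T ^^ n)"
proof (induction n)
  case (Suc n)
  show ?case using clinear_compose[OF clinear_T Suc] by (simp add: o_def)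
qed (simp add: id_def clinear_ident)

lemma M_sum: "M n t = (\<Sum>i\<le>degree (s_poly q n). complex_of_real (coeff (s_poly q n) i) *\<^sub>C m0 ((T ^^ i) t))"
  by (simp add: M_def poly_op_def clinear_sum[OF clinear_m0] clinear_scaleC[OF clinear_m0])

lemma clinear_M: "clinear (M n)"
  by (rule clinearI)
    (simp_all add: M_sum clinear_add[OF clinear_T_power] clinear_scaleC[OF clinear_T_power]
      clinear_add[OF clinear_m0] clinear_scaleC[OF clinear_m0] scaleC_add_right sum.distrib
      complex_vector.scale_sum_right scaleC_scaleC mult.commute)

text \<open>One transport principle for all symmetries: R is the graph of a tensor map, the graph of
  \<open>Delta_F\<close>, or \<open>flip_star\<close>. Homogeneity of h is asked for real scalars,
  so that the antilinear involution is covered; the coefficients of \<open>s_poly\<close> are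
  real.\<close>

lemma M_transfer:
  assumes R: "R t t'" "\<And>t t'. R t t' \<Longrightarrow> R (T t) (T t')" "\<And>t t'. R t t' \<Longrightarrow> h (m0 t) = m0 t'"
    and h: "\<And>f g. h (f + g) = h f + h g" "\<And>c f. h (complex_of_real c *\<^sub>C f) = complex_of_real c *\<^sub>C h f"
  shows "h (M n t) = M n t'"
proof -
  have "R ((T ^^ i) t) ((T ^^ i) t')" for i
    by (induction i) (simp_all add: R)
  then have m: "h (m0 ((T ^^ i) t)) = m0 ((T ^^ i) t')" for i
    by (rule R(3))
  have "h (\<Sum>i\<in>A. complex_of_real (c i) *\<^sub>C f i) = (\<Sum>i\<in>A. complex_of_real (c i) *\<^sub>C h (f i))"
    if "finite A" for A and c f
    using that h(2)[of 0 0] by (induction A rule: finite_induct) (simp_all add: h)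
  from this[of "{..degree (s_poly q n)}" "coeff (s_poly q n)" "\<lambda>i. m0 ((T ^^ i) t)"]
  show ?thesis unfolding M_sum by (simp add: m)
qed

definition mu :: "nat \<Rightarrow> 'p \<Rightarrow> 'p \<Rightarrow> 'p" where "mu n f g = M n (f \<otimes> g)"

lemma cbilinear_mu: "cbilinear (mu n)"
  unfolding mu_def
  by (rule cbilinearI) (simp_all add: tens_simps clinear_add[OF clinear_M] clinear_scaleC[OF clinear_M])

lemmas mu_simps = cbilinearD[OF cbilinear_mu] cbilinear_zero[OF cbilinear_mu]

lemma mu_0: "mu 0 f g = f * g"
  by (simp add: mu_def M_def poly_op_1 m0_tens)

lemma M_tensor_map:
  assumes l: "clinear f" "clinear g" "clinear h"
    and "\<And>t. T (tensor_map f g t) = tensor_map f g (T t)" "\<And>u v. h (u * v) = f u * g v"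
  shows "h (mu n u v) = mu n (f u) (g v)"
proof -
  have "h (M n (u \<otimes> v)) = M n (tensor_map f g (u \<otimes> v))"
  proof (rule M_transfer[where R = "\<lambda>t t'. t' = tensor_map f g t" and h = h])
    fix t t' assume "t' = tensor_map f g t"
    moreover have "h (m0 t) = m0 (tensor_map f g t)"
      by (rule clinear_eq_tensorI[of "\<lambda>t. h (m0 t)"])
        (simp_all add: assms clinear_compose[OF l(3) clinear_m0]
          clinear_compose[OF clinear_m0 clinear_tensor_map[OF l(1,2)]] m0_tens tensor_map_tens)
    ultimately show "h (m0 t) = m0 t'" by simp
  qed (simp_all add: assms clinear_add clinear_scaleC)
  then show ?thesis by (simp add: mu_def tensor_map_tens l)
qed

lemma mu_z: "mu n (z * f) g = z * mu n f g"
  using M_tensor_map[of "\<lambda>f. z * f" "\<lambda>g. g" "\<lambda>f. z * f" n f g] T_z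
  by (simp add: clinear_mult clinear_ident mult.assoc)

lemma mu_kk: "kk (mu n f g) = mu n (kk f) (kk g)"
  by (rule M_tensor_map) (simp_all add: lin T_kk kk_mult)

lemma mu_ki: "ki (mu n f g) = mu n (ki f) (ki g)"
  by (rule M_tensor_map) (simp_all add: lin T_ki ki_mult)

lemma mu_ff: "ff (mu n f g) = mu n (ff f) (ki g) + mu n f (ff g)"
proof -
  have "ff (M n (f \<otimes> g)) = M n (Delta_F (f \<otimes> g))"
  proof (rule M_transfer[where R = "\<lambda>t t'. t' = Delta_F t" and h = ff])
    fix t t' assume "t' = Delta_F t"
    moreover have "ff (m0 t) = m0 (Delta_F t)"
      by (rule clinear_eq_tensorI[of "\<lambda>t. ff (m0 t)"])
        (simp_all add: lin clinear_compose[OF lin(4) clinear_m0] clinear_compose[OF clinear_m0 clinear_Delta_F]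
          m0_tens Delta_F_tens clinear_add[OF clinear_m0] ff_mult)
    ultimately show "ff (m0 t) = m0 t'" by simp
  qed (simp_all add: T_Delta_F lin_simps)
  then show ?thesis by (simp add: mu_def Delta_F_tens clinear_add[OF clinear_M])
qed

lemma mu_st: "st (mu n f g) = mu n (st g) (st f)"
  unfolding mu_def
proof (rule M_transfer[where R = "flip_star st" and h = st])
  show "st (m0 t) = m0 t'" if "flip_star st t t'" for t t'
    using that by (induction rule: flip_star.induct)
      (simp_all add: clinear_zero[OF clinear_m0] clinear_add[OF clinear_m0] st_zero st_add m0_tens st(3))
qed (simp_all add: flip_T flip_star.tens st_add st_scale)

lemma mu_zs: "mu n f (g * zs) = mu n f g * zs"
  using mu_z[of n "st g" "st f"] mu_st[of n f "g * zs"] mu_st[of n f g]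
  by (metis st(2-3) st_zs)

lemma ee_st: "ee f = iw *\<^sub>C st (ff (st f))"
  by (simp only: st_ff st(2) scaleC_scaleC scaleC_one w_iw w_def[symmetric])

text \<open>E is F conjugated by the involution, up to a scalar. The involution reverses the factors
  and exchanges K with its inverse, which turns the coproduct rule of F into that of E.\<close>

lemma mu_ee: "ee (mu n f g) = mu n (ee f) g + mu n (kk f) (ee g)"
  by (simp add: ee_st mu_st mu_ff st_add st(2) st_ki mu_simps scaleC_add_right add.commute)

lemma mu_z_power: "mu n (z ^ i * f) g = z ^ i * mu n f g"
  by (induction i) (simp_all add: mult.assoc mu_z)

lemma mu_zs_power: "mu n f (g * zs ^ i) = mu n f g * zs ^ i"
  by (induction i) (simp_all add: power_Suc2 mult.assoc[symmetric] mu_zs del: power_Suc)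

text \<open>\<open>M_eq_0\<close> and \<open>mu_vac\<close> are inductions along this recurrence,
  without the explicit polynomials.\<close>

lemma M_rec:
  "M (Suc 0) t = (1 - w) *\<^sub>C M 0 (T t)"
  "(1 - w ^ (n + 2)) *\<^sub>C M (n + 2) t = (1 - w)\<^sup>2 *\<^sub>C M (n + 1) (T t)
    + ((1 + w) * (1 - w ^ (n + 1))) *\<^sub>C M (n + 1) t - (w * (1 - w ^ n)) *\<^sub>C M n t"
proof -
  have "s_poly q (Suc 0) = smult (1 - q\<^sup>2) ([:0, 1:] * 1)"
    using s_poly_1[OF q] by simp
  then show "M (Suc 0) t = (1 - w) *\<^sub>C M 0 (T t)"
    unfolding M_def by (simp only: poly_op_smult poly_op_X s_poly_0 clinear_scaleC[OF clinear_m0])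
      (simp add: w_def)
  have "m0 (poly_op (smult (1 - (q\<^sup>2) ^ (n + 2)) (s_poly q (n + 2))) T t) =
    m0 (poly_op (smult ((1 - q\<^sup>2)\<^sup>2) ([:0, 1:] * s_poly q (n + 1))
    + smult ((1 + q\<^sup>2) * (1 - (q\<^sup>2) ^ (n + 1))) (s_poly q (n + 1)) - smult (q\<^sup>2 * (1 - (q\<^sup>2) ^ n)) (s_poly q n)) T t)"
    by (simp only: s_poly_rec[OF q])
  then show "(1 - w ^ (n + 2)) *\<^sub>C M (n + 2) t = (1 - w)\<^sup>2 *\<^sub>C M (n + 1) (T t)
    + ((1 + w) * (1 - w ^ (n + 1))) *\<^sub>C M (n + 1) t - (w * (1 - w ^ n)) *\<^sub>C M n t"
    by (simp only: poly_op_smult poly_op_diff poly_op_add poly_op_X M_def w_def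
      clinear_scaleC[OF clinear_m0] clinear_add[OF clinear_m0] clinear_diff[OF clinear_m0]
      of_real_diff of_real_add of_real_mult of_real_power of_real_1)
qed

text \<open>The operator kills tensors with an entry 1, so this makes 1 a unit for the deformed
  product (\<open>mu_one\<close>).\<close>

lemma M_eq_0:
  assumes "T t = 0"
  shows "M (Suc n) t = 0"
proof (induction n rule: less_induct)
  case (less n)
  show ?case
  proof (cases n)
    case 0
    then show ?thesis by (simp add: M_rec(1) assms clinear_zero[OF clinear_M])
  next
    case (Suc m)
    have "M (m + 1) t = 0" using less[of m] Suc by simp
    \<comment> \<open>At m = 0 the value \<open>M 0 t\<close> is the plain product and may be
      nonzero, but its coefficient w (1 - w^0) is zero.\<close>
    moreover have "(w * (1 - w ^ m)) *\<^sub>C M m t = 0"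
      using less[of "m - 1"] Suc by (cases m) auto
    ultimately have "(1 - w ^ (m + 2)) *\<^sub>C M (m + 2) t = 0"
      unfolding M_rec(2) by (simp add: assms clinear_zero[OF clinear_M])
    then show ?thesis using w_power_neq_1[of "m + 1"] Suc by simp
  qed
qed

lemma mu_one: "mu n 1 g = (if n = 0 then g else 0)" "mu n g 1 = (if n = 0 then g else 0)"
proof -
  have "T (1 \<otimes> g) = 0" "T (g \<otimes> 1) = 0" by (simp_all add: T_tens gen_D box_simps)
  then show "mu n 1 g = (if n = 0 then g else 0)" "mu n g 1 = (if n = 0 then g else 0)"
    by (cases n; simp add: mu_0; simp add: mu_def M_eq_0)+
qed

subsection \<open>Vacuum expectation values\<close>

text \<open>The order 0 of \<open>mu_vac\<close>. Moving one \<open>zs\<close> through z^j leaves a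
  term ending in \<open>zs\<close>, which does not contribute, and the factor 1 - w^j.\<close>

lemma coef_zs_z_power:
  "coef d 0 (zs ^ i * z ^ j) = (if j = i + d then complex_of_real (vac (q\<^sup>2) d 0 i) else 0)"
proof (induction i arbitrary: j)
  case 0
  show ?case using q2 by (simp add: coef_power)
next
  case (Suc i)
  have "zs ^ Suc i * z ^ j = w ^ j *\<^sub>C (zs ^ i * z ^ j * zs) + (1 - w ^ j) *\<^sub>C (zs ^ i * z ^ (j - 1))"
    by (simp only: power_Suc2 mult.assoc zs_z_power distrib_left mult_scaleC_right)
  then have "coef d 0 (zs ^ Suc i * z ^ j) = (1 - w ^ j) * coef d 0 (zs ^ i * z ^ (j - 1))"
    by (simp add: coef_add coef_scale coef_zs_right)
  also have "\<dots> = (if j = Suc i + d then complex_of_real (vac (q\<^sup>2) d 0 (Suc i)) else 0)"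
  proof (cases j)
    case (Suc j')
    then show ?thesis
      by (auto simp: Suc.IH vac_first_0 q_poch_Suc w_def)
  qed simp
  finally show ?case .
qed

text \<open>The difference j - i is preserved and three neighbouring exponents are coupled, as in
  \<open>vac_lap\<close>.\<close>

lemma T_monomial:
  "T (zs ^ Suc i \<otimes> z ^ Suc j) = (iw * qnum (Suc i) * qnum (Suc j)) *\<^sub>C
    (zs ^ i \<otimes> z ^ j - (1 + iw) *\<^sub>C (zs ^ Suc i \<otimes> z ^ Suc j) + iw *\<^sub>C (zs ^ (i + 2) \<otimes> z ^ (j + 2)))"
proof -
  have "T (zs ^ Suc i \<otimes> z ^ Suc j) = (qnum (Suc i) * qnum (Suc j)) *\<^sub>C box_term (zs ^ i) (z ^ j)"
    unfolding T_tens D_zs_power D'_z_power by (simp add: box_simps scaleC_scaleC)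
  moreover have "box_term (zs ^ i) (z ^ j) = iw *\<^sub>C
    (zs ^ i \<otimes> z ^ j - (1 + iw) *\<^sub>C (zs ^ Suc i \<otimes> z ^ Suc j) + iw *\<^sub>C (zs ^ (i + 2) \<otimes> z ^ (j + 2)))"
  proof -
    have "zs ^ i * zs * zs = zs ^ (i + 2)"
      by (simp only: power_add power2_eq_square mult.assoc)
    moreover have "z * (z * z ^ j) = z ^ (j + 2)" by simp
    ultimately show ?thesis
      by (simp only: box_term_def power_Suc2[of zs] power_Suc[of z])
  qed
  ultimately show ?thesis by (simp only: scaleC_scaleC mult_ac)
qed

text \<open>Induction on the order n with both exponents free, since the operator reaches
  neighbouring exponents at lower order. If i or j is 0, one argument is the unit.\<close>

lemma mu_vac:
  "coef d 0 (mu n (zs ^ i) (z ^ j)) = (if j = i + d then complex_of_real (vac (q\<^sup>2) d n i) else 0)"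
proof (induction n arbitrary: i j rule: less_induct)
  case (less n)
  consider "n = 0" | "i = 0" | "j = 0" "i \<noteq> 0" "n \<noteq> 0" | n' i' j' where "n = Suc n'" "i = Suc i'" "j = Suc j'"
    by (metis not0_implies_Suc)
  then show ?case
  proof cases
    case 1
    then show ?thesis by (simp add: mu_0 coef_zs_z_power)
  next
    case 2
    then show ?thesis using q2 by (simp add: mu_one coef_power coef_zero)
  next
    case 3
    then show ?thesis by (simp add: mu_one coef_zero)
  next
    case 4
    let ?v = "\<lambda>n i. complex_of_real (vac (q\<^sup>2) d n i)"
    define b where "b = (1 - w)\<^sup>2 * (iw * qnum (Suc i') * qnum (Suc j'))"
    have cT: "coef d 0 (M m (T (zs ^ i \<otimes> z ^ j))) = iw * qnum (Suc i') * qnum (Suc j') *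
      (coef d 0 (mu m (zs ^ i') (z ^ j')) - (1 + iw) * coef d 0 (mu m (zs ^ i) (z ^ j))
       + iw * coef d 0 (mu m (zs ^ (i' + 2)) (z ^ (j' + 2))))" for m
      unfolding 4 T_monomial mu_def
      by (simp only: clinear_scaleC[OF clinear_M] clinear_add[OF clinear_M] clinear_diff[OF clinear_M]
          coef_add coef_scale clinear_diff[OF clinear_coef])
    \<comment> \<open>At lower order the table is known, so the operator becomes
      \<open>vac_lap\<close>; the factor (1 - w)^2 turns the q-integers into the differences 1 -
      w^(-k).\<close>
    have lap: "coef d 0 (M m (T (zs ^ i \<otimes> z ^ j))) * (1 - w)\<^sup>2 = (if j = i + d then complex_of_real (vac_lap (q\<^sup>2) d m i') else 0)"
      if "m < n" for m
    proof (cases "j = i + d")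
      case True
      have j': "j' = i' + d" "j' + 2 = i' + 2 + d" using True 4 by auto
      have "iw * qnum (Suc i') * qnum (Suc j') * (1 - w)\<^sup>2 = w * (1 - iw ^ Suc i') * (1 - iw ^ Suc j')"
      proof -
        have "iw \<noteq> 1" using iw_power_neq_1[of 0] by simp
        then have e: "1 - iw ^ k = qnum k * (1 - iw)" for k
          by (simp add: qnum_eq)
        show ?thesis unfolding e using w_iw(1) by algebra
      qed
      moreover have "complex_of_real (vac_lap (q\<^sup>2) d m i') = w * (1 - iw ^ Suc i') * (1 - iw ^ Suc j') *
         (?v m i' - (1 + iw) * ?v m (Suc i') + iw * ?v m (i' + 2))"
        unfolding vac_lap_def j' iw_power by (simp add: w_def iw_def)
      ultimately show ?thesis
        unfolding cT less[OF that] using True 4 j' by (simp add: mult.assoc)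
    next
      case False
      then have "j' \<noteq> i' + d" "j' + 2 \<noteq> i' + 2 + d" using 4 by auto
      then show ?thesis unfolding cT less[OF that] using False by simp
    qed
    show ?thesis
    proof (cases n')
      case 0
      have "coef d 0 (mu n (zs ^ i) (z ^ j)) * (1 - w) = coef d 0 (M 0 (T (zs ^ i \<otimes> z ^ j))) * (1 - w)\<^sup>2"
        by (simp add: mu_def 4(1) 0 M_rec(1) coef_scale power2_eq_square)
      also have "\<dots> = (if j = i + d then complex_of_real (vac (q\<^sup>2) d n i) else 0) * (1 - w)"
      proof -
        have "complex_of_real (vac_lap (q\<^sup>2) d 0 i') = complex_of_real ((1 - q\<^sup>2) * vac (q\<^sup>2) d 1 (Suc i'))"
          by (simp only: vac_rec(2)[OF q2])
        then show ?thesis using lap[of 0] 4 0 by (simp add: w_def mult.commute)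
      qed
      finally show ?thesis using w_neq_1 by simp
    next
      case (Suc m)
      have n: "n = m + 2" using 4 Suc by simp
      have mm: "coef d 0 (mu m' (zs ^ i) (z ^ j)) = (if j = i + d then ?v m' i else 0)" if "m' < n" for m'
        using less[OF that] .
      have "(1 - w ^ (m + 2)) * coef d 0 (mu n (zs ^ i) (z ^ j)) =
          coef d 0 ((1 - w ^ (m + 2)) *\<^sub>C M (m + 2) (zs ^ i \<otimes> z ^ j))"
        by (simp only: mu_def n coef_scale)
      also have "\<dots> = coef d 0 (M (m + 1) (T (zs ^ i \<otimes> z ^ j))) * (1 - w)\<^sup>2
          + (1 + w) * (1 - w ^ (m + 1)) * coef d 0 (mu (m + 1) (zs ^ i) (z ^ j))
          - w * (1 - w ^ m) * coef d 0 (mu m (zs ^ i) (z ^ j))"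
        unfolding M_rec(2) mu_def
        by (simp only: coef_add coef_scale clinear_diff[OF clinear_coef] mult.commute)
      also have "\<dots> = (1 - w ^ (m + 2)) * (if j = i + d then ?v n i else 0)"
      proof -
        have "complex_of_real ((1 - (q\<^sup>2) ^ (m + 2)) * vac (q\<^sup>2) d (m + 2) (Suc i')) =
          complex_of_real (vac_lap (q\<^sup>2) d (m + 1) i' + (1 + q\<^sup>2) * (1 - (q\<^sup>2) ^ (m + 1)) * vac (q\<^sup>2) d (m + 1) (Suc i')
           - q\<^sup>2 * (1 - (q\<^sup>2) ^ m) * vac (q\<^sup>2) d m (Suc i'))"
          by (simp only: vac_rec(1)[OF q2])
        then have "(1 - w ^ (m + 2)) * ?v (m + 2) (Suc i') = complex_of_real (vac_lap (q\<^sup>2) d (m + 1) i')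
           + (1 + w) * (1 - w ^ (m + 1)) * ?v (m + 1) (Suc i') - w * (1 - w ^ m) * ?v m (Suc i')"
          by (simp only: w_def of_real_diff of_real_add of_real_mult of_real_power of_real_1)
        moreover have "m + 1 < n" "m < n" by (simp_all add: n)
        ultimately show ?thesis by (simp only: lap mm) (simp add: 4(2) n)
      qed
      finally show ?thesis using w_power_neq_1[of "m + 1"] by simp
    qed
  qed
qed

text \<open>A power of z at the left of a monomial of h can be pulled out and then destroys the
  constant term. Among the remaining powers of \<open>zs\<close>, \<open>mu_vac\<close> at d = 0
  selects the exponent n.\<close>

lemma coef_mu_right: "coef 0 0 (mu b h (z ^ n)) = coef 0 n h * complex_of_real (vac (q\<^sup>2) 0 b n)"
  by (induction h rule: mon_induct)
    (auto simp: mu_z_power coef_z_power_left mu_vac coef_mon coef_power mu_simps coef_add coef_scale algebra_simps)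

lemma coef_mu_left: "coef 0 0 (mu b (zs ^ n) h) = coef n 0 h * complex_of_real (vac (q\<^sup>2) 0 b n)"
proof -
  have "coef 0 0 (mu b (zs ^ n) h) = cnj (coef 0 0 (mu b (st h) (z ^ n)))"
    by (simp add: mu_st coef_st[symmetric] st(2) st_power st(4))
  then show ?thesis by (simp add: coef_mu_right coef_st)
qed

lemma coef_mu_zs: "coef 0 e (mu a (zs ^ k) (z ^ l)) = (if k = l + e then complex_of_real (vac (q\<^sup>2) e a l) else 0)"
proof -
  have "coef 0 e (mu a (zs ^ k) (z ^ l)) = cnj (coef e 0 (mu a (zs ^ l) (z ^ k)))"
    by (simp add: coef_st[symmetric] mu_st st_power st(4) st_zs)
  then show ?thesis by (simp add: mu_vac)
qed

section \<open>The associator\<close>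

definition assoc_l :: "nat \<Rightarrow> 'p \<Rightarrow> 'p \<Rightarrow> 'p \<Rightarrow> 'p"
  where "assoc_l p f g h = (\<Sum>a\<le>p. mu (p - a) (mu a f g) h)"
definition assoc_r :: "nat \<Rightarrow> 'p \<Rightarrow> 'p \<Rightarrow> 'p \<Rightarrow> 'p"
  where "assoc_r p f g h = (\<Sum>a\<le>p. mu (p - a) f (mu a g h))"

lemma assoc_add:
  "assoc_l p (f + f') g h = assoc_l p f g h + assoc_l p f' g h"
  "assoc_l p f (g + g') h = assoc_l p f g h + assoc_l p f g' h"
  "assoc_l p f g (h + h') = assoc_l p f g h + assoc_l p f g h'"
  "assoc_r p (f + f') g h = assoc_r p f g h + assoc_r p f' g h"
  "assoc_r p f (g + g') h = assoc_r p f g h + assoc_r p f g' h"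
  "assoc_r p f g (h + h') = assoc_r p f g h + assoc_r p f g h'"
  by (simp_all add: assoc_l_def assoc_r_def mu_simps sum.distrib)

lemma assoc_scale:
  "assoc_l p (c *\<^sub>C f) g h = c *\<^sub>C assoc_l p f g h"
  "assoc_l p f (c *\<^sub>C g) h = c *\<^sub>C assoc_l p f g h"
  "assoc_l p f g (c *\<^sub>C h) = c *\<^sub>C assoc_l p f g h"
  "assoc_r p (c *\<^sub>C f) g h = c *\<^sub>C assoc_r p f g h"
  "assoc_r p f (c *\<^sub>C g) h = c *\<^sub>C assoc_r p f g h"
  "assoc_r p f g (c *\<^sub>C h) = c *\<^sub>C assoc_r p f g h"
  by (simp_all add: assoc_l_def assoc_r_def mu_simps complex_vector.scale_sum_right)

lemma assoc_z: "assoc_l p (z ^ i * f) g h = z ^ i * assoc_l p f g h" "assoc_r p (z ^ i * f) g h = z ^ i * assoc_r p f g h"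
  by (simp_all add: assoc_l_def assoc_r_def mu_z_power sum_distrib_left)

lemma assoc_zs: "assoc_l p f g (h * zs ^ i) = assoc_l p f g h * zs ^ i" "assoc_r p f g (h * zs ^ i) = assoc_r p f g h * zs ^ i"
  by (simp_all add: assoc_l_def assoc_r_def mu_zs_power sum_distrib_right)

text \<open>By linearity all arguments are monomials. Powers of z on the left of f and of
  \<open>zs\<close> on the right of h pull out of both bracketings, which leaves the arguments in
  \<open>base\<close>.\<close>

lemma coef_assoc: "coef 0 0 (assoc_l p f g h) = coef 0 0 (assoc_r p f g h)"
proof -
  have base: "coef 0 0 (assoc_l p (zs ^ k) (z ^ l * zs ^ m) (z ^ n)) = coef 0 0 (assoc_r p (zs ^ k) (z ^ l * zs ^ m) (z ^ n))" for k l m n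
  proof -
    \<comment> \<open>The outer product reads off the coefficient of zs^n. The right factor zs^m
      shifts it to n - m, where the inner product is known from \<open>coef_mu_zs\<close>.\<close>
    have L: "coef 0 0 (assoc_l p (zs ^ k) (z ^ l * zs ^ m) (z ^ n)) =
      (\<Sum>a\<le>p. (if m \<le> n \<and> k = l + (n - m) then complex_of_real (vac (q\<^sup>2) (n - m) a l) else 0) *
        complex_of_real (vac (q\<^sup>2) 0 (p - a) n))"
      unfolding assoc_l_def clinear_sum[OF clinear_coef] coef_mu_right mu_zs_power coef_zs_power_right coef_mu_zs
      by (intro sum.cong) auto
    have R: "coef 0 0 (assoc_r p (zs ^ k) (z ^ l * zs ^ m) (z ^ n)) =
      (\<Sum>a\<le>p. (if l \<le> k \<and> n = m + (k - l) then complex_of_real (vac (q\<^sup>2) (k - l) a m) else 0) *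
        complex_of_real (vac (q\<^sup>2) 0 (p - a) k))"
      unfolding assoc_r_def clinear_sum[OF clinear_coef] coef_mu_left mu_z_power coef_z_power_left mu_vac
      by (intro sum.cong) auto
    show ?thesis
    \<comment> \<open>The conditions in \<open>L\<close> and \<open>R\<close> are the same: both say
      that k - l and n - m are equal and nonnegative. Outside it both sides vanish.\<close>
    proof (cases "m \<le> n \<and> k = l + (n - m)")
      case True
      define e where "e = n - m"
      have e: "n = m + e" "k = l + e" "n - m = e" "k - l = e" using True by (auto simp: e_def)
      have "complex_of_real (\<Sum>a\<le>p. vac (q\<^sup>2) 0 (p - a) (m + e) * vac (q\<^sup>2) e a l) =
          complex_of_real (\<Sum>a\<le>p. vac (q\<^sup>2) 0 (p - a) (l + e) * vac (q\<^sup>2) e a m)"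
        by (simp only: vac_convolution[OF q2])
      then show ?thesis unfolding L R using True by (simp add: e mult.commute)
    next
      case False
      then have N: "\<not> (l \<le> k \<and> n = m + (k - l))" by auto
      show ?thesis unfolding L R by (simp only: False N if_False mult_zero_left sum.neutral_const)
    qed
  qed
  show ?thesis
  proof (induction f rule: mon_induct)
    case (mon j k)
    show ?case
    proof (induction h rule: mon_induct)
      case (mon n i)
      show ?case
        by (induction g rule: mon_induct)
          (auto simp: assoc_z assoc_zs coef_z_power_left coef_zs_power_right base mult.assoc[symmetric]
            assoc_add assoc_scale coef_add coef_scale distrib_left distrib_right mult_scaleC_left mult_scaleC_right)
    qed (simp_all add: assoc_add assoc_scale coef_add coef_scale)
  qed (simp_all add: assoc_add assoc_scale coef_add coef_scale)
qed

lemma mu_assoc: "(\<Sum>a\<le>p. mu (p - a) (mu a f g) h) = (\<Sum>a\<le>p. mu (p - a) f (mu a g h))"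
proof -
  define A where "A f g h = assoc_l p f g h - assoc_r p f g h" for f g h
  \<comment> \<open>All associators at once: F and E also act on the arguments, so only the whole
    family is mapped into its span.\<close>
  define V where "V = {A f g h | f g h. True}"
  have V: "A f g h \<in> complex_vector.span V" for f g h
    by (rule complex_vector.span_base) (auto simp: V_def)
  have ff: "ff (A f g h) = A (ff f) (ki g) (ki h) + A f (ff g) (ki h) + A f g (ff h)" for f g h
    by (simp add: A_def assoc_l_def assoc_r_def lin_simps clinear_sum[OF lin(4)] mu_ff mu_ki mu_simps sum.distrib)
  have ee: "ee (A f g h) = A (ee f) g h + A (kk f) (ee g) h + A (kk f) (kk g) (ee h)" for f g h
    by (simp add: A_def assoc_l_def assoc_r_def lin_simps clinear_sum[OF lin(3)] mu_ee mu_kk mu_simps sum.distrib)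
  have "A f g h = 0"
  proof (rule covariant_eq_0[of V])
    show "A f g h \<in> V" by (auto simp: V_def)
    fix x assume "x \<in> V"
    then obtain f g h where x: "x = A f g h" by (auto simp: V_def)
    show "ff x \<in> complex_vector.span V" "ee x \<in> complex_vector.span V"
      unfolding x ff ee by (intro complex_vector.span_add V)+
    show "coef 0 0 x = 0"
      by (simp add: x A_def clinear_diff[OF clinear_coef] coef_assoc)
  qed
  then show ?thesis by (simp add: A_def assoc_l_def assoc_r_def)
qed

end

section \<open>Formal power series\<close>

text \<open>\<open>fps_m\<close> for arbitrary coefficient maps; the index bookkeeping is thereby
  separated from the operator.\<close>

definition conv :: "(nat \<Rightarrow> 'p \<Rightarrow> 'p \<Rightarrow> 'p) \<Rightarrow> 'p::complex_vector fps \<Rightarrow> 'p fps \<Rightarrow> 'p fps"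
  where "conv \<mu> a b = Abs_fps (\<lambda>n. \<Sum>i\<le>n. \<Sum>j\<le>i. \<mu> (n - i) (fps_nth a j) (fps_nth b (i - j)))"

lemma conv_nth: "fps_nth (conv \<mu> a b) n = (\<Sum>i\<le>n. \<Sum>j\<le>i. \<mu> (n - i) (fps_nth a j) (fps_nth b (i - j)))"
  by (simp add: conv_def)

lemma fps_scaleC_nth: "fps_nth (c *\<^sub>C f) n = c *\<^sub>C fps_nth f n"
  by (simp add: scaleC_fps_def)

lemma fps_map_nth: "fps_nth (fps_map h f) n = h (fps_nth f n)"
  by (simp add: fps_map_def)

lemma clinear_fps_map: "clinear h \<Longrightarrow> clinear (fps_map h)"
  by (rule clinearI) (simp_all add: fps_eq_iff fps_map_nth fps_scaleC_nth clinear_add clinear_scaleC)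

lemma cbilinear_conv:
  assumes "\<And>n. cbilinear (\<mu> n)"
  shows "cbilinear (conv \<mu>)"
  by (rule cbilinearI)
    (simp_all add: fps_eq_iff conv_nth fps_scaleC_nth cbilinearD[OF assms] sum.distrib
      complex_vector.scale_sum_right)

lemma conv_assoc:
  fixes \<mu> :: "nat \<Rightarrow> 'p::complex_vector \<Rightarrow> 'p \<Rightarrow> 'p"
  assumes bil: "\<And>n. cbilinear (\<mu> n)"
    and assoc: "\<And>p f g h. (\<Sum>u\<le>p. \<mu> (p - u) (\<mu> u f g) h) = (\<Sum>u\<le>p. \<mu> (p - u) f (\<mu> u g h))"
  shows "conv \<mu> (conv \<mu> a b) c = conv \<mu> a (conv \<mu> b c)"
proof (rule fps_ext)
  fix n :: nat
  \<comment> \<open>x, y, s are the degrees of the coefficients taken from a, b, c, and u is the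
    order of the inner product; the outer order is the remainder. For fixed x, y, s the sum over u
    is the hypothesis at p = n - x - y - s.\<close>
  define Q where "Q = (SIGMA x:{..n}. SIGMA y:{..n - x}. SIGMA s:{..n - x - y}. {..n - x - y - s})"
  define F where "F x y s u = \<mu> (n - x - y - s - u) (\<mu> u (fps_nth a x) (fps_nth b y)) (fps_nth c s)" for x y s u :: nat
  define G where "G x y s u = \<mu> (n - x - y - s - u) (fps_nth a x) (\<mu> u (fps_nth b y) (fps_nth c s))" for x y s u :: nat
  have "fps_nth (conv \<mu> (conv \<mu> a b) c) n =
    (\<Sum>i\<le>n. \<Sum>j\<le>i. \<Sum>i'\<le>j. \<Sum>j'\<le>i'. \<mu> (n - i) (\<mu> (j - i') (fps_nth a j') (fps_nth b (i' - j'))) (fps_nth c (i - j)))"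
    by (simp add: conv_nth cbilinear_sum[OF bil])
  also have "\<dots> = (\<Sum>(i, j, i', j')\<in>(SIGMA i:{..n}. SIGMA j:{..i}. SIGMA i':{..j}. {..i'}).
      \<mu> (n - i) (\<mu> (j - i') (fps_nth a j') (fps_nth b (i' - j'))) (fps_nth c (i - j)))"
    by (simp add: sum.Sigma)
  also have "\<dots> = (\<Sum>(x, y, s, u)\<in>Q. F x y s u)"
    by (rule sum.reindex_bij_witness[of _ "\<lambda>(x, y, s, u). (x + y + s + u, x + y + u, x + y, x)"
          "\<lambda>(i, j, i', j'). (j', i' - j', i - j, j - i')"]) (auto simp: Q_def F_def G_def)
  also have "\<dots> = (\<Sum>x\<le>n. \<Sum>y\<le>n - x. \<Sum>s\<le>n - x - y. \<Sum>u\<le>n - x - y - s. F x y s u)"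
    by (simp add: sum.Sigma Q_def)
  also have "\<dots> = (\<Sum>x\<le>n. \<Sum>y\<le>n - x. \<Sum>s\<le>n - x - y. \<Sum>u\<le>n - x - y - s. G x y s u)"
    by (simp only: F_def G_def assoc)
  also have "\<dots> = (\<Sum>(x, y, s, u)\<in>Q. G x y s u)"
    by (simp add: sum.Sigma Q_def)
  also have "\<dots> = (\<Sum>(i, j, i', j')\<in>(SIGMA i:{..n}. SIGMA j:{..i}. SIGMA i':{..i - j}. {..i'}).
      \<mu> (n - i) (fps_nth a j) (\<mu> (i - j - i') (fps_nth b j') (fps_nth c (i' - j'))))"
    by (rule sum.reindex_bij_witness[of _ "\<lambda>(i, j, i', j'). (j, j', i' - j', i - j - i')"
          "\<lambda>(x, y, s, u). (x + y + s + u, x, y + s, y)"]) (auto simp: Q_def F_def G_def)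
  also have "\<dots> = (\<Sum>i\<le>n. \<Sum>j\<le>i. \<Sum>i'\<le>i - j. \<Sum>j'\<le>i'.
      \<mu> (n - i) (fps_nth a j) (\<mu> (i - j - i') (fps_nth b j') (fps_nth c (i' - j'))))"
    by (simp add: sum.Sigma)
  also have "\<dots> = fps_nth (conv \<mu> a (conv \<mu> b c)) n"
    by (simp add: conv_nth cbilinear_sum[OF bil])
  finally show "fps_nth (conv \<mu> (conv \<mu> a b) c) n = fps_nth (conv \<mu> a (conv \<mu> b c)) n" .
qed

lemma conv_unit:
  fixes \<mu> :: "nat \<Rightarrow> 'p::complex_algebra_1 \<Rightarrow> 'p \<Rightarrow> 'p"
  assumes bil: "\<And>n. cbilinear (\<mu> n)"
    and one: "\<And>n f. \<mu> n 1 f = (if n = 0 then f else 0)" "\<And>n f. \<mu> n f 1 = (if n = 0 then f else 0)"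
  shows "is_unit_of (conv \<mu>) 1"
proof -
  note z = cbilinear_zero[OF bil]
  have "(\<Sum>j\<le>i. \<mu> m (fps_nth 1 j) (fps_nth f (i - j))) = (\<Sum>j\<in>{0}. \<mu> m (fps_nth 1 j) (fps_nth f (i - j)))"
    "(\<Sum>j\<le>i. \<mu> m (fps_nth f j) (fps_nth 1 (i - j))) = (\<Sum>j\<in>{i}. \<mu> m (fps_nth f j) (fps_nth 1 (i - j)))"
    for i m f
    by (rule sum.mono_neutral_right; auto simp: z)+
  then have "fps_nth (conv \<mu> 1 f) n = (\<Sum>i\<le>n. if i = n then fps_nth f n else 0)"
    "fps_nth (conv \<mu> f 1) n = (\<Sum>i\<le>n. if i = n then fps_nth f n else 0)" for f n
    unfolding conv_nth by (auto simp: one intro!: sum.cong)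
  then show ?thesis
    by (simp add: is_unit_of_def fps_eq_iff)
qed

lemma conv_antihom:
  assumes add: "\<And>f g. h (f + g) = h f + h g" and zero: "h 0 = 0"
    and anti: "\<And>n f g. h (\<mu> n f g) = \<mu> n (h g) (h f)"
  shows "fps_map h (conv \<mu> a b) = conv \<mu> (fps_map h b) (fps_map h a)"
proof (rule fps_ext)
  fix n :: nat
  have sum: "h (sum f A) = (\<Sum>x\<in>A. h (f x))" for f :: "nat \<Rightarrow> 'a" and A
    by (induction A rule: infinite_finite_induct) (simp_all add: add zero)
  have "(\<Sum>j\<le>i. \<mu> (n - i) (h (fps_nth b (i - j))) (h (fps_nth a j))) =
      (\<Sum>j\<le>i. \<mu> (n - i) (h (fps_nth b j)) (h (fps_nth a (i - j))))" for i
    by (rule sum.reindex_bij_witness[of _ "\<lambda>j. i - j" "\<lambda>j. i - j"]) auto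
  then show "fps_nth (fps_map h (conv \<mu> a b)) n = fps_nth (conv \<mu> (fps_map h b) (fps_map h a)) n"
    by (simp add: fps_map_nth conv_nth sum anti)
qed

text \<open>Since \<Delta> is a homomorphism, the elements satisfying the equation form a
  subalgebra; on a generator it is enough to test it on simple tensors.\<close>

lemma covariant_from_generators:
  assumes pres: "presented_by \<phi> R" and hom: "alg_hom \<Delta>" and mdl: "is_module act" and bil: "cbilinear mul"
    and gens: "\<And>g a b. act (\<phi> g) (mul a b) = tensor_lift mul (tensor_act act (\<Delta> (\<phi> g)) (a \<otimes> b))"
  shows "act \<xi> (tensor_lift mul t) = tensor_lift mul (tensor_act act (\<Delta> \<xi>) t)"
  using pres
proof (induction \<xi> arbitrary: t rule: presented_by_induct)
  case one
  show ?case using hom mdl by (simp add: alg_hom_def tensor_act_one is_module_def)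
next
  have act: "cbilinear act" using mdl by (simp add: is_module_def)
  have \<Delta>: "clinear \<Delta>" "\<Delta> (x * y) = \<Delta> x * \<Delta> y" for x y using hom by (simp_all add: alg_hom_def)
  note lift = clinear_tensor_lift[OF bil]
  note left = clinear_tensor_act_left[OF act]
  {
    case (mult g \<xi>)
    have *: "act (\<phi> g) (tensor_lift mul t) = tensor_lift mul (tensor_act act (\<Delta> (\<phi> g)) t)" for t
      by (rule clinear_eq_tensorI[of "\<lambda>t. act (\<phi> g) (tensor_lift mul t)"])
        (simp_all add: gens tensor_lift_tens[OF bil] clinear_compose[OF cbilinear_clinear(1)[OF act] lift]
          clinear_compose[OF lift clinear_tensor_act[OF act]])
    show ?case using mdl by (simp add: is_module_def mult * \<Delta> tensor_act_mult[OF mdl])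
  next
    case (add \<xi> \<eta>)
    then show ?case by (simp add: cbilinearD[OF act] clinear_add[OF \<Delta>(1)] clinear_add[OF left] clinear_add[OF lift])
  next
    case (scale c \<xi>)
    then show ?case
      by (simp add: cbilinearD[OF act] clinear_scaleC[OF \<Delta>(1)] clinear_scaleC[OF left] clinear_scaleC[OF lift])
  }
qed

section \<open>The differential calculus\<close>

lemma Pol_alg_induct [consumes 1, case_names one z zs add scale]:
  assumes "Pol_alg q z zs" "P 1" "\<And>f. P f \<Longrightarrow> P (z * f)" "\<And>f. P f \<Longrightarrow> P (zs * f)"
    "\<And>f g. P f \<Longrightarrow> P g \<Longrightarrow> P (f + g)" "\<And>c f. P f \<Longrightarrow> P (c *\<^sub>C f)"
  shows "P f"
  using assms(1) unfolding Pol_alg_def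
proof (induction f rule: presented_by_induct)
  case (mult g f)
  then show ?case by (cases g) (simp_all add: assms)
qed (simp_all add: assms)

lemma Pol_alg_rel:
  assumes "Pol_alg q z zs"
  shows "zs * z = complex_of_real (q\<^sup>2) *\<^sub>C (z * zs) + complex_of_real (1 - q\<^sup>2) *\<^sub>C 1"
  using presented_by_rel[OF assms[unfolded Pol_alg_def] singletonI]
  by (simp add: free_eval_simps del: of_real_power of_real_diff)

text \<open>Supplies the derivatives for \<open>disc_calculus\<close>. The automorphisms
  \<open>kk\<close>, \<open>ki\<close> later become the actions of K and its inverse.\<close>

locale pol_calculus =
  fixes q :: real and z zs :: "'p::complex_algebra_1" and kk ki :: "'p \<Rightarrow> 'p"
    and l :: "'p \<Rightarrow> 'w::complex_vector \<Rightarrow> 'w" and r :: "'w \<Rightarrow> 'p \<Rightarrow> 'w" and d :: "'p \<Rightarrow> 'w"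
  assumes q: "0 < q" and Pol: "Pol_alg q z zs" and calc: "Pol_calculus q z zs l r d"
    and lin: "clinear kk" "clinear ki"
    and kk_mult: "kk (f * g) = kk f * kk g" and kk_one: "kk 1 = 1"
    and ki_mult: "ki (f * g) = ki f * ki g" and ki_one: "ki 1 = 1"
    and kk_ki: "kk (ki f) = f" and ki_kk: "ki (kk f) = f"
    and kk_z: "kk z = complex_of_real (q\<^sup>2) *\<^sub>C z" and kk_zs: "kk zs = complex_of_real (1 / q\<^sup>2) *\<^sub>C zs"
begin

section \<open>Moving polynomials across the differentials\<close>

lemma bilinear: "cbilinear l" "cbilinear r"
  and l_one: "l 1 x = x" and l_mult: "l (a * b) x = l a (l b x)"
  and r_one: "r x 1 = x" and r_mult: "r x (a * b) = r (r x a) b"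
  and l_r: "r (l a x) b = l a (r x b)"
  and clinear_d: "clinear d" and d_mult: "d (f * g) = r (d f) g + l f (d g)"
  using calc unfolding Pol_calculus_def first_order_calculus_def bimodule_def by auto

lemma kernel: "free_bimod_eval l r (d z) (d zs) u = 0 \<longleftrightarrow> u \<in> sub_bimod (calculus_rels q z zs)"
  using calc unfolding Pol_calculus_def by blast

lemmas l_simps = cbilinearD[OF bilinear(1)] cbilinear_zero[OF bilinear(1)]
lemmas r_simps = cbilinearD[OF bilinear(2)] cbilinear_zero[OF bilinear(2)]

lemma cbilinear_lr: "cbilinear (\<lambda>a b. r (l a v) b)"
  by (rule cbilinearI) (simp_all add: l_simps r_simps)

lemma free_bimod_eval_tens: "tensor_lift (\<lambda>a b. r (l a v) b) (a \<otimes> b) = r (l a v) b"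
  by (rule tensor_lift_tens[OF cbilinear_lr])

lemma rels_eval:
  assumes "(x, y) \<in> calculus_rels q z zs"
  shows "free_bimod_eval l r (d z) (d zs) (x, y) = 0"
proof -
  have "((1 \<otimes> 1) * x * (1 \<otimes> 1), (1 \<otimes> 1) * y * (1 \<otimes> 1)) \<in> sub_bimod (calculus_rels q z zs)"
    unfolding sub_bimod_def by (rule complex_vector.span_base) (use assms in blast)
  then show ?thesis by (simp add: kernel flip: one_tensor_def)
qed

lemma comm:
  "l z (d z) = complex_of_real (1 / q\<^sup>2) *\<^sub>C r (d z) z"
  "l zs (d zs) = complex_of_real (q\<^sup>2) *\<^sub>C r (d zs) zs"
  "l zs (d z) = complex_of_real (q\<^sup>2) *\<^sub>C r (d z) zs"
  "l z (d zs) = complex_of_real (1 / q\<^sup>2) *\<^sub>C r (d zs) z"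
proof -
  note lift = clinear_diff[OF clinear_tensor_lift[OF cbilinear_lr]] clinear_scaleC[OF clinear_tensor_lift[OF cbilinear_lr]]
    clinear_zero[OF clinear_tensor_lift[OF cbilinear_lr]]
  note rel = rels_eval[unfolded calculus_rels_def free_bimod_eval_def fst_conv snd_conv]
  show "l z (d z) = complex_of_real (1 / q\<^sup>2) *\<^sub>C r (d z) z"
    using rel[of "z \<otimes> 1 - complex_of_real (1 / q\<^sup>2) *\<^sub>C (1 \<otimes> z)" 0]
    by (simp add: lift free_bimod_eval_tens l_one r_one del: of_real_divide)
  show "l zs (d zs) = complex_of_real (q\<^sup>2) *\<^sub>C r (d zs) zs"
    using rel[of 0 "zs \<otimes> 1 - complex_of_real (q\<^sup>2) *\<^sub>C (1 \<otimes> zs)"]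
    by (simp add: lift free_bimod_eval_tens l_one r_one del: of_real_power)
  show "l zs (d z) = complex_of_real (q\<^sup>2) *\<^sub>C r (d z) zs"
    using rel[of "zs \<otimes> 1 - complex_of_real (q\<^sup>2) *\<^sub>C (1 \<otimes> zs)" 0]
    by (simp add: lift free_bimod_eval_tens l_one r_one del: of_real_power)
  show "l z (d zs) = complex_of_real (1 / q\<^sup>2) *\<^sub>C r (d zs) z"
    using rel[of 0 "z \<otimes> 1 - complex_of_real (1 / q\<^sup>2) *\<^sub>C (1 \<otimes> z)"]
    by (simp add: lift free_bimod_eval_tens l_one r_one del: of_real_divide)
qed

lemma q_scale: "(complex_of_real (q\<^sup>2) * complex_of_real (1 / q\<^sup>2)) *\<^sub>C x = x"
    "(complex_of_real (1 / q\<^sup>2) * complex_of_real (q\<^sup>2)) *\<^sub>C x = x" for x :: "'b::complex_vector"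
  using q by (simp_all add: scaleC_one)

text \<open>For both differentials, passing z costs q^2 and passing \<open>zs\<close> costs q^(-2).
  These are the weights of K, so a single automorphism describes all four commutation
  relations.\<close>

lemma r_generator:
  assumes "v = d z \<or> v = d zs"
  shows "r v f = l (kk f) v"
proof -
  have z: "r v z = l (kk z) v" and zs: "r v zs = l (kk zs) v"
    using assms comm by (auto simp: kk_z kk_zs l_simps q_scale simp del: of_real_power of_real_divide)
  show ?thesis
    using Pol
    by (induction f rule: Pol_alg_induct)
      (simp_all add: kk_one l_one r_one r_mult z zs l_r l_mult kk_mult l_simps r_simps clinear_add[OF lin(1)]
        clinear_scaleC[OF lin(1)])
qed

lemma l_generator: "l f (d z) = r (d z) (ki f)" "l f (d zs) = r (d zs) (ki f)"
  by (simp_all add: r_generator kk_ki)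

section \<open>Partial derivatives and their twisted Leibniz rules\<close>

lemma partials_ex: "\<exists>a b. d f = l a (d z) + l b (d zs)"
  using Pol
proof (induction f rule: Pol_alg_induct)
  case one
  have "d 1 = 0" using d_mult[of 1 1] by (simp add: l_one r_one)
  then have "d 1 = l 0 (d z) + l 0 (d zs)" by (simp add: l_simps)
  then show ?case by blast
next
  case (z f)
  then obtain a b where "d f = l a (d z) + l b (d zs)" by blast
  then have "d (z * f) = l (kk f + z * a) (d z) + l (z * b) (d zs)"
    by (simp add: d_mult r_generator l_simps l_mult)
  then show ?case by blast
next
  case (zs f)
  then obtain a b where "d f = l a (d z) + l b (d zs)" by blast
  then have "d (zs * f) = l (zs * a) (d z) + l (kk f + zs * b) (d zs)"
    by (simp add: d_mult r_generator l_simps l_mult)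
  then show ?case by blast
next
  case (add f g)
  then obtain a b a' b' where "d f = l a (d z) + l b (d zs)" "d g = l a' (d z) + l b' (d zs)" by blast
  then have "d (f + g) = l (a + a') (d z) + l (b + b') (d zs)"
    by (simp add: clinear_add[OF clinear_d] l_simps)
  then show ?case by blast
next
  case (scale c f)
  then obtain a b where "d f = l a (d z) + l b (d zs)" by blast
  then have "d (c *\<^sub>C f) = l (c *\<^sub>C a) (d z) + l (c *\<^sub>C b) (d zs)"
    by (simp add: clinear_scaleC[OF clinear_d] l_simps scaleC_add_right)
  then show ?case by blast
qed

text \<open>The two differentials are free generators of the left module: \<open>a \<otimes> b \<mapsto> a * kk b\<close> moves the right
  coefficient to the left and vanishes on the defining relations.\<close>

lemma generators_free:
  assumes "l a (d z) + l b (d zs) = 0"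
  shows "a = 0 \<and> b = 0"
proof -
  let ?\<psi> = "tensor_lift (\<lambda>a b. a * kk b)"
  have bil: "cbilinear (\<lambda>a b. a * kk b)"
    by (rule cbilinear_comp[OF cbilinear_mult clinear_ident lin(1)])
  note lift = clinear_tensor_lift[OF bil]
  note lifts = clinear_diff[OF lift] clinear_scaleC[OF lift] clinear_zero[OF lift] clinear_add[OF lift] tensor_lift_tens[OF bil]
  have \<psi>: "?\<psi> ((a \<otimes> 1) * x * (1 \<otimes> b)) = a * ?\<psi> x * kk b" for a b x
    by (induction x rule: tensor_induct)
      (simp_all add: lifts distrib_left distrib_right tensor_mult_tens kk_mult mult.assoc)
  have rel: "?\<psi> x = 0 \<and> ?\<psi> y = 0" if "(x, y) \<in> calculus_rels q z zs" for x y
    using that unfolding calculus_rels_def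
    by (auto simp: lifts kk_one kk_z kk_zs mult_scaleC_right q_scale simp del: of_real_power of_real_divide)
  have sub: "?\<psi> (fst u) = 0 \<and> ?\<psi> (snd u) = 0" if "u \<in> sub_bimod (calculus_rels q z zs)" for u
    using that unfolding sub_bimod_def
  proof (induction rule: complex_vector.span_induct_alt)
    case (step c x y)
    then obtain a b u v where "x = ((a \<otimes> 1) * u * (1 \<otimes> b), (a \<otimes> 1) * v * (1 \<otimes> b))" "(u, v) \<in> calculus_rels q z zs"
      by blast
    then show ?case using step rel[of u v] by (simp add: lifts \<psi> scaleC_prod_def)
  qed (simp add: lifts)
  have "free_bimod_eval l r (d z) (d zs) (a \<otimes> 1, b \<otimes> 1) = 0"
    using assms by (simp add: free_bimod_eval_def free_bimod_eval_tens r_one)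
  then have "(a \<otimes> 1, b \<otimes> 1) \<in> sub_bimod (calculus_rels q z zs)" by (simp add: kernel)
  from sub[OF this] show ?thesis by (simp add: lifts kk_one)
qed

lemma partials_r_eqI:
  assumes "d f = l a (d z) + l b (d zs)"
  shows "partials_r z zs l d f = (a, b)"
  unfolding partials_r_def
proof (rule the_equality)
  show "case (a, b) of (a, b) \<Rightarrow> d f = l a (d z) + l b (d zs)" using assms by simp
next
  fix p assume "case p of (a, b) \<Rightarrow> d f = l a (d z) + l b (d zs)"
  then obtain a' b' where p: "p = (a', b')" "d f = l a' (d z) + l b' (d zs)" by (cases p) auto
  then have "l (a' - a) (d z) + l (b' - b) (d zs) = 0"
    using assms by (simp add: clinear_diff[OF cbilinear_clinear(2)[OF bilinear(1)]] algebra_simps)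
  then show "p = (a, b)" using generators_free p(1) by fastforce
qed

text \<open>\<open>r_generator\<close> turns right coefficients into left ones through the injective
  map \<open>kk\<close>, so uniqueness again comes from \<open>generators_free\<close>.\<close>

lemma partials_l_eqI:
  assumes "d f = r (d z) a + r (d zs) b"
  shows "partials_l z zs r d f = (a, b)"
  unfolding partials_l_def
proof (rule the_equality)
  show "case (a, b) of (a, b) \<Rightarrow> d f = r (d z) a + r (d zs) b" using assms by simp
next
  fix p assume "case p of (a, b) \<Rightarrow> d f = r (d z) a + r (d zs) b"
  then obtain a' b' where p: "p = (a', b')" "d f = r (d z) a' + r (d zs) b'" by (cases p) auto
  then have "l (kk a' - kk a) (d z) + l (kk b' - kk b) (d zs) = 0"
    using assms by (simp add: clinear_diff[OF cbilinear_clinear(2)[OF bilinear(1)]] r_generator algebra_simps)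
  then have "kk a' = kk a" "kk b' = kk b" using generators_free by fastforce+
  then show "p = (a, b)" using p(1) by (metis ki_kk)
qed

definition D :: "'p \<Rightarrow> 'p" where "D f = snd (partials_r z zs l d f)"
definition D' :: "'p \<Rightarrow> 'p" where "D' f = fst (partials_l z zs r d f)"

lemma D_ex: "\<exists>a. d f = l a (d z) + l (D f) (d zs)"
  using partials_ex[of f] partials_r_eqI[of f] by (auto simp: D_def)

lemma D'_ex: "\<exists>b. d f = r (d z) (D' f) + r (d zs) b"
  using partials_ex[of f] partials_l_eqI[of f] by (auto simp: D'_def l_generator)

lemma D_eqI: "d f = l a (d z) + l b (d zs) \<Longrightarrow> D f = b"
  by (simp add: D_def partials_r_eqI)

lemma D'_eqI: "d f = r (d z) a + r (d zs) b \<Longrightarrow> D' f = a"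
  by (simp add: D'_def partials_l_eqI)

lemma clinear_D: "clinear D"
proof (rule clinearI)
  fix f g c
  obtain a b where ab: "d f = l a (d z) + l (D f) (d zs)" "d g = l b (d z) + l (D g) (d zs)"
    using D_ex by blast
  show "D (f + g) = D f + D g"
    by (rule D_eqI[of _ "a + b"]) (simp add: clinear_add[OF clinear_d] ab l_simps)
  show "D (c *\<^sub>C f) = c *\<^sub>C D f"
    by (rule D_eqI[of _ "c *\<^sub>C a"]) (simp add: clinear_scaleC[OF clinear_d] ab(1) l_simps scaleC_add_right)
qed

lemma clinear_D': "clinear D'"
proof (rule clinearI)
  fix f g c
  obtain a b where ab: "d f = r (d z) (D' f) + r (d zs) a" "d g = r (d z) (D' g) + r (d zs) b"
    using D'_ex by blast
  show "D' (f + g) = D' f + D' g"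
    by (rule D'_eqI[of _ _ "a + b"]) (simp add: clinear_add[OF clinear_d] ab r_simps)
  show "D' (c *\<^sub>C f) = c *\<^sub>C D' f"
    by (rule D'_eqI[of _ _ "c *\<^sub>C a"]) (simp add: clinear_scaleC[OF clinear_d] ab(1) r_simps scaleC_add_right)
qed

lemma D_mult: "D (f * g) = D f * kk g + f * D g"
proof -
  obtain a b where ab: "d f = l a (d z) + l (D f) (d zs)" "d g = l b (d z) + l (D g) (d zs)"
    using D_ex by blast
  show ?thesis
    by (rule D_eqI[of _ "a * kk g + f * b"])
      (simp add: d_mult ab l_simps r_simps l_r r_generator l_mult)
qed

lemma D'_mult: "D' (f * g) = D' f * g + ki f * D' g"
proof -
  obtain a b where ab: "d f = r (d z) (D' f) + r (d zs) a" "d g = r (d z) (D' g) + r (d zs) b"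
    using D'_ex by blast
  show ?thesis
    by (rule D'_eqI[of _ _ "a * g + ki f * b"])
      (simp add: d_mult ab l_simps r_simps l_r[symmetric] l_generator r_mult)
qed

lemma D_generators: "D z = 0" "D zs = 1" "D' z = 1" "D' zs = 0"
  by (rule D_eqI[of _ 1] D_eqI[of _ 0] D'_eqI[of _ _ 0] D'_eqI[of _ _ 1];
      simp add: l_simps r_simps l_one r_one)+

end

section \<open>The module algebra\<close>

lemma is_module_fps_map:
  assumes "is_module act"
  shows "is_module (\<lambda>\<xi>. fps_map (act \<xi>))"
  using assms unfolding is_module_def
  by (auto intro!: cbilinearI simp: fps_eq_iff fps_map_nth fps_scaleC_nth cbilinearD)

section \<open>The Hopf algebra on generators\<close>

lemma Uq_su11_relations:
  assumes "Uq_su11 q K Kinv E F \<Delta> \<epsilon> S ust"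
  shows "K * Kinv = 1" "Kinv * K = 1" "K * E = complex_of_real (q\<^sup>2) *\<^sub>C (E * K)"
    "K * F = complex_of_real (1 / q\<^sup>2) *\<^sub>C (F * K)"
proof -
  have "presented_by (case_uq_gen K Kinv E F) (uq_rels q)"
    using assms by (simp add: Uq_su11_def)
  note rel = presented_by_rel[OF this, unfolded uq_rels_def]
  show "K * Kinv = 1"
    using rel[of "gen GenK * gen GenKinv - 1"] by (simp add: free_eval_simps)
  show "Kinv * K = 1"
    using rel[of "gen GenKinv * gen GenK - 1"] by (simp add: free_eval_simps)
  show "K * E = complex_of_real (q\<^sup>2) *\<^sub>C (E * K)"
    using rel[of "gen GenK * gen GenE - complex_of_real (q^2) *\<^sub>C (gen GenE * gen GenK)"]
    by (simp add: free_eval_simps del: of_real_power of_real_divide)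
  show "K * F = complex_of_real (1 / q\<^sup>2) *\<^sub>C (F * K)"
    using rel[of "gen GenK * gen GenF - complex_of_real (1 / q^2) *\<^sub>C (gen GenF * gen GenK)"]
    by (simp add: free_eval_simps del: of_real_power of_real_divide)
qed

text \<open>These values translate the compatibility with the involution into an exchange of E with
  F and of K with its inverse, and so give the action on \<open>zs\<close> from that on z.\<close>

lemma Uq_su11_star_antipode:
  assumes U: "Uq_su11 q K Kinv E F \<Delta> \<epsilon> S ust"
  shows "ust (S K) = Kinv" "ust (S Kinv) = K" "ust (S E) = complex_of_real (1 / q\<^sup>2) *\<^sub>C F"
    "ust (S F) = complex_of_real (q\<^sup>2) *\<^sub>C E"
proof -
  note d = U[unfolded Uq_su11_def]
  note rel = Uq_su11_relations[OF U]
  have m: "ust (x * y) = ust y * ust x" "ust (c *\<^sub>C x) = cnj c *\<^sub>C ust x" for x y c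
    using d by (auto simp: antilinear_antihom_def antilinear_def)
  have neg: "ust (- x) = - ust x" for x
    using m(2)[of "- 1" x] by (simp add: scaleC_one)
  show "ust (S K) = Kinv" "ust (S Kinv) = K" using d by simp_all
  have "ust (S E) = K * F * Kinv" using d by (simp add: neg m(1))
  then show "ust (S E) = complex_of_real (1 / q\<^sup>2) *\<^sub>C F"
    by (simp add: rel mult_scaleC_left mult.assoc del: of_real_power of_real_divide)
  have "ust (S F) = K * E * Kinv" using d by (simp add: neg m(1) mult.assoc)
  then show "ust (S F) = complex_of_real (q\<^sup>2) *\<^sub>C E"
    by (simp add: rel mult_scaleC_left mult.assoc del: of_real_power of_real_divide)
qed

lemma module_algebra_generators:
  assumes U: "Uq_su11 q K Kinv E F \<Delta> \<epsilon> S ust"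
    and mod: "is_module act" "cbilinear mul"
    and cov: "\<And>\<xi> t. act \<xi> (tensor_lift mul t) = tensor_lift mul (tensor_act act (\<Delta> \<xi>) t)"
  shows "act K (mul f g) = mul (act K f) (act K g)" "act Kinv (mul f g) = mul (act Kinv f) (act Kinv g)"
    "act E (mul f g) = mul (act E f) g + mul (act K f) (act E g)"
    "act F (mul f g) = mul (act F f) (act Kinv g) + mul f (act F g)"
proof -
  have bil: "cbilinear act" and one: "act 1 = (\<lambda>f. f)" using mod by (auto simp: is_module_def)
  note simps = tensor_lift_tens[OF mod(2)] tensor_act_tens[OF bil] tensor_map_tens cbilinear_clinear(1)[OF bil]
    clinear_add[OF clinear_tensor_act_left[OF bil]] clinear_add[OF clinear_tensor_lift[OF mod(2)]] one clinear_ident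
  note cov' = cov[of _ "f \<otimes> g", unfolded simps(1)]
  show "act K (mul f g) = mul (act K f) (act K g)" "act Kinv (mul f g) = mul (act Kinv f) (act Kinv g)"
    "act E (mul f g) = mul (act E f) g + mul (act K f) (act E g)"
    "act F (mul f g) = mul (act F f) (act Kinv g) + mul f (act F g)"
    unfolding cov' using U one by (simp_all add: Uq_su11_def simps cbilinear_clinear(1)[OF bil, of 1, unfolded one])
qed

context disc_calculus
begin

lemma box_eq_T:
  "tensor_lift (\<lambda>f g. (D f \<otimes> 1) * (complex_of_real (1 / q^2) *\<^sub>C
        (1 - complex_of_real (1 + 1 / q^2) *\<^sub>C (zs \<otimes> z) + complex_of_real (1 / q^2) *\<^sub>C ((zs^2) \<otimes> (z^2))))
      * (1 \<otimes> D' g)) = T"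
proof -
  have e: "complex_of_real (1 / q\<^sup>2) = iw" "complex_of_real (1 + 1 / q\<^sup>2) = 1 + iw"
    by (simp_all add: iw_def)
  have "(u \<otimes> 1) * (iw *\<^sub>C (1 - (1 + iw) *\<^sub>C (zs \<otimes> z) + iw *\<^sub>C ((zs^2) \<otimes> (z^2)))) * (1 \<otimes> v) = box_term u v" for u v
    unfolding box_term_def one_tensor_def
    by (simp only: mult_scaleC_left mult_scaleC_right distrib_left distrib_right left_diff_distrib right_diff_distrib
        tensor_mult_tens power2_eq_square mult_1_left mult_1_right mult.assoc)
  then show ?thesis unfolding T_def e by simp
qed

end

theorem proposition6p1:
  fixes q :: real
    and z zs :: "'p::complex_algebra_1" and st :: "'p \<Rightarrow> 'p"
    and l :: "'p \<Rightarrow> 'w::complex_vector \<Rightarrow> 'w" and r :: "'w \<Rightarrow> 'p \<Rightarrow> 'w" and d :: "'p \<Rightarrow> 'w"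
    and K Kinv E F :: "'u::complex_algebra_1" and \<Delta> :: "'u \<Rightarrow> ('u, 'u) tensor"
    and \<epsilon> :: "'u \<Rightarrow> complex" and S ust :: "'u \<Rightarrow> 'u"
    and act :: "'u \<Rightarrow> 'p \<Rightarrow> 'p"
  assumes q: "0 < q" "q < 1"
    and Pol: "Pol_alg q z zs" "Pol_star z zs st"
    and calculus: "Pol_calculus q z zs l r d"
    and U: "Uq_su11 q K Kinv E F \<Delta> \<epsilon> S ust"
    and act: "star_module_algebra \<Delta> \<epsilon> S ust act (*) st"
    and act_z: "act K z = complex_of_real (q^2) *\<^sub>C z"
      "act Kinv z = complex_of_real (1 / q^2) *\<^sub>C z"
      "act F z = complex_of_real (q powr (1/2)) *\<^sub>C 1"
      "act E z = - (complex_of_real (q powr (1/2)) *\<^sub>C z^2)"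
  shows "star_module_algebra \<Delta> \<epsilon> S ust
    (\<lambda>\<xi>. fps_map (act \<xi>)) (fps_m q z zs l r d) (fps_map st)"
proof -
  have mod: "is_module act"
    and cov: "act \<xi> (tensor_lift (*) t) = tensor_lift (*) (tensor_act act (\<Delta> \<xi>) t)"
    and unit: "is_unit_of (*) e \<Longrightarrow> act \<xi> e = \<epsilon> \<xi> *\<^sub>C e"
    and inv: "antilinear st" "st (st f) = f" "st (f * g) = st g * st f"
    and st_act: "st (act \<xi> f) = act (ust (S \<xi>)) (st f)" for \<xi> t e f g
    using act by (auto simp: star_module_algebra_def module_algebra_def is_involution_def)
  note bil = mod[unfolded is_module_def, THEN conjunct1]
  note gens = module_algebra_generators[OF U mod cbilinear_mult cov]
  note SU = Uq_su11_star_antipode[OF U]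
  have st_z: "st z = zs" using Pol(2) by (simp add: Pol_star_def)
  have st_scale: "st (c *\<^sub>C f) = cnj c *\<^sub>C st f" for c f
    using inv(1) by (simp add: antilinear_def)
  have act_one: "act \<xi> 1 = \<epsilon> \<xi> *\<^sub>C 1" for \<xi>
    by (rule unit) (simp add: is_unit_of_def)
  have \<epsilon>: "\<epsilon> K = 1" "\<epsilon> Kinv = 1"
  proof -
    have "clinear \<epsilon>" "\<epsilon> 1 = 1" "\<epsilon> (K - 1) = 0" "\<epsilon> (Kinv - 1) = 0"
      using U by (simp_all add: Uq_su11_def alg_hom_def)
    then show "\<epsilon> K = 1" "\<epsilon> Kinv = 1" by (simp_all add: clinear_diff)
  qed
  have KK: "act K (act Kinv f) = f" "act Kinv (act K f) = f" for f
    using mod Uq_su11_relations(1,2)[OF U] unfolding is_module_def by metis+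
  \<comment> \<open>Obtained by applying the involution to the actions of \<open>Kinv\<close> and E
    on z.\<close>
  have act_zs: "act K zs = complex_of_real (1 / q\<^sup>2) *\<^sub>C zs"
    "act F zs = - ((complex_of_real (q powr (1/2)) * complex_of_real (q\<^sup>2)) *\<^sub>C zs\<^sup>2)"
  proof -
    show "act K zs = complex_of_real (1 / q\<^sup>2) *\<^sub>C zs"
      using st_act[of Kinv z] by (simp add: SU act_z st_scale st_z del: of_real_power of_real_divide)
    have neg: "st (- f) = - st f" for f using st_scale[of "- 1" f] by (simp add: scaleC_one)
    have "complex_of_real (1 / q\<^sup>2) *\<^sub>C act F zs = - (complex_of_real (q powr (1/2)) *\<^sub>C zs\<^sup>2)"
      using st_act[of E z]
      by (simp add: SU act_z st_scale st_z neg power2_eq_square inv(3) cbilinearD[OF bil]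
          del: of_real_power of_real_divide)
    then have "complex_of_real (q\<^sup>2) *\<^sub>C complex_of_real (1 / q\<^sup>2) *\<^sub>C act F zs =
        complex_of_real (q\<^sup>2) *\<^sub>C - (complex_of_real (q powr (1/2)) *\<^sub>C zs\<^sup>2)" by (simp only:)
    moreover have "complex_of_real (q\<^sup>2) * complex_of_real (1 / q\<^sup>2) = 1" using q by simp
    ultimately show "act F zs = - ((complex_of_real (q powr (1/2)) * complex_of_real (q\<^sup>2)) *\<^sub>C zs\<^sup>2)"
      by (simp only: scaleC_scaleC scaleC_one complex_vector.scale_minus_right mult.commute)
  qed
  note act_lin = cbilinear_clinear(1)[OF bil]
  \<comment> \<open>This interpretation precedes the next one, whose derivative parameters are
    \<open>c.D\<close> and \<open>c.D'\<close>.\<close>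
  interpret c: pol_calculus q z zs "act K" "act Kinv" l r d
    by (rule pol_calculus.intro)
      (simp_all add: q Pol calculus act_lin gens act_one \<epsilon> KK act_z act_zs scaleC_one del: of_real_power of_real_divide)
  interpret disc_calculus q "complex_of_real (q powr (1/2))" z zs st "act K" "act Kinv" "act E" "act F" c.D c.D'
  proof (rule disc_calculus.intro)
    show "complex_of_real (q powr (1/2)) \<noteq> 0" using q by simp
    show "zs * z = complex_of_real (q\<^sup>2) *\<^sub>C (z * zs) + complex_of_real (1 - q\<^sup>2) *\<^sub>C 1"
      by (rule Pol_alg_rel[OF Pol(1)])
    show "P f" if "P 1" "\<And>f. P f \<Longrightarrow> P (z * f)" "\<And>f. P f \<Longrightarrow> P (zs * f)"
      "\<And>f g. P f \<Longrightarrow> P g \<Longrightarrow> P (f + g)" "\<And>c f. P f \<Longrightarrow> P (c *\<^sub>C f)" for P f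
      by (rule Pol_alg_induct[OF Pol(1), of P]) (fact that)+
    show "st (act F f) = complex_of_real (q\<^sup>2) *\<^sub>C act E (st f)" for f
      by (simp add: st_act SU cbilinearD[OF bil] del: of_real_power)
    show "act Kinv z = (1 / complex_of_real (q\<^sup>2)) *\<^sub>C z" by (simp add: act_z)
  qed (simp_all add: q act_lin gens act_one \<epsilon> act_z act_zs inv st_z st_act SU c.clinear_D c.clinear_D'
      c.D_mult c.D'_mult c.D_generators scaleC_one del: of_real_power of_real_divide)
  have "box q z zs l r d = T"
    unfolding box_eq_T[symmetric] box_def c.D_def c.D'_def ..
  \<comment> \<open>At k = 0 the subtraction k - 1 would be truncated; there
    \<open>star_prod\<close> is the plain product, in agreement with
    \<open>s_poly q 0 = 1\<close>.\<close>
  then have star: "fps_nth (star_prod q z zs l r d f g) k = mu k f g" for f g k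
    by (cases k) (simp_all add: star_prod_def mu_0, simp add: C_coeff_def mu_def M_def s_poly_def poly_op_diff)
  have fps_m: "fps_m q z zs l r d = conv mu"
    by (rule ext)+ (simp add: fps_m_def conv_def fps_sum_nth star)
  have bil': "cbilinear (conv mu)"
    by (rule cbilinear_conv) (rule cbilinear_mu)
  have assoc: "conv mu (conv mu f g) h = conv mu f (conv mu g h)" for f g h
    by (rule conv_assoc) (rule cbilinear_mu, rule mu_assoc)
  have one: "is_unit_of (conv mu) 1"
    by (rule conv_unit) (simp_all add: cbilinear_mu mu_one)
  note mod' = is_module_fps_map[OF mod]
  have cov': "fps_map (act \<xi>) (tensor_lift (conv mu) t) =
      tensor_lift (conv mu) (tensor_act (\<lambda>\<xi>. fps_map (act \<xi>)) (\<Delta> \<xi>) t)" for \<xi> t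
  proof (rule covariant_from_generators[where act = "\<lambda>\<xi>. fps_map (act \<xi>)"])
    show "presented_by (case_uq_gen K Kinv E F) (uq_rels q)" "alg_hom \<Delta>"
      using U by (simp_all add: Uq_su11_def)
    fix g :: uq_gen and a b :: "'p fps"
    have bila: "cbilinear (\<lambda>\<xi>. fps_map (act \<xi>))" using mod' by (simp add: is_module_def)
    have one_act: "fps_map (act 1) = (\<lambda>f. f)" using mod' by (auto simp: is_module_def)
    note simps = tensor_lift_tens[OF bil'] tensor_act_tens[OF bila] tensor_map_tens clinear_fps_map[OF act_lin]
      clinear_add[OF clinear_tensor_act_left[OF bila]] clinear_add[OF clinear_tensor_lift[OF bil']]
    have \<Delta>: "\<Delta> K = K \<otimes> K" "\<Delta> Kinv = Kinv \<otimes> Kinv" "\<Delta> E = E \<otimes> 1 + K \<otimes> E" "\<Delta> F = F \<otimes> Kinv + 1 \<otimes> F"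
      using U by (simp_all add: Uq_su11_def)
    show "fps_map (act (case_uq_gen K Kinv E F g)) (conv mu a b) =
      tensor_lift (conv mu) (tensor_act (\<lambda>\<xi>. fps_map (act \<xi>)) (\<Delta> (case_uq_gen K Kinv E F g)) (a \<otimes> b))"
      by (cases g; simp add: \<Delta> simps one_act[THEN fun_cong];
          simp add: fps_eq_iff fps_map_nth conv_nth clinear_sum[OF act_lin] mu_kk mu_ki mu_ee mu_ff sum.distrib)
  qed (fact mod' bil')+
  have "fps_map (act \<xi>) e = \<epsilon> \<xi> *\<^sub>C e" if "is_unit_of (conv mu) e" for \<xi> e
  proof -
    \<comment> \<open>A unit is unique, so the condition on all units concerns the constant series 1
      alone.\<close>
    have "e = 1" using that one unfolding is_unit_of_def by metis
    then show ?thesis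
      by (simp add: fps_eq_iff fps_map_nth fps_scaleC_nth act_one clinear_zero[OF act_lin])
  qed
  then have "module_algebra \<Delta> \<epsilon> (\<lambda>\<xi>. fps_map (act \<xi>)) (conv mu)"
    unfolding module_algebra_def is_algebra_def using bil' assoc mod' cov' by blast
  moreover have "is_involution (conv mu) (fps_map st)"
    unfolding is_involution_def
  proof (intro conjI allI)
    show "antilinear (fps_map st)"
      by (simp add: antilinear_def fps_eq_iff fps_map_nth fps_scaleC_nth st_add st_scale)
    show "fps_map st (fps_map st f) = f" for f
      by (simp add: fps_eq_iff fps_map_nth inv)
    show "fps_map st (conv mu f g) = conv mu (fps_map st g) (fps_map st f)" for f g
      by (rule conv_antihom) (simp_all add: st_add st_zero mu_st)
  qed
  ultimately show ?thesis
    unfolding star_module_algebra_def fps_m by (simp add: fps_eq_iff fps_map_nth st_act)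
qed

end
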